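(* Let each finite irreducible Coxeter group be identified with its standard representation as an essential irreducible finite reflection group, and let $\kappa$ denote the optimal max filtering condition number. For the exceptional groups: - $\kappa(E_6)=\kappa(F_4)\approx 7.5957$, with minimal polynomial over $\mathbb{Q}$ equal to $x^4-8x^3+2x^2+8x+1$; - $\kappa(E_7)\approx 11.4301$, with minimal polynomial $x^6-12x^5+3x^4+40x^3+3x^2-12x+1$; - $\kappa(E_8)=\kappa(H_4)\approx 19.0811$, with minimal polynomial $x^8-16x^7-60x^6+16x^5+134x^4+16x^3-60x^2-16x+1$; - $\kappa(H_3)\approx 6.3137$, with minimal polynomial $x^4-4x^3-14x^2-4x+1$. (Here $\approx$ means agreement to within $10^{-4}$.) For the remaining groups: (a) $\kappa(A_\ell)=(\frac{2}{\pi}+o(1))\,\ell$ as $\ell\to\infty$; (b) $\kappa(B_\ell)=(\frac{4}{\pi}+o(1))\,\ell$ as $\ell\to\infty$; (c) $\kappa(D_\ell)=(\frac{4}{\pi}+o(1))\,\ell$ as $\ell\to\infty$; (d) $\kappa(I_m)=\sqrt{\frac{1+\cos(\pi/m)}{1-\cos(\pi/m)}}$ for every $m$, and this equals $(\frac{2}{\pi}+o(1))\,m$ as $m\to\infty$.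
   Context: Max filtering. For a finite group $G\leq\operatorname{O}(d)$, $\mathbb{R}^d/G$ is the set of orbits $G\cdot x$ with metric $d(G\cdot x,G\cdot y)=\min_{p\in G\cdot x,\,q\in G\cdot y}\|p-q\|$. Put $\langle\!\langle G\cdot x,G\cdot y\rangle\!\rangle=\max_{p\in G\cdot x,\,q\in G\cdot y}\langle p,q\rangle$. Given templates $t_1,\dots,t_n\in\mathbb{R}^d$, the max filter bank is $\Phi\colon\mathbb{R}^d/G\to\mathbb{R}^n$, $\Phi(G\cdot x)=\{\langle\!\langle G\cdot t_i,G\cdot x\rangle\!\rangle\}_{i=1}^n$. The optimal max filtering condition number $\kappa(G)$ is the infimum of quotients $C/c$ over all $n\in\mathbb{N}$, templates $t_1,\dots,t_n\in\mathbb{R}^d$, and constants $C,c>0$ such that $c\,d(G\cdot x,G\cdot y)\le\|\Phi(G\cdot x)-\Phi(G\cdot y)\|\le C\,d(G\cdot x,G\cdot y)$ for all $x,y\in\mathbb{R}^d$. Standard representations. For nonzero $u\in\mathbb{R}^d$, let $R(u)=I-\frac{2}{\|u\|^2}uu^\top$. A Coxeter diagram is a graph on vertices $\{1,\dots,d\}$, some of whose edges are labeled by integers $\geq4$; set $m_{ij}=2$ for nonadjacent $i\ne j$, $m_{ij}=3$ for unlabeled edges, and $m_{ij}$ equal to the label for labeled edges. The associated essential reflection group in $\operatorname{O}(d)$ (unique up to orthogonal conjugation) is the group generated by $R(\alpha_1),\dots,R(\alpha_d)$, where $\alpha_1,\dots,\alpha_d\in\mathbb{R}^d$ are unit vectors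 forming a basis with $\langle\alpha_i,\alpha_j\rangle=-\cos(\pi/m_{ij})$ for $i\neq j$. The diagrams are: $A_\ell$: path on $\ell$ vertices, no labels; $B_\ell$: path on $\ell$ vertices with one end edge labeled $4$; $D_\ell$: path on $\ell-1$ vertices with one additional vertex adjacent to the second-to-last vertex of the path, no labels; $E_n$ for $n\in\{6,7,8\}$: path on $n-1$ vertices with one additional vertex adjacent to the third vertex of the path, no labels; $F_4$: path on $4$ vertices with middle edge labeled $4$; $H_n$ for $n\in\{3,4\}$: path on $n$ vertices with one end edge labeled $5$; $I_m$ ($m\ge3$): two vertices joined by an edge with $m_{12}=m$ (dihedral group of order $2m$ acting on $\mathbb{R}^2$). *)

theory Defs
  imports
    "Jordan_Normal_Form.VS_Connect"
    "HOL-Algebra.Generated_Groups"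
    "HOL-Library.Landau_Symbols"
begin

text \<open>
  The dimension varies with the group (and tends to infinity in the asymptotic statements), so
  Euclidean space is \<^term>\<open>carrier_vec d :: real vec set\<close>, and groups of isometries are sets of
  real matrices. All indices start at 0.
\<close>

section \<open>Max filtering\<close>

definition euclid_norm :: "real vec \<Rightarrow> real" where
  "euclid_norm v = sqrt (v \<bullet> v)"

definition orbit :: "real mat set \<Rightarrow> real vec \<Rightarrow> real vec set" where
  "orbit G x = {g *\<^sub>v x | g. g \<in> G}"

text \<open>The minimum and the maximum below are taken over finite nonempty sets as soon as the group
  is finite.\<close>

definition orbit_dist :: "real vec set \<Rightarrow> real vec set \<Rightarrow> real" where
  "orbit_dist P Q = Min {euclid_norm (p - q) | p q. p \<in> P \<and> q \<in> Q}"

definition max_filter :: "real vec set \<Rightarrow> real vec set \<Rightarrow> real" where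
  "max_filter P Q = Max {p \<bullet> q | p q. p \<in> P \<and> q \<in> Q}"

definition max_filter_bank ::
  "real mat set \<Rightarrow> nat \<Rightarrow> (nat \<Rightarrow> real vec) \<Rightarrow> real vec set \<Rightarrow> real vec" where
  "max_filter_bank G n t P = vec n (\<lambda>i. max_filter (orbit G (t i)) P)"

definition bilipschitz_bank ::
  "nat \<Rightarrow> real mat set \<Rightarrow> nat \<Rightarrow> (nat \<Rightarrow> real vec) \<Rightarrow> real \<Rightarrow> real \<Rightarrow> bool" where
  "bilipschitz_bank d G n t c C \<longleftrightarrow>
     (\<forall>x\<in>carrier_vec d. \<forall>y\<in>carrier_vec d.
        c * orbit_dist (orbit G x) (orbit G y)
          \<le> euclid_norm (max_filter_bank G n t (orbit G x) - max_filter_bank G n t (orbit G y)) \<and>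
        euclid_norm (max_filter_bank G n t (orbit G x) - max_filter_bank G n t (orbit G y))
          \<le> C * orbit_dist (orbit G x) (orbit G y))"

definition kappa :: "nat \<Rightarrow> real mat set \<Rightarrow> real" where
  "kappa d G = Inf {C / c | n t C c.
     (\<forall>i<n. t i \<in> carrier_vec d) \<and> 0 < C \<and> 0 < c \<and> bilipschitz_bank d G n t c C}"

section \<open>Reflection groups\<close>

definition orthogonal_group :: "nat \<Rightarrow> real mat monoid" where
  "orthogonal_group d =
     \<lparr>carrier = {A \<in> carrier_mat d d. A\<^sup>T * A = 1\<^sub>m d}, mult = (*), one = 1\<^sub>m d\<rparr>"

definition reflection :: "nat \<Rightarrow> real vec \<Rightarrow> real mat" where
  "reflection d u = 1\<^sub>m d - (2 / (euclid_norm u)\<^sup>2) \<cdot>\<^sub>m mat d d (\<lambda>(i, j). u $ i * u $ j)"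

text \<open>A diagram has vertices \<open>0, \<dots>, rank - 1\<close>; edges are two-element sets, and
  \<^term>\<open>None\<close> marks an edge without label.\<close>

record coxeter_diagram =
  rank :: nat
  edges :: "nat set set"
  label :: "nat set \<Rightarrow> nat option"

definition coxeter_order :: "coxeter_diagram \<Rightarrow> nat \<Rightarrow> nat \<Rightarrow> nat" where
  "coxeter_order \<Gamma> i j =
     (if {i, j} \<notin> edges \<Gamma> then 2
      else case label \<Gamma> {i, j} of None \<Rightarrow> 3 | Some k \<Rightarrow> k)"

definition simple_system :: "coxeter_diagram \<Rightarrow> (nat \<Rightarrow> real vec) \<Rightarrow> bool" where
  "simple_system \<Gamma> \<alpha> \<longleftrightarrow>
     (\<forall>i<rank \<Gamma>. \<alpha> i \<in> carrier_vec (rank \<Gamma>) \<and> euclid_norm (\<alpha> i) = 1) \<and>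
     inj_on \<alpha> {..<rank \<Gamma>} \<and>
     vectorspace.basis class_ring (module_vec TYPE(real) (rank \<Gamma>)) (\<alpha> ` {..<rank \<Gamma>}) \<and>
     (\<forall>i<rank \<Gamma>. \<forall>j<rank \<Gamma>. i \<noteq> j \<longrightarrow>
        \<alpha> i \<bullet> \<alpha> j = - cos (pi / real (coxeter_order \<Gamma> i j)))"

text \<open>The group is unique only up to orthogonal conjugation, hence a predicate.\<close>

definition standard_representation :: "coxeter_diagram \<Rightarrow> real mat set \<Rightarrow> bool" where
  "standard_representation \<Gamma> G \<longleftrightarrow>
     (\<exists>\<alpha>. simple_system \<Gamma> \<alpha> \<and>
        G = generate (orthogonal_group (rank \<Gamma>)) (reflection (rank \<Gamma>) ` \<alpha> ` {..<rank \<Gamma>}))"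

definition path_edges :: "nat \<Rightarrow> nat set set" where
  "path_edges n = {{i, Suc i} | i. Suc i < n}"

definition diagram_A :: "nat \<Rightarrow> coxeter_diagram" where
  "diagram_A l = \<lparr>rank = l, edges = path_edges l, label = Map.empty\<rparr>"

definition diagram_B :: "nat \<Rightarrow> coxeter_diagram" where
  "diagram_B l = \<lparr>rank = l, edges = path_edges l, label = [{l - 2, l - 1} \<mapsto> 4]\<rparr>"

definition diagram_D :: "nat \<Rightarrow> coxeter_diagram" where
  "diagram_D l =
     \<lparr>rank = l, edges = path_edges (l - 1) \<union> {{l - 3, l - 1}}, label = Map.empty\<rparr>"

definition diagram_E :: "nat \<Rightarrow> coxeter_diagram" where
  "diagram_E n =
     \<lparr>rank = n, edges = path_edges (n - 1) \<union> {{2, n - 1}}, label = Map.empty\<rparr>"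

definition diagram_F4 :: coxeter_diagram where
  "diagram_F4 = \<lparr>rank = 4, edges = path_edges 4, label = [{1, 2} \<mapsto> 4]\<rparr>"

definition diagram_H :: "nat \<Rightarrow> coxeter_diagram" where
  "diagram_H n = \<lparr>rank = n, edges = path_edges n, label = [{n - 2, n - 1} \<mapsto> 5]\<rparr>"

definition diagram_I :: "nat \<Rightarrow> coxeter_diagram" where
  "diagram_I m = \<lparr>rank = 2, edges = path_edges 2, label = [{0, 1} \<mapsto> m]\<rparr>"

section \<open>Minimal polynomials over the rationals\<close>

definition is_minimal_polynomial :: "rat poly \<Rightarrow> real \<Rightarrow> bool" where
  "is_minimal_polynomial p x \<longleftrightarrow>
     lead_coeff p = 1 \<and> poly (map_poly of_rat p) x = 0 \<and>
     (\<forall>q. q \<noteq> 0 \<and> poly (map_poly of_rat q) x = 0 \<longrightarrow> degree p \<le> degree q)"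

section \<open>Existence of the standard representations\<close>

lemma group_orthogonal_group: "group (orthogonal_group d)"
proof (rule groupI)
  fix A B assume "A \<in> carrier (orthogonal_group d)" "B \<in> carrier (orthogonal_group d)"
  then have A: "A \<in> carrier_mat d d" "A\<^sup>T * A = 1\<^sub>m d" and B: "B \<in> carrier_mat d d" "B\<^sup>T * B = 1\<^sub>m d"
    by (auto simp: orthogonal_group_def)
  have "(A * B)\<^sup>T * (A * B) = (B\<^sup>T * A\<^sup>T) * (A * B)"
    using A B by (simp add: transpose_mult[of _ d d _ d])
  also have "\<dots> = B\<^sup>T * (A\<^sup>T * (A * B))"
    using A(1) B(1) by (intro assoc_mult_mat[of _ d d _ d _ d]) auto
  also have "A\<^sup>T * (A * B) = (A\<^sup>T * A) * B"
    using A(1) B(1) by (intro assoc_mult_mat[of _ d d _ d _ d, symmetric]) auto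
  finally have "(A * B)\<^sup>T * (A * B) = 1\<^sub>m d"
    using A B by simp
  then show "A \<otimes>\<^bsub>orthogonal_group d\<^esub> B \<in> carrier (orthogonal_group d)"
    using A B by (simp add: orthogonal_group_def)
next
  fix A assume "A \<in> carrier (orthogonal_group d)"
  then have A: "A \<in> carrier_mat d d" "A\<^sup>T * A = 1\<^sub>m d"
    by (auto simp: orthogonal_group_def)
  then have "A * A\<^sup>T = 1\<^sub>m d"
    using mat_mult_left_right_inverse[of "A\<^sup>T" d A] by auto
  with A show "\<exists>B\<in>carrier (orthogonal_group d).
      B \<otimes>\<^bsub>orthogonal_group d\<^esub> A = \<one>\<^bsub>orthogonal_group d\<^esub>"
    by (intro bexI[of _ "A\<^sup>T"]) (auto simp: orthogonal_group_def)
qed (auto simp: orthogonal_group_def assoc_mult_mat)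

text \<open>Every diagram below is a tree rooted at \<open>0\<close> in which the parent of a vertex has a smaller
  index; \<open>s\<close> lists the squared diagonal entries of the sparse Cholesky factor of the Gram
  matrix.\<close>

lemma standard_representation_of_tree:
  fixes par :: "nat \<Rightarrow> nat" and s :: "nat \<Rightarrow> real"
  assumes par: "\<And>k. 0 < k \<Longrightarrow> k < d \<Longrightarrow> par k < k"
    and d: "rank \<Gamma> = d"
    and ord: "\<And>i k. i < k \<Longrightarrow> k < d \<Longrightarrow> par k \<noteq> i \<Longrightarrow> coxeter_order \<Gamma> i k = 2"
    and pos: "\<And>i. i < d \<Longrightarrow> 0 < s i"
    and s: "\<And>i. i < d \<Longrightarrow>
      s i = 1 - (\<Sum>k\<in>{i<..<d}. if par k = i then (cos (pi / coxeter_order \<Gamma> i k))\<^sup>2 / s k else 0)"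
  shows "\<exists>G. standard_representation \<Gamma> G"
proof -
  define c where "c i k = cos (pi / real (coxeter_order \<Gamma> i k))" for i k
  define M where "M = mat d d (\<lambda>(i, k). if k = i then sqrt (s i)
    else if i < k \<and> par k = i then - c i k / sqrt (s k) else 0)"
  define \<alpha> where "\<alpha> i = row M i" for i
  have M: "M \<in> carrier_mat d d" by (simp add: M_def)
  have tri: "upper_triangular M" by (auto simp: M_def)
  have diag: "0 \<notin> set (diag_mat M)"
    using pos by (force simp: M_def diag_mat_def)
  interpret vec_space "TYPE(real)" d .
  have rows: "\<alpha> ` {..<d} = set (rows M)"
    using M by (auto simp: \<alpha>_def rows_def)
  have basis: "basis (\<alpha> ` {..<d})"
    unfolding rows by (rule upper_triangular_imp_basis[OF M tri diag])
  have "distinct (rows M)"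
    by (rule upper_triangular_imp_distinct[OF M tri diag])
  then have inj: "inj_on \<alpha> {..<d}"
    using M by (simp add: \<alpha>_def [abs_def] rows_def distinct_map atLeast0LessThan)
  have carrier: "\<alpha> i \<in> carrier_vec d" if "i < d" for i
    using M that by (simp add: \<alpha>_def)
  have entry: "\<alpha> i $ k = (if k = i then sqrt (s i)
      else if i < k \<and> par k = i then - c i k / sqrt (s k) else 0)" if "i < d" "k < d" for i k
    using that by (simp add: \<alpha>_def M_def)
  have unit: "euclid_norm (\<alpha> i) = 1" if i: "i < d" for i
  proof -
    have "\<alpha> i \<bullet> \<alpha> i = (\<Sum>k\<in>{0..<d}. (\<alpha> i $ k)\<^sup>2)"
      using carrier[OF i] by (simp add: scalar_prod_def power2_eq_square)
    also have "\<dots> = (\<Sum>k\<in>{0..<d}. (if k = i then s i else 0)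
        + (if i < k \<and> par k = i then (c i k)\<^sup>2 / s k else 0))"
      using i pos by (intro sum.cong) (auto simp: entry power_divide less_imp_le)
    also have "\<dots> = s i + (\<Sum>k\<in>{0..<d}. if i < k \<and> par k = i then (c i k)\<^sup>2 / s k else 0)"
      using i by (simp add: sum.distrib)
    also have "(\<Sum>k\<in>{0..<d}. if i < k \<and> par k = i then (c i k)\<^sup>2 / s k else 0)
        = (\<Sum>k\<in>{i<..<d}. if par k = i then (c i k)\<^sup>2 / s k else 0)"
      by (intro sum.mono_neutral_cong_right) auto
    finally show ?thesis
      using s[OF i] unfolding euclid_norm_def c_def by simp
  qed
  have ip: "\<alpha> i \<bullet> \<alpha> j = - c i j" if ij: "i < j" "j < d" for i j
  proof -
    have "\<alpha> i \<bullet> \<alpha> j = (\<Sum>k\<in>{0..<d}. \<alpha> i $ k * \<alpha> j $ k)"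
      using carrier[OF ij(2)] by (simp add: scalar_prod_def)
    also have "\<dots> = (\<Sum>k\<in>{0..<d}. if k = j then \<alpha> i $ j * \<alpha> j $ j else 0)"
      using ij by (intro sum.cong) (auto simp: entry)
    also have "\<dots> = \<alpha> i $ j * \<alpha> j $ j"
      using ij by simp
    also have "\<dots> = - c i j"
      using ij pos[of j] ord[OF ij] by (auto simp: entry c_def)
    finally show ?thesis .
  qed
  have "simple_system \<Gamma> \<alpha>"
    unfolding simple_system_def d
  proof (intro conjI allI impI)
    fix i j assume ij: "i < d" "j < d" "i \<noteq> j"
    have sym: "coxeter_order \<Gamma> i j = coxeter_order \<Gamma> j i"
      by (simp add: coxeter_order_def insert_commute)
    show "\<alpha> i \<bullet> \<alpha> j = - cos (pi / real (coxeter_order \<Gamma> i j))"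
    proof (cases "i < j")
      case True
      then show ?thesis using ip ij by (simp add: c_def)
    next
      case False
      with ij have "j < i" by simp
      then have "\<alpha> j \<bullet> \<alpha> i = - c j i" using ip ij by simp
      moreover have "\<alpha> i \<bullet> \<alpha> j = \<alpha> j \<bullet> \<alpha> i"
        using ij carrier by (intro comm_scalar_prod) auto
      ultimately show ?thesis by (simp add: c_def sym)
    qed
  qed (use basis inj carrier unit in auto)
  then show ?thesis
    by (auto simp: standard_representation_def)
qed

lemma path_edges_iff: "i < k \<Longrightarrow> {i, k} \<in> path_edges n \<longleftrightarrow> k = Suc i \<and> k < n"
  by (auto simp: path_edges_def doubleton_eq_iff)

lemma sum_path_children:
  fixes f :: "nat \<Rightarrow> real"
  shows "(\<Sum>k\<in>{i<..<d}. if k - 1 = i then f k else 0) = (if Suc i < d then f (Suc i) else 0)"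
proof -
  have "(\<Sum>k\<in>{i<..<d}. if k - 1 = i then f k else 0)
      = (\<Sum>k\<in>{i<..<d}. if k = Suc i then f k else 0)"
    by (intro sum.cong) auto
  then show ?thesis by simp
qed

lemma standard_representation_exists_A: assumes "l \<ge> 1" shows "\<exists>G. standard_representation (diagram_A l) G"
proof (rule standard_representation_of_tree[where d = l and par = "\<lambda>k. k - 1"
      and s = "\<lambda>i. (real l - real i + 1) / (2 * (real l - real i))"])
  fix i assume i: "i < l"
  have "coxeter_order (diagram_A l) i (Suc i) = 3" if "Suc i < l"
    using that by (simp add: coxeter_order_def diagram_A_def path_edges_iff)
  moreover have "real l - real i > 1" if "Suc i < l" using that by linarith
  ultimately show "(real l - real i + 1) / (2 * (real l - real i)) =
      1 - (\<Sum>k\<in>{i<..<l}. if k - 1 = i then (cos (pi / coxeter_order (diagram_A l) i k))\<^sup>2 /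
        ((real l - real k + 1) / (2 * (real l - real k))) else 0)"
    using i unfolding sum_path_children
    by (cases "Suc i < l") (auto simp: cos_60 field_simps power2_eq_square
        dest!: Suc_lessI[of i l])
qed (auto simp: coxeter_order_def diagram_A_def path_edges_iff)

lemma standard_representation_exists_B: assumes "l \<ge> 2" shows "\<exists>G. standard_representation (diagram_B l) G"
proof (rule standard_representation_of_tree[where d = l and par = "\<lambda>k. k - 1"
      and s = "\<lambda>i. if Suc i = l then 1 else 1 / 2"])
  fix i assume i: "i < l"
  have "coxeter_order (diagram_B l) i (Suc i) = (if Suc (Suc i) = l then 4 else 3)" if "Suc i < l"
    using that assms
    by (auto simp: coxeter_order_def diagram_B_def path_edges_iff doubleton_eq_iff)
  then show "(if Suc i = l then 1 else 1 / 2) =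
      1 - (\<Sum>k\<in>{i<..<l}. if k - 1 = i then (cos (pi / coxeter_order (diagram_B l) i k))\<^sup>2 /
        (if Suc k = l then 1 else 1 / 2) else 0)"
    using i unfolding sum_path_children
    by (auto simp: cos_60 cos_45 power2_eq_square)
qed (auto simp: coxeter_order_def diagram_B_def path_edges_iff)

lemma standard_representation_exists_D: assumes "l \<ge> 4" shows "\<exists>G. standard_representation (diagram_D l) G"
proof (rule standard_representation_of_tree[where d = l
      and par = "\<lambda>k. if k = l - 1 then l - 3 else k - 1"
      and s = "\<lambda>i. if i \<ge> l - 2 then 1 else 1 / 2"])
  fix i k assume "i < k" "k < l" "(if k = l - 1 then l - 3 else k - 1) \<noteq> i"
  then show "coxeter_order (diagram_D l) i k = 2"
    by (auto simp: coxeter_order_def diagram_D_def path_edges_iff doubleton_eq_iff split: if_splits)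
next
  fix i assume i: "i < l"
  let ?f = "\<lambda>k. (cos (pi / coxeter_order (diagram_D l) i k))\<^sup>2 / (if k \<ge> l - 2 then 1 else 1 / 2)"
  have path: "coxeter_order (diagram_D l) i (Suc i) = 3" if "Suc i < l - 1"
    using that by (simp add: coxeter_order_def diagram_D_def path_edges_iff)
  have branch: "coxeter_order (diagram_D l) (l - 3) (l - 1) = 3"
    by (simp add: coxeter_order_def diagram_D_def)
  have "(\<Sum>k\<in>{i<..<l}. if (if k = l - 1 then l - 3 else k - 1) = i then ?f k else 0)
      = (\<Sum>k\<in>{i<..<l}. (if k = Suc i then if Suc i < l - 1 then ?f (Suc i) else 0 else 0)
          + (if k = l - 1 then if i = l - 3 then ?f (l - 1) else 0 else 0))"
    using assms by (intro sum.cong) auto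
  also have "\<dots> = (if Suc i < l - 1 then ?f (Suc i) else 0) + (if i = l - 3 then ?f (l - 1) else 0)"
    using assms i by (auto simp: sum.distrib)
  also have "\<dots> = (if i \<ge> l - 2 then 0 else 1 / 2)"
  proof -
    consider "i + 3 < l" | "i + 3 = l" | "i + 2 = l" | "i + 1 = l" using i by linarith
    then show ?thesis
    proof cases
      case 1
      then show ?thesis using path by (auto simp: cos_60 power2_eq_square)
    next
      case 2
      then have "i = l - 3" "Suc i < l - 1" "l - 2 \<le> Suc i" by auto
      then show ?thesis using path branch assms by (auto simp: cos_60 power2_eq_square)
    qed (use assms in auto)
  qed
  finally show "(if i \<ge> l - 2 then 1 else 1 / 2) =
      1 - (\<Sum>k\<in>{i<..<l}. if (if k = l - 1 then l - 3 else k - 1) = i then ?f k else 0)"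
    by simp
qed (use assms in \<open>auto simp: diagram_D_def split: if_splits\<close>)

lemma standard_representation_exists_I: assumes "m \<ge> 3" shows "\<exists>G. standard_representation (diagram_I m) G"
proof (rule standard_representation_of_tree[where d = 2 and par = "\<lambda>k. k - 1"
      and s = "\<lambda>i. if i = 0 then (sin (pi / m))\<^sup>2 else 1"])
  fix i :: nat assume i: "i < 2"
  have "sin (pi / m) > 0"
    using assms by (intro sin_gt_zero) (auto simp: field_simps)
  then show "0 < (if i = 0 then (sin (pi / m))\<^sup>2 else 1)" by simp
  have "coxeter_order (diagram_I m) 0 1 = m"
    by (simp add: coxeter_order_def diagram_I_def path_edges_iff)
  then show "(if i = 0 then (sin (pi / m))\<^sup>2 else 1) =
      1 - (\<Sum>k\<in>{i<..<2}. if k - 1 = i then (cos (pi / coxeter_order (diagram_I m) i k))\<^sup>2 /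
        (if k = 0 then (sin (pi / m))\<^sup>2 else 1) else 0)"
    using i unfolding sum_path_children by (auto simp: sin_squared_eq less_2_cases_iff)
qed (auto simp: coxeter_order_def diagram_I_def path_edges_iff)

lemma standard_representation_exists_F4: "\<exists>G. standard_representation diagram_F4 G"
proof (rule standard_representation_of_tree[where d = 4 and par = "\<lambda>k. k - 1"
      and s = "\<lambda>i. [1 / 4, 1 / 3, 3 / 4, 1] ! i"])
  fix i :: nat assume "i < 4"
  then consider "i = 0" | "i = 1" | "i = 2" | "i = 3" by linarith
  note i = this
  show "0 < [1 / 4, 1 / 3, 3 / 4, 1 :: real] ! i" using i by cases simp_all
  show "[1 / 4, 1 / 3, 3 / 4, 1 :: real] ! i =
      1 - (\<Sum>k\<in>{i<..<4}. if k - 1 = i then (cos (pi / coxeter_order diagram_F4 i k))\<^sup>2 /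
        [1 / 4, 1 / 3, 3 / 4, 1] ! k else 0)"
    unfolding sum_path_children using i
    by cases (simp_all add: coxeter_order_def diagram_F4_def path_edges_iff doubleton_eq_iff
        cos_60 cos_45 power2_eq_square)
qed (auto simp: coxeter_order_def diagram_F4_def path_edges_iff)

lemma cos_36_bound: "(cos (pi / 5))\<^sup>2 < 2 / 3"
proof -
  define u where "u = cos (pi / 5)"
  have "u > 0" unfolding u_def by (intro cos_gt_zero) (auto simp: field_simps)
  have "cos (3 * (pi / 5)) = - cos (2 * (pi / 5))"
    using cos_pi_minus[of "2 * (pi / 5)"] by (simp add: field_simps)
  then have "4 * u ^ 3 - 3 * u = - (2 * u\<^sup>2 - 1)"
    unfolding u_def cos_treble_cos cos_double_cos .
  then have "(u + 1) * (4 * u\<^sup>2 - 2 * u - 1) = 0"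
    by (simp add: algebra_simps power3_eq_cube power2_eq_square)
  with \<open>u > 0\<close> have u: "4 * u\<^sup>2 - 2 * u - 1 = 0" by simp
  have "u < 5 / 6"
  proof (rule ccontr)
    assume "\<not> u < 5 / 6"
    then have "u * (4 * u - 2) \<ge> (5 / 6) * (4 * (5 / 6) - 2)" by (intro mult_mono) auto
    with u show False by (simp add: power2_eq_square algebra_simps)
  qed
  with u show ?thesis by (simp add: u_def)
qed

lemma standard_representation_exists_H: assumes "n \<in> {3, 4}" shows "\<exists>G. standard_representation (diagram_H n) G"
proof -
  define x where "x = (cos (pi / 5))\<^sup>2"
  have x: "x < 2 / 3" using cos_36_bound by (simp add: x_def)
  define s where "s i = (if Suc i = n then 1 else if i + 2 = n then 1 - x
      else if i + 3 = n then 1 - 1 / (4 * (1 - x)) else 1 - 1 / (4 * (1 - 1 / (4 * (1 - x)))))" for i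
  have 1: "1 - 1 / (4 * (1 - x)) > 1 / 4" using x by (simp add: field_simps)
  then have 2: "1 - 1 / (4 * (1 - 1 / (4 * (1 - x)))) > 0"
    using divide_strict_left_mono[of "1" "4 * (1 - 1 / (4 * (1 - x)))" 1] by simp
  show ?thesis
  proof (rule standard_representation_of_tree[where d = n and par = "\<lambda>k. k - 1" and s = s])
    fix i assume i: "i < n"
    show "0 < s i" using x 1 2 by (simp add: s_def)
    have "coxeter_order (diagram_H n) i (Suc i) = (if i + 2 = n then 5 else 3)" if "Suc i < n"
      using that assms
      by (auto simp: coxeter_order_def diagram_H_def path_edges_iff doubleton_eq_iff)
    then show "s i = 1 - (\<Sum>k\<in>{i<..<n}. if k - 1 = i
        then (cos (pi / coxeter_order (diagram_H n) i k))\<^sup>2 / s k else 0)"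
      using i assms unfolding sum_path_children
      by (auto simp: s_def x_def cos_60 power2_eq_square)
  qed (auto simp: coxeter_order_def diagram_H_def path_edges_iff)
qed

lemma standard_representation_exists_E: assumes "n \<in> {6, 7, 8}" shows "\<exists>G. standard_representation (diagram_E n) G"
proof -
  define s :: "nat \<Rightarrow> real" where "s = (!) (
      if n = 6 then [3/8, 2/5, 5/12, 3/4, 1, 1]
      else if n = 7 then [1/4, 1/3, 3/8, 2/3, 3/4, 1, 1]
      else [1/8, 2/7, 7/20, 5/8, 2/3, 3/4, 1, 1])"
  define par where "par k = (if k = n - 1 then 2 else k - 1)" for k
  have order: "coxeter_order (diagram_E n) i k = (if par k = i then 3 else 2)" if "i < k" "k < n" for i k
    using that assms
    by (auto simp: coxeter_order_def diagram_E_def path_edges_iff doubleton_eq_iff par_def)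
  have rank: "rank (diagram_E n) = n" by (simp add: diagram_E_def)
  have par_less: "par k < k" if "0 < k" "k < n" for k using assms that by (auto simp: par_def)
  show ?thesis
  proof (rule standard_representation_of_tree[where d = n and par = par and s = s])
    fix i assume i: "i < n"
    then have i': "i \<in> {0, 1, 2, 3, 4, 5, 6, 7}" using assms by auto
    then show "0 < s i"
      using assms i by (elim insertE emptyE; simp add: s_def)
    have "(\<Sum>k\<in>{i<..<n}. if par k = i then (cos (pi / coxeter_order (diagram_E n) i k))\<^sup>2 / s k else 0)
        = (\<Sum>k\<in>{i<..<n}. if par k = i then 1 / 4 / s k else 0)"
      by (intro sum.cong) (auto simp: order cos_60 power2_eq_square)
    also have "\<dots> = sum_list (map (\<lambda>k. if par k = i then 1 / 4 / s k else 0) [Suc i..<n])"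
      by (simp add: sum_list_distinct_conv_sum_set greaterThanLessThan_upt)
    also have "\<dots> = 1 - s i"
      using assms i i' by (elim insertE emptyE; simp add: s_def par_def upt_conv_Cons)
    finally show "s i = 1 - (\<Sum>k\<in>{i<..<n}. if par k = i
        then (cos (pi / coxeter_order (diagram_E n) i k))\<^sup>2 / s k else 0)"
      by simp
  qed (use order rank par_less in auto)
qed

end

theory Submission
  imports
    Defs
    "HOL-Computational_Algebra.Fundamental_Theorem_Algebra"
    "HOL-Real_Asymp.Real_Asymp"
    "Berlekamp_Zassenhaus.Factor_Bound"
begin

text \<open>
  On the fundamental chamber of a reflection group the quotient metric is the Euclidean one and a max
  filter bank is linear, so \<open>kappa\<close> asks for the best condition number of a matrix whose rows lie in
  the chamber. Let \<open>I - N\<close> be the Gram matrix of the simple roots and \<open>v\<close> the Perron vector of \<open>N\<close>,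
  with eigenvalue \<open>c\<close>. The dual basis of the simple roots has squared condition number
  \<open>(1 + c) / (1 - c)\<close>. Nothing is better: as the diagram is bipartite, flipping the signs of \<open>v\<close> on one
  side gives the eigenvalue \<open>- c\<close>, and rows with nonnegative products with all simple roots respond to
  the flipped vector at most as strongly as to \<open>v\<close>. In every type \<open>c = cos (pi / h)\<close> with \<open>h\<close> the
  Coxeter number, so \<open>kappa = cot (pi / (2 * h))\<close>.
\<close>

section \<open>The fundamental chamber in root coordinates\<close>

text \<open>The overview takes for granted that every orbit meets the chamber and that distances and
  filters between orbits are attained there. Most of the work lies here: the group is given by its
  generators only, so that neither its finiteness nor the signs of its roots are known. The source
  of everything is the dihedral case of two generators, which yields the positivity of roots;
  finiteness is a consequence of it and of positive definiteness. The latter needs no spectral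
  theorem: \<open>v\<close> with \<open>c < 1\<close> certifies it by a weighted AM-GM inequality,
  so one vector settles finiteness, the upper bound and the lower bound. Coxeter numbers have no
  abstract role. For each type a vector made of sines is checked to be an eigenvector, and
  \<open>h\<close> is the denominator of its angle. The polynomials of degree 6 and 8 are not
  factored by hand. With \<open>x\<close> the cotangent, the field of \<open>x\<close> is at most
  quadratic over the field of \<open>x + 1 / x\<close>, and if the two fields coincided, a norm
  equation would hold that evaluation at a few points refutes.\<close>

text \<open>Vectors are functions of their coordinates in the basis of simple roots, so that a root is positive
  iff it is pointwise nonnegative, and \<^term>\<open>i < d\<close> is the only side condition needed.\<close>

locale perron_form =
  fixes d :: nat and m :: "nat \<Rightarrow> nat \<Rightarrow> nat" and c :: real and v :: "nat \<Rightarrow> real"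
  assumes m_sym: "m i j = m j i"
    and m_ge_2: "i \<noteq> j \<Longrightarrow> 2 \<le> m i j"
    and v_pos: "0 < v i"
    and perron: "i < d \<Longrightarrow> (\<Sum>j<d. (if i = j then 0 else cos (pi / m i j)) * v j) = c * v i"
    and c_less_1: "c < 1"
    and d_pos: "0 < d"
begin

definition N :: "nat \<Rightarrow> nat \<Rightarrow> real" where
  "N i j = (if i = j then 0 else cos (pi / m i j))"

definition gram :: "nat \<Rightarrow> (nat \<Rightarrow> real) \<Rightarrow> real" where
  "gram i x = x i - (\<Sum>j<d. N i j * x j)"

definition form :: "(nat \<Rightarrow> real) \<Rightarrow> (nat \<Rightarrow> real) \<Rightarrow> real" where
  "form x y = (\<Sum>i<d. x i * gram i y)"

definition refl :: "nat \<Rightarrow> (nat \<Rightarrow> real) \<Rightarrow> nat \<Rightarrow> real" where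
  "refl i x = x(i := x i - 2 * gram i x)"

definition act :: "nat list \<Rightarrow> (nat \<Rightarrow> real) \<Rightarrow> nat \<Rightarrow> real" where
  "act ws = foldr refl ws"

definition e :: "nat \<Rightarrow> nat \<Rightarrow> real" where
  "e i = (\<lambda>k. if k = i then 1 else 0)"

text \<open>The Coxeter length. A group element is identified with its action on coordinate
  functions, so \<open>ell\<close> depends on \<open>act w\<close> only and passes freely between
  words for the same element. It is meaningful when some word over \<open>{..<d}\<close> has this
  action.\<close>

definition ell :: "nat list \<Rightarrow> nat" where
  "ell w = (LEAST n. \<exists>w'. set w' \<subseteq> {..<d} \<and> act w' = act w \<and> length w' = n)"

section \<open>Reflections as linear maps on coordinates\<close>

lemma N_sym: "N i j = N j i"
  by (simp add: N_def m_sym)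

lemma N_diag [simp]: "N i i = 0"
  by (simp add: N_def)

lemma N_nonneg: "0 \<le> N i j"
proof (cases "i = j")
  case False
  then have "2 \<le> real (m i j)" using m_ge_2[of i j] by simp
  then have "pi / m i j \<le> pi / 2" by (intro divide_left_mono) auto
  moreover have "- (pi / 2) \<le> pi / m i j" by (rule order_trans[of _ 0]) auto
  ultimately have "0 \<le> cos (pi / m i j)" by (rule cos_ge_zero[rotated])
  then show ?thesis using False by (simp add: N_def)
qed simp

lemma perron_N: "i < d \<Longrightarrow> (\<Sum>j<d. N i j * v j) = c * v i"
  using perron by (simp add: N_def)

lemma c_nonneg: "0 \<le> c"
proof -
  have "0 \<le> (\<Sum>j<d. N 0 j * v j)"
    using v_pos N_nonneg by (intro sum_nonneg mult_nonneg_nonneg) (auto simp: less_imp_le)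
  then show ?thesis using perron_N[OF d_pos] v_pos[of 0] by (simp add: zero_le_mult_iff)
qed

lemma gram_v: "i < d \<Longrightarrow> gram i v = (1 - c) * v i"
  by (simp add: gram_def perron_N left_diff_distrib)

lemma gram_lincomb: "gram i (\<lambda>k. p * x k + q * y k) = p * gram i x + q * gram i y"
  by (simp add: gram_def sum.distrib sum_distrib_left algebra_simps)

lemma gram_e: "j < d \<Longrightarrow> gram i (e j) = (if i = j then 1 else - N i j)"
proof -
  assume "j < d"
  have "(\<Sum>k<d. N i k * e j k) = (\<Sum>k<d. if k = j then N i j else 0)"
    by (intro sum.cong) (auto simp: e_def)
  with \<open>j < d\<close> show ?thesis by (auto simp: gram_def) (auto simp: e_def)
qed

lemma refl_conv: "refl i x = (\<lambda>k. 1 * x k + (- 2 * gram i x) * e i k)"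
  by (auto simp: refl_def e_def)

lemma refl_lincomb: "refl i (\<lambda>k. p * x k + q * y k) = (\<lambda>k. p * refl i x k + q * refl i y k)"
  unfolding refl_conv gram_lincomb by (auto simp: algebra_simps)

lemma gram_refl: "i < d \<Longrightarrow> gram j (refl i x) = gram j x - 2 * gram i x * gram j (e i)"
  unfolding refl_conv gram_lincomb by simp

lemma refl_refl [simp]: "i < d \<Longrightarrow> refl i (refl i x) = x"
  using gram_refl[of i i x] by (auto simp: refl_def gram_e)

lemma refl_e: "i < d \<Longrightarrow> refl i (e i) = (\<lambda>k. - e i k)"
  unfolding refl_conv gram_e by auto

lemma act_Nil [simp]: "act [] x = x" and act_Cons [simp]: "act (i # w) x = refl i (act w x)"
  by (simp_all add: act_def)

lemma act_append [simp]: "act (u @ w) x = act u (act w x)"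
  by (simp add: act_def)

lemma act_append_cong: "act u = act u' \<Longrightarrow> act w = act w' \<Longrightarrow> act (u @ w) = act (u' @ w')"
  by (rule ext) simp

lemma act_lincomb: "act w (\<lambda>k. p * x k + q * y k) = (\<lambda>k. p * act w x k + q * act w y k)"
  by (induction w) (auto simp: refl_lincomb)

lemma act_refl: "act w (refl i x) = (\<lambda>k. act w x k - 2 * gram i x * act w (e i) k)"
  unfolding refl_conv act_lincomb by auto

lemma act_uminus: "act w (\<lambda>k. - x k) = (\<lambda>k. - act w x k)"
  using act_lincomb[of w "-1" x 0 x] by simp

lemma act_rev [simp]: "set w \<subseteq> {..<d} \<Longrightarrow> act (rev w) (act w x) = x"
  by (induction w arbitrary: x) auto

section \<open>The invariant form\<close>

lemma form_sym: "form x y = form y x"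
proof -
  have "form x y = (\<Sum>i<d. x i * y i) - (\<Sum>i<d. \<Sum>j<d. N i j * x i * y j)" for x y
    by (simp add: form_def gram_def right_diff_distrib sum_subtractf sum_distrib_left ac_simps)
  moreover have "(\<Sum>i<d. \<Sum>j<d. N i j * x i * y j) = (\<Sum>i<d. \<Sum>j<d. N i j * y i * x j)"
    by (subst sum.swap) (simp add: N_sym ac_simps)
  ultimately show ?thesis by (simp add: ac_simps)
qed

lemma form_lincomb_right: "form x (\<lambda>k. p * y k + q * z k) = p * form x y + q * form x z"
  unfolding form_def gram_lincomb by (simp add: algebra_simps sum.distrib sum_distrib_left)

lemma form_lincomb_left: "form (\<lambda>k. p * y k + q * z k) x = p * form y x + q * form z x"
  by (simp add: form_sym[of _ x] form_lincomb_right)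

lemma form_e: "i < d \<Longrightarrow> form (e i) x = gram i x"
proof -
  assume "i < d"
  have "form (e i) x = (\<Sum>j<d. if j = i then gram i x else 0)"
    unfolding form_def by (intro sum.cong) (auto simp: e_def)
  with \<open>i < d\<close> show ?thesis by simp
qed

lemma form_refl: "i < d \<Longrightarrow> form x (refl i y) = form x y - 2 * gram i y * gram i x"
  unfolding refl_conv form_lincomb_right by (simp add: form_sym[of x "e i"] form_e)

lemma form_refl_refl: "i < d \<Longrightarrow> form (refl i x) (refl i y) = form x y"
  unfolding form_refl form_sym[of "refl i x" y] by (simp add: gram_refl gram_e form_sym[of y x])

lemma form_act: "set w \<subseteq> {..<d} \<Longrightarrow> form (act w x) (act w y) = form x y"
  by (induction w) (auto simp: form_refl_refl)

text \<open>The Schur test with weight \<open>v\<close> confines the spectrum of \<open>N\<close> to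
  the interval from \<open>- c\<close> to \<open>c\<close>: AM-GM splits each product
  \<open>x i * x j\<close> into two weighted squares, and the eigenvector equation sums each kind to
  \<open>c / 2\<close> times the squared norm. As \<open>c < 1\<close>, the form is positive
  definite.\<close>

lemma form_bounds:
  shows "(1 - c) * (\<Sum>i<d. (x i)\<^sup>2) \<le> form x x" "form x x \<le> (1 + c) * (\<Sum>i<d. (x i)\<^sup>2)"
proof -
  let ?S = "\<Sum>i<d. \<Sum>j<d. N i j * x i * x j"
  have 1: "form x x = (\<Sum>i<d. (x i)\<^sup>2) - ?S"
    by (simp add: form_def gram_def right_diff_distrib sum_subtractf sum_distrib_left
        power2_eq_square ac_simps)
  have amgm: "\<bar>N i j * x i * x j\<bar> \<le> N i j * v j * (x i)\<^sup>2 / (2 * v i) + N i j * v i * (x j)\<^sup>2 / (2 * v j)" for i j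
  proof -
    have vi: "v i > 0" "v j > 0" using v_pos by auto
    have "0 \<le> (v j * \<bar>x i\<bar> - v i * \<bar>x j\<bar>)\<^sup>2" by simp
    then have "2 * (v i * v j) * (\<bar>x i\<bar> * \<bar>x j\<bar>) \<le> (v j)\<^sup>2 * (x i)\<^sup>2 + (v i)\<^sup>2 * (x j)\<^sup>2"
      by (simp add: power2_diff power_mult_distrib algebra_simps)
    then have "2 * (v i * v j) * (\<bar>x i\<bar> * \<bar>x j\<bar>) / (2 * (v i * v j))
        \<le> ((v j)\<^sup>2 * (x i)\<^sup>2 + (v i)\<^sup>2 * (x j)\<^sup>2) / (2 * (v i * v j))"
      using vi by (intro divide_right_mono) auto
    also have "\<dots> = v j * (x i)\<^sup>2 / (2 * v i) + v i * (x j)\<^sup>2 / (2 * v j)"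
      using vi by (simp add: add_divide_distrib power2_eq_square)
    finally have "\<bar>x i\<bar> * \<bar>x j\<bar> \<le> v j * (x i)\<^sup>2 / (2 * v i) + v i * (x j)\<^sup>2 / (2 * v j)"
      using vi by simp
    then have "N i j * (\<bar>x i\<bar> * \<bar>x j\<bar>) \<le> N i j * (v j * (x i)\<^sup>2 / (2 * v i) + v i * (x j)\<^sup>2 / (2 * v j))"
      using N_nonneg by (intro mult_left_mono) auto
    then show ?thesis using N_nonneg[of i j] by (simp add: abs_mult algebra_simps)
  qed
  have half: "(\<Sum>i<d. \<Sum>j<d. N i j * v j * (x i)\<^sup>2 / (2 * v i)) = c / 2 * (\<Sum>i<d. (x i)\<^sup>2)"
  proof -
    have "(\<Sum>j<d. N i j * v j * (x i)\<^sup>2 / (2 * v i)) = c / 2 * (x i)\<^sup>2" if "i \<in> {..<d}" for i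
    proof -
      have "i < d" using that by simp
      have "(\<Sum>j<d. N i j * v j * (x i)\<^sup>2 / (2 * v i)) = (\<Sum>j<d. N i j * v j) * ((x i)\<^sup>2 / (2 * v i))"
        by (simp add: sum_distrib_right sum_divide_distrib)
      then show ?thesis using perron_N[OF \<open>i < d\<close>] v_pos[of i] by simp
    qed
    then show ?thesis unfolding sum_distrib_left by (rule sum.cong[OF HOL.refl])
  qed
  have half': "(\<Sum>i<d. \<Sum>j<d. N i j * v i * (x j)\<^sup>2 / (2 * v j)) = c / 2 * (\<Sum>i<d. (x i)\<^sup>2)"
    by (subst half[symmetric], subst sum.swap) (simp add: N_sym)
  have "\<bar>?S\<bar> \<le> (\<Sum>i<d. \<Sum>j<d. \<bar>N i j * x i * x j\<bar>)"
    by (rule order_trans[OF sum_abs]) (intro sum_mono sum_abs)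
  also have "\<dots> \<le> (\<Sum>i<d. \<Sum>j<d. N i j * v j * (x i)\<^sup>2 / (2 * v i) + N i j * v i * (x j)\<^sup>2 / (2 * v j))"
    by (intro sum_mono amgm)
  also have "\<dots> = c * (\<Sum>i<d. (x i)\<^sup>2)"
    unfolding sum.distrib half half' by simp
  finally show "(1 - c) * (\<Sum>i<d. (x i)\<^sup>2) \<le> form x x" "form x x \<le> (1 + c) * (\<Sum>i<d. (x i)\<^sup>2)"
    unfolding 1 by (simp_all add: algebra_simps abs_le_iff)
qed

section \<open>Word length and dihedral subgroups\<close>

lemma ell_le: "set w' \<subseteq> {..<d} \<Longrightarrow> act w' = act w \<Longrightarrow> ell w \<le> length w'"
  unfolding ell_def by (rule Least_le) auto

lemma reduced_word:
  assumes "set w \<subseteq> {..<d}"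
  obtains w' where "set w' \<subseteq> {..<d}" "act w' = act w" "length w' = ell w"
  using LeastI[of "\<lambda>n. \<exists>w'. set w' \<subseteq> {..<d} \<and> act w' = act w \<and> length w' = n" "length w"] assms
  unfolding ell_def by blast

lemma ell_cong: "act w = act w' \<Longrightarrow> ell w = ell w'"
  by (simp add: ell_def)

text \<open>Grown at the left: a nonempty word ends in \<open>t\<close>, the letter that acts first,
  and the parity of \<open>k\<close> decides which letter stands in front. Fixing the right end
  suits the later arguments, which cancel letters there.\<close>

fun alternating :: "nat \<Rightarrow> nat \<Rightarrow> nat \<Rightarrow> nat list" where
  "alternating s t 0 = []"
| "alternating s t (Suc k) = (if even k then t else s) # alternating s t k"

lemma alternating_snoc: "alternating t s (Suc k) = alternating s t k @ [s]"
  by (induction k) auto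

lemma set_alternating: "set (alternating s t k) \<subseteq> {s, t}"
  by (induction k) auto

lemma length_alternating [simp]: "length (alternating s t k) = k"
  by (induction k) auto

lemma alternating_add: "\<exists>w. alternating s t (j + k) = w @ alternating s t k \<and> length w = j \<and> set w \<subseteq> {s, t}"
  by (induction j) (force)+

text \<open>A letter put in front of an alternating word either prolongs it or cancels its first
  letter.\<close>

lemma dihedral_normal_form:
  assumes "s < d" "t < d" "set u \<subseteq> {s, t}"
  shows "\<exists>k\<le>length u. act u = act (alternating s t k) \<or> act u = act (alternating t s k)"
  using assms(3)
proof (induction u)
  case Nil
  then show ?case by auto
next
  case (Cons r u)
  \<comment> \<open>Stated for the two letters in either order, so that one argument serves both
    alternating words.\<close>
  have step: "\<exists>k\<le>Suc n. act (r # u) = act (alternating s t k) \<or> act (r # u) = act (alternating t s k)"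
    if "{s, t} = {s', t'}" "act u = act (alternating s' t' n)" for s' t' n
  proof -
    from that Cons.prems assms have st: "s' < d" "t' < d" "r \<in> {s', t'}" by auto
    have cons: "act (r # u) = act (r # alternating s' t' n)"
      by (rule ext) (simp add: that(2))
    have "\<exists>k\<le>Suc n. act (r # u) = act (alternating s' t' k) \<or> act (r # u) = act (alternating t' s' k)"
    proof (cases n)
      case 0
      with st have "r # alternating s' t' n = alternating s' t' 1 \<or> r # alternating s' t' n = alternating t' s' 1"
        by auto
      then have "act (r # u) = act (alternating s' t' 1) \<or> act (r # u) = act (alternating t' s' 1)"
        using cons by (elim disjE) simp_all
      then show ?thesis by (intro exI[of _ 1]) simp
    next
      case (Suc l)
      show ?thesis
      proof (cases "r = (if even l then t' else s')")
        case True
        have "act (r # alternating s' t' n) = act (alternating s' t' l)"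
          by (rule ext) (use True Suc st in simp)
        with cons Suc show ?thesis by (intro exI[of _ l]) simp
      next
        case False
        with Suc st have "r # alternating s' t' n = alternating s' t' (Suc n)"
          by (auto split: if_splits)
        with cons show ?thesis by (intro exI[of _ "Suc n"]) simp
      qed
    qed
    then show ?thesis using that(1) by (auto simp: doubleton_eq_iff)
  qed
  from Cons obtain k where k: "k \<le> length u"
    "act u = act (alternating s t k) \<or> act u = act (alternating t s k)" by auto
  from k(2) have "\<exists>k'\<le>Suc k. act (r # u) = act (alternating s t k') \<or> act (r # u) = act (alternating t s k')"
  proof
    assume "act u = act (alternating s t k)"
    then show ?thesis by (rule step[OF HOL.refl])
  next
    assume "act u = act (alternating t s k)"
    then show ?thesis by (rule step[OF insert_commute])
  qed
  then obtain k' where k': "k' \<le> Suc k"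
    "act (r # u) = act (alternating s t k') \<or> act (r # u) = act (alternating t s k')" by blast
  from k'(1) k(1) have "k' \<le> length (r # u)" by simp
  with k'(2) show ?case by blast
qed

text \<open>Each reflection changes only one of the two coefficients, hence the parity cases. The
  new coefficient obeys the recurrence of the Chebyshev polynomials of the second kind at
  \<open>cos (pi / m s t)\<close>, which the quotients of sines solve.\<close>

lemma act_alternating_e:
  assumes st: "s < d" "t < d" "s \<noteq> t"
  defines "a \<equiv> \<lambda>k. sin (real k * pi / m s t) / sin (pi / m s t)"
  shows "act (alternating s t k) (e s) =
    (\<lambda>j. (if even k then a (Suc k) else a k) * e s j + (if even k then a k else a (Suc k)) * e t j)"
proof -
  define \<theta> where "\<theta> = pi / m s t"
  have a: "a k = sin (real k * \<theta>) / sin \<theta>" for k by (simp add: a_def \<theta>_def)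
  have m2: "2 \<le> real (m s t)" using m_ge_2[OF st(3)] by simp
  then have "\<theta> \<le> pi / 2" unfolding \<theta>_def by (intro divide_left_mono) auto
  moreover have "0 < \<theta>" using m2 by (simp add: \<theta>_def)
  ultimately have sin: "sin \<theta> > 0" using pi_gt_zero by (intro sin_gt_zero) linarith+
  have N: "N s t = cos \<theta>" "N t s = cos \<theta>" using st(3) by (simp_all add: N_def \<theta>_def m_sym)
  have rec: "a (Suc (Suc k)) = 2 * cos \<theta> * a (Suc k) - a k" for k
  proof -
    have "sin (real k * \<theta> + \<theta> + \<theta>) + sin (real k * \<theta>) = 2 * cos \<theta> * sin (real k * \<theta> + \<theta>)"
      using sin_add[of "real k * \<theta> + \<theta>" \<theta>] sin_diff[of "real k * \<theta> + \<theta>" \<theta>] by simp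
    then have "sin (real (Suc (Suc k)) * \<theta>) = 2 * cos \<theta> * sin (real (Suc k) * \<theta>) - sin (real k * \<theta>)"
      by (simp add: algebra_simps)
    then show ?thesis unfolding a by (simp add: diff_divide_distrib)
  qed
  show ?thesis
  proof (induction k)
    case 0
    then show ?case using sin by (simp add: a)
  next
    case (Suc k)
    show ?case
      unfolding alternating.simps act_Cons Suc.IH refl_conv[of _ "\<lambda>j. _ j"] gram_lincomb
      using st by (auto simp: gram_e N rec algebra_simps fun_eq_iff)
  qed
qed

text \<open>Both sides are linear, so they are compared on \<open>e s\<close>, on \<open>e t\<close>
  and on the common kernel of \<open>gram s\<close> and \<open>gram t\<close>, which every word in
  \<open>s\<close> and \<open>t\<close> fixes pointwise.\<close>

lemma braid:
  assumes st: "s < d" "t < d" "s \<noteq> t"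
  shows "act (alternating s t (m s t)) = act (alternating t s (m s t))"
proof -
  define \<theta> where "\<theta> = pi / m s t"
  have m2: "2 \<le> m s t" using m_ge_2[OF st(3)] by simp
  have m2': "2 \<le> real (m s t)" using m2 by simp
  then have "\<theta> \<le> pi / 2" unfolding \<theta>_def by (intro divide_left_mono) auto
  moreover have "0 < \<theta>" using m2 by (simp add: \<theta>_def)
  ultimately have sin: "sin \<theta> > 0" using pi_gt_zero by (intro sin_gt_zero) linarith+
  have N: "N s t = cos \<theta>" "N t s = cos \<theta>" using st(3) by (simp_all add: N_def \<theta>_def m_sym)
  have on_e: "act (alternating s t (m s t)) (e s) = act (alternating t s (m s t)) (e s)"
    if st: "s < d" "t < d" "s \<noteq> t" and m2: "2 \<le> m s t"
      and th: "\<theta> = pi / m s t" for s t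
  proof -
    obtain n where n: "m s t = Suc n" "n > 0" using m2 by (cases "m s t") auto
    have "real (Suc n) * \<theta> = pi" using n by (simp add: th)
    then have pi: "real n * \<theta> = pi - \<theta>" "real (Suc (Suc n)) * \<theta> = pi + \<theta>" "real (Suc n) * \<theta> = pi"
      by (simp_all add: algebra_simps)
    \<comment> \<open>Since \<open>m s t\<close> times \<theta> is \<open>pi\<close>, the
      coefficients at the three indices around \<open>m s t\<close> are 1, 0 and -1; both words
      therefore send \<open>e s\<close> to the same negated basis vector.\<close>
    have a: "sin (real (Suc n) * pi / m s t) / sin (pi / m s t) = 0"
      "sin (real n * pi / m s t) / sin (pi / m s t) = 1"
      "sin (real (Suc (Suc n)) * pi / m s t) / sin (pi / m s t) = - 1"
      using pi sin by (simp_all add: th)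
    have "act (alternating t s (Suc n)) (e s) = (\<lambda>j. - act (alternating s t n) (e s) j)"
      unfolding alternating_snoc by (simp add: refl_e[OF st(1)] act_uminus)
    moreover have "act (alternating s t (Suc n)) (e s) = (\<lambda>j. if even n then - e t j else - e s j)"
      "act (alternating s t n) (e s) = (\<lambda>j. if even n then e t j else e s j)"
      unfolding act_alternating_e[OF st] a by auto
    ultimately show ?thesis unfolding n(1) by (simp del: alternating.simps) auto
  qed
  have fix_: "act u y = y" if "set u \<subseteq> {s, t}" "gram s y = 0" "gram t y = 0" for u y
    using that by (induction u) (auto simp: refl_def)
  show ?thesis
  proof
    fix x
    \<comment> \<open>\<open>p\<close> and \<open>q\<close> solve the Gram system of the two roots,
      whose determinant is the squared sine of \<theta>; the remainder \<open>y\<close> is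
      orthogonal to both roots.\<close>
    define p where "p = (gram s x + cos \<theta> * gram t x) / (sin \<theta>)\<^sup>2"
    define q where "q = (gram t x + cos \<theta> * gram s x) / (sin \<theta>)\<^sup>2"
    define y where "y = (\<lambda>k. 1 * x k + (-1) * (p * e s k + q * e t k))"
    have pq: "(sin \<theta>)\<^sup>2 * p = gram s x + cos \<theta> * gram t x" "(sin \<theta>)\<^sup>2 * q = gram t x + cos \<theta> * gram s x"
      using sin by (simp_all add: p_def q_def)
    have "(sin \<theta>)\<^sup>2 * (p - cos \<theta> * q) = (sin \<theta>)\<^sup>2 * p - cos \<theta> * ((sin \<theta>)\<^sup>2 * q)"
      "(sin \<theta>)\<^sup>2 * (q - cos \<theta> * p) = (sin \<theta>)\<^sup>2 * q - cos \<theta> * ((sin \<theta>)\<^sup>2 * p)"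
      by (simp_all add: right_diff_distrib)
    then have "(sin \<theta>)\<^sup>2 * (p - cos \<theta> * q) = (1 - (cos \<theta>)\<^sup>2) * gram s x"
      "(sin \<theta>)\<^sup>2 * (q - cos \<theta> * p) = (1 - (cos \<theta>)\<^sup>2) * gram t x"
      unfolding pq by (simp_all add: algebra_simps power2_eq_square)
    then have "p - cos \<theta> * q = gram s x" "q - cos \<theta> * p = gram t x"
      using sin by (simp_all add: sin_squared_eq[symmetric])
    moreover have "gram s y = gram s x - (p - cos \<theta> * q)" "gram t y = gram t x - (q - cos \<theta> * p)"
      unfolding y_def gram_lincomb using st by (simp_all add: gram_e N)
    ultimately have "gram s y = 0" "gram t y = 0" by simp_all
    then have y: "act (alternating s t k) y = y" "act (alternating t s k) y = y" for k
      using set_alternating[of s t k] set_alternating[of t s k] by (auto intro!: fix_)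
    have x: "x = (\<lambda>k. 1 * y k + 1 * (p * e s k + q * e t k))" by (auto simp: y_def)
    have "\<theta> = pi / m t s" "2 \<le> m t s" using m2 by (simp_all add: \<theta>_def m_sym[of t s])
    with on_e[OF st m2 \<theta>_def] on_e[of t s] st show "act (alternating s t (m s t)) x = act (alternating t s (m s t)) x"
      by (subst (1 2) x) (simp only: act_lincomb y, simp add: m_sym[of t s])
  qed
qed

text \<open>Minimality makes \<open>u\<close> alternating. It cannot end in \<open>s\<close>, or
  appending \<open>s\<close> would cancel that letter; and with \<open>m s t\<close> or more letters
  the braid relation would let it end in \<open>s\<close>. So it ends in \<open>t\<close> and has
  fewer than \<open>m s t\<close> letters, and in this range both sines are nonnegative.\<close>

lemma dihedral_positive:
  assumes st: "s < d" "t < d" "s \<noteq> t" and u: "set u \<subseteq> {s, t}"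
    and min: "\<And>u'. set u' \<subseteq> {s, t} \<Longrightarrow> act u' = act u \<Longrightarrow> length u \<le> length u'"
    and min': "\<And>u'. set u' \<subseteq> {s, t} \<Longrightarrow> act u' = act (u @ [s]) \<Longrightarrow> length u \<le> length u'"
  shows "\<exists>p\<ge>0. \<exists>q\<ge>0. act u (e s) = (\<lambda>j. p * e s j + q * e t j)"
proof -
  obtain k where k: "k \<le> length u" "act u = act (alternating s t k) \<or> act u = act (alternating t s k)"
    using dihedral_normal_form[OF st(1,2) u] by blast
  have set: "set (alternating s t k) \<subseteq> {s, t}" "set (alternating t s k) \<subseteq> {s, t}" for k
    using set_alternating[of s t k] set_alternating[of t s k] by auto
  from k min[OF set(1), of k] min[OF set(2), of k] have len: "length u = k" by auto
  have not_s: "\<not> (k > 0 \<and> act u = act (alternating t s k))"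
  proof
    assume "k > 0 \<and> act u = act (alternating t s k)"
    then obtain l where l: "k = Suc l" "act u = act (alternating s t l @ [s])"
      by (cases k) (auto simp only: alternating_snoc)
    then have "act (alternating s t l) = act (u @ [s])" using st by (simp add: fun_eq_iff)
    from min'[OF set(1) this] show False using len l by simp
  qed
  then have u': "act u = act (alternating s t k)" using k by (cases "k = 0") auto
  have "k < m s t"
  proof (rule ccontr)
    assume "\<not> k < m s t"
    then obtain w where w: "alternating s t k = w @ alternating s t (m s t)"
      "length w = k - m s t" "set w \<subseteq> {s, t}"
      using alternating_add[of s t "k - m s t" "m s t"] by auto
    obtain n where n: "m s t = Suc n" using m_ge_2[OF st(3)] by (cases "m s t") auto
    have "act (w @ alternating s t n) = act (u @ [s])"
    proof
      fix x
      have "act (u @ [s]) x = act w (act (alternating s t (m s t)) (refl s x))"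
        by (simp add: u' w(1))
      also have "\<dots> = act w (act (alternating t s (Suc n)) (refl s x))"
        using braid[OF st] by (simp only: n)
      also have "\<dots> = act (w @ alternating s t n) x"
        unfolding alternating_snoc using st by simp
      finally show "act (w @ alternating s t n) x = act (u @ [s]) x" ..
    qed
    from min'[OF _ this] have "length u \<le> k - m s t + n" using w set(1)[of n] by simp
    then show False using len n \<open>\<not> k < m s t\<close> by simp
  qed
  have nonneg: "0 \<le> sin (real l * pi / m s t) / sin (pi / m s t)" if "l \<le> m s t" for l
  proof (intro divide_nonneg_nonneg sin_ge_zero)
    have m0: "real (m s t) > 0" using m_ge_2[OF st(3)] by simp
    then show "real l * pi / m s t \<le> pi" "pi / m s t \<le> pi"
      using that \<open>k < m s t\<close> by (simp_all add: field_simps)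
  qed auto
  let ?a = "\<lambda>k. sin (real k * pi / m s t) / sin (pi / m s t)"
  have "0 \<le> (if even k then ?a (Suc k) else ?a k)" "0 \<le> (if even k then ?a k else ?a (Suc k))"
    using nonneg[of k] nonneg[of "Suc k"] \<open>k < m s t\<close> by simp_all
  moreover note act_alternating_e[OF st, of k, folded u']
  ultimately show ?thesis by (intro exI conjI)
qed

text \<open>Among the factorizations of \<open>w\<close> as \<open>v @ u\<close> with \<open>u\<close> a word in \<open>s\<close> and \<open>t\<close> and no loss of length, take
  one with \<open>u\<close> as long as possible. Then \<open>u\<close> maps \<open>e s\<close> to a positive combination of \<open>e s\<close> and \<open>e t\<close> by a
  computation in the dihedral group, and the induction hypothesis applies to \<open>v\<close>.\<close>

lemma act_e_nonneg:
  assumes "set w \<subseteq> {..<d}" "s < d" "ell w \<le> ell (w @ [s])"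
  shows "0 \<le> act w (e s) j"
  using assms
proof (induction "ell w" arbitrary: w s j rule: less_induct)
  case less
  note w = \<open>set w \<subseteq> {..<d}\<close> and s = \<open>s < d\<close> and asc = \<open>ell w \<le> ell (w @ [s])\<close>
  obtain w0 where w0: "set w0 \<subseteq> {..<d}" "act w0 = act w" "length w0 = ell w"
    using reduced_word[OF w] by blast
  show ?case
  proof (cases w0 rule: rev_cases)
    case Nil
    then have "act w (e s) = e s" using w0(2) by (metis act_Nil)
    then show ?thesis by (simp add: e_def)
  next
    case (snoc w1 t)
    then have t: "t < d" and w1: "set w1 \<subseteq> {..<d}" using w0(1) by auto
    have "s \<noteq> t"
    proof
      assume "s = t"
      have "act (w @ [s]) x = act w1 x" for x
        using w0(2)[symmetric] snoc t \<open>s = t\<close> by simp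
      then have "ell (w @ [s]) \<le> length w1" by (intro ell_le w1) auto
      with asc w0(3) snoc show False by simp
    qed
    define split where "split k v u \<longleftrightarrow> set v \<subseteq> {..<d} \<and> set u \<subseteq> {s, t} \<and> act w = act (v @ u) \<and>
      length v + length u = ell w \<and> length u = k" for k v u
    have "split 1 w1 [t]" using w0 snoc w1 by (simp add: split_def)
    moreover have "k \<le> ell w" if "split k v u" for k v u using that by (auto simp: split_def)
    ultimately have "\<exists>k. (\<exists>v u. split k v u) \<and> (\<forall>k'. (\<exists>v u. split k' v u) \<longrightarrow> k' \<le> k)"
      by (intro ex_has_greatest_nat[of _ 1 _ "Suc (ell w)"]) (blast, auto simp: less_Suc_eq_le)
    then obtain k v u where split: "split k v u" and max: "\<And>k' v' u'. split k' v' u' \<Longrightarrow> k' \<le> k"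
      by blast
    from max[OF \<open>split 1 w1 [t]\<close>] have "k \<ge> 1" .
    from split have v: "set v \<subseteq> {..<d}" and u: "set u \<subseteq> {s, t}" and wvu: "act w = act (v @ u)"
      and len: "length v + length u = ell w" "length u = k"
      by (auto simp: split_def)
    have u_d: "set u' \<subseteq> {..<d}" if "set u' \<subseteq> {s, t}" for u' using that s t by auto
    have "ell v < ell w"
      using ell_le[OF v HOL.refl] len \<open>k \<ge> 1\<close> by simp
    have ell_v: "ell v = length v"
    proof (rule antisym)
      show "ell v \<le> length v" by (rule ell_le[OF v HOL.refl])
      obtain v' where v': "set v' \<subseteq> {..<d}" "act v' = act v" "length v' = ell v"
        using reduced_word[OF v] by blast
      have "act (v' @ u) = act w" unfolding wvu using v'(2) by (intro act_append_cong) auto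
      then have "ell w \<le> length (v' @ u)" using v' u_d[OF u] by (intro ell_le) auto
      then show "length v \<le> ell v" using v' len by simp
    qed
    \<comment> \<open>Otherwise \<open>r\<close> could be split off from the end of \<open>v\<close>
      and put in front of \<open>u\<close> without loss of length, and the second part would
      grow.\<close>
    have asc_v: "ell v \<le> ell (v @ [r])" if r: "r \<in> {s, t}" for r
    proof (rule ccontr)
      assume "\<not> ell v \<le> ell (v @ [r])"
      then have less: "ell (v @ [r]) < length v" by (simp add: ell_v)
      have rd: "r < d" using r s t by auto
      obtain v' where v': "set v' \<subseteq> {..<d}" "act v' = act (v @ [r])" "length v' = ell (v @ [r])"
        using reduced_word[of "v @ [r]"] v rd by auto
      have "act (v' @ r # u) = act w"
        by (rule ext) (simp add: v'(2) wvu rd)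
      moreover from this have "ell w \<le> length (v' @ r # u)"
        using v'(1) rd u_d[OF u] by (intro ell_le) auto
      ultimately have "split (Suc k) v' (r # u)"
        using v' u r less len unfolding split_def by auto
      from max[OF this] show False by simp
    qed
    have pos: "0 \<le> act v (e r) j" if "r \<in> {s, t}" for r j
      by (rule less.hyps[OF \<open>ell v < ell w\<close> v _ asc_v[OF that]]) (use that s t in auto)
    have "\<exists>p\<ge>0. \<exists>q\<ge>0. act u (e s) = (\<lambda>j. p * e s j + q * e t j)"
    proof (rule dihedral_positive[OF s t \<open>s \<noteq> t\<close> u])
      fix u' assume u': "set u' \<subseteq> {s, t}"
      {
        assume "act u' = act u"
        then have "act (v @ u') = act w" unfolding wvu by (intro act_append_cong) auto
        then have "ell w \<le> length (v @ u')" using v u_d[OF u'] by (intro ell_le) auto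
        then show "length u \<le> length u'" using len by simp
      }
      {
        assume eq: "act u' = act (u @ [s])"
        have "act (v @ u') = act (w @ [s])" by (rule ext) (simp add: eq wvu)
        then have "ell (w @ [s]) \<le> length (v @ u')" using v u_d[OF u'] by (intro ell_le) auto
        then show "length u \<le> length u'" using len asc by simp
      }
    qed
    then obtain p q where pq: "p \<ge> 0" "q \<ge> 0" "act u (e s) = (\<lambda>j. p * e s j + q * e t j)"
      by blast
    have "act w (e s) = (\<lambda>j. p * act v (e s) j + q * act v (e t) j)"
      by (simp add: wvu pq(3) act_lincomb)
    then show ?thesis using pq pos[of s] pos[of t] by simp
  qed
qed

section \<open>Dominance on the chamber\<close>

lemma ell_0_iff: "set w \<subseteq> {..<d} \<Longrightarrow> ell w = 0 \<Longrightarrow> act w x = x"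
  using reduced_word[of w] by (metis act_Nil length_0_conv)

text \<open>Induction on length peels off the last letter of a reduced word; the positive root
  \<open>act w1 (e i)\<close> is the direction along which this letter moves a point.\<close>

lemma descent:
  assumes w: "set w \<subseteq> {..<d}" and "0 < ell w"
  obtains w1 i where "set w1 \<subseteq> {..<d}" "i < d" "ell w = Suc (ell w1)" "\<And>j. 0 \<le> act w1 (e i) j"
    "\<And>x j. act w x j = act w1 x j - 2 * gram i x * act w1 (e i) j"
proof -
  obtain w0 where w0: "set w0 \<subseteq> {..<d}" "act w0 = act w" "length w0 = ell w"
    using reduced_word[OF w] by blast
  with assms obtain w1 i where snoc: "w0 = w1 @ [i]" by (cases w0 rule: rev_cases) auto
  with w0 have w1: "set w1 \<subseteq> {..<d}" "i < d" by auto
  obtain w1' where w1': "set w1' \<subseteq> {..<d}" "act w1' = act w1" "length w1' = ell w1"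
    using reduced_word[OF w1(1)] by blast
  have "act (w1' @ [i]) = act w"
    using w1'(2) by (simp add: w0(2)[symmetric] snoc fun_eq_iff)
  then have "ell w \<le> length (w1' @ [i])" using w1 w1' by (intro ell_le) auto
  with ell_le[OF w1(1) HOL.refl] w1'(3) w0(3) snoc have ell: "ell w = Suc (ell w1)" by simp
  have "ell (w1 @ [i]) = ell w" using w0(2) snoc by (intro ell_cong) simp
  then have "0 \<le> act w1 (e i) j" for j using ell by (intro act_e_nonneg w1) simp
  moreover have "act w x j = act w1 x j - 2 * gram i x * act w1 (e i) j" for x j
    using w0(2)[symmetric] by (simp add: snoc act_refl)
  ultimately show ?thesis using that w1 ell by blast
qed

text \<open>Along a reduced word every letter subtracts a nonnegative multiple of a positive root.
  In root coordinates the dominance order is the pointwise order.\<close>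

lemma chamber_dominates:
  assumes x: "\<And>i. i < d \<Longrightarrow> 0 \<le> gram i x" and w: "set w \<subseteq> {..<d}"
  shows "act w x j \<le> x j"
  using w
proof (induction "ell w" arbitrary: w)
  case 0
  then show ?case using ell_0_iff[of w x] by simp
next
  case (Suc n)
  then obtain w1 i where w1: "set w1 \<subseteq> {..<d}" "i < d" "ell w = Suc (ell w1)"
    "0 \<le> act w1 (e i) j" "act w x j = act w1 x j - 2 * gram i x * act w1 (e i) j"
    using descent[of w] by (metis zero_less_Suc)
  then have "act w1 x j \<le> x j" using Suc by simp
  moreover have "0 \<le> gram i x * act w1 (e i) j" using w1 x[of i] by simp
  ultimately show ?case using w1(5) by simp
qed

text \<open>\<open>y\<close> has nonnegative products with the simple roots, and
  \<open>x - act w x\<close> is a nonnegative combination of them. This rearrangement inequality is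
  what evaluates filters and distances.\<close>

lemma form_act_le:
  assumes x: "\<And>i. i < d \<Longrightarrow> 0 \<le> gram i x" and y: "\<And>i. i < d \<Longrightarrow> 0 \<le> gram i y"
    and w: "set w \<subseteq> {..<d}"
  shows "form (act w x) y \<le> form x y"
  unfolding form_def using chamber_dominates[OF x w] y by (intro sum_mono mult_right_mono) auto

text \<open>Root coordinates may be irrational, so the height of a positive root is not an integer
  bounded below by 1. The unit norm gives a uniform bound instead: with \<open>1 + c \<le> 2\<close>
  even the square of the height is at least \<open>1 / 2\<close>.\<close>

lemma act_e_sum:
  assumes w: "set w \<subseteq> {..<d}" and i: "i < d" and pos: "\<And>j. 0 \<le> act w (e i) j"
  shows "1 / 2 \<le> (\<Sum>j<d. act w (e i) j)"
proof -
  let ?b = "act w (e i)"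
  have "1 = form ?b ?b" using w i by (simp add: form_act form_e gram_e)
  also have "\<dots> \<le> (1 + c) * (\<Sum>j<d. (?b j)\<^sup>2)" by (rule form_bounds)
  also have "\<dots> \<le> 2 * (\<Sum>j<d. (?b j)\<^sup>2)"
    using c_less_1 by (intro mult_right_mono sum_nonneg) auto
  also have "(\<Sum>j<d. (?b j)\<^sup>2) \<le> (\<Sum>j<d. ?b j)\<^sup>2"
  proof -
    have "(\<Sum>j<d. (?b j)\<^sup>2) \<le> (\<Sum>j<d. ?b j * (\<Sum>k<d. ?b k))"
      using pos by (intro sum_mono) (auto simp: power2_eq_square intro!: mult_left_mono member_le_sum)
    then show ?thesis by (simp add: sum_distrib_right power2_eq_square)
  qed
  finally have "1 / 2 \<le> (\<Sum>j<d. ?b j)\<^sup>2" by simp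
  moreover have "(\<Sum>j<d. ?b j)\<^sup>2 < 1 / 2 * (1 / 2)" if "(\<Sum>j<d. ?b j) < 1 / 2"
    unfolding power2_eq_square using that pos by (intro mult_strict_mono') (auto intro: sum_nonneg)
  ultimately show ?thesis by fastforce
qed

text \<open>Each letter of a reduced word moves the interior point \<^term>\<open>v\<close> by a definite amount, while
  the orbit of \<^term>\<open>v\<close> is bounded.\<close>

lemma ell_bounded: "\<exists>L. \<forall>w. set w \<subseteq> {..<d} \<longrightarrow> ell w \<le> L"
proof -
  obtain \<delta> where \<delta>: "\<delta> > 0" "\<And>i. i < d \<Longrightarrow> \<delta> \<le> v i"
  proof
    show "Min (v ` {..<d}) > 0" using v_pos d_pos by (subst Min_gr_iff) auto
  qed simp
  \<comment> \<open>A letter \<open>i\<close> lowers the coordinate sum by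
    \<open>2 * (1 - c) * v i\<close> times the height of a positive root; as heights are at least
    \<open>1 / 2\<close>, this is at least \<open>(1 - c) * \<delta>\<close>.\<close>
  have lower: "(1 - c) * \<delta> * ell w \<le> (\<Sum>j<d. v j - act w v j)" if "set w \<subseteq> {..<d}" for w
    using that
  proof (induction "ell w" arbitrary: w)
    case 0
    then show ?case using ell_0_iff[of w v] by simp
  next
    case (Suc n)
    then have "0 < ell w" by simp
    from descent[OF Suc.prems this] obtain w1 i where w1: "set w1 \<subseteq> {..<d}" "i < d"
      "ell w = Suc (ell w1)" "\<And>j. 0 \<le> act w1 (e i) j"
      "\<And>x j. act w x j = act w1 x j - 2 * gram i x * act w1 (e i) j"
      by blast
    have "(1 - c) * \<delta> * ell w = (1 - c) * \<delta> * ell w1 + (1 - c) * \<delta> * (2 * (1 / 2))"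
      using w1(3) by (simp add: algebra_simps)
    also have "\<dots> \<le> (\<Sum>j<d. v j - act w1 v j) + (1 - c) * v i * (2 * (\<Sum>j<d. act w1 (e i) j))"
      using Suc w1 c_less_1 \<delta> act_e_sum[OF w1(1,2,4)]
      by (intro add_mono mult_mono) (auto intro!: sum_nonneg mult_nonneg_nonneg less_imp_le[OF v_pos])
    also have "\<dots> = (\<Sum>j<d. v j - act w v j)"
      by (simp add: w1(5) gram_v[OF w1(2)] sum_subtractf sum.distrib sum_distrib_left algebra_simps)
    finally show ?case .
  qed
  \<comment> \<open>A coordinate \<open>y\<close> satisfies \<open>- y \<le> y^2 + 1 / 4\<close>, by
    the square of \<open>y + 1 / 2\<close>. Bounding squares through the invariant form is thus
    enough, and no square root appears.\<close>
  define M where "M = 1 + form v v / (1 - c)"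
  have upper: "(\<Sum>j<d. v j - act w v j) \<le> (\<Sum>j<d. v j) + d * M" if "set w \<subseteq> {..<d}" for w
  proof -
    have "v j - act w v j \<le> v j + M" if "j \<in> {..<d}" for j
    proof -
      have "(1 - c) * (\<Sum>i<d. (act w v i)\<^sup>2) \<le> form v v"
        using form_bounds(1)[of "act w v"] form_act[OF \<open>set w \<subseteq> {..<d}\<close>] by simp
      then have "(\<Sum>i<d. (act w v i)\<^sup>2) \<le> form v v / (1 - c)"
        using c_less_1 by (simp add: field_simps)
      moreover have "(act w v j)\<^sup>2 \<le> (\<Sum>i<d. (act w v i)\<^sup>2)"
        using that by (intro member_le_sum) auto
      moreover have "0 \<le> (act w v j + 1 / 2)\<^sup>2" by simp
      ultimately show ?thesis by (simp add: M_def power2_eq_square algebra_simps)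
    qed
    then have "(\<Sum>j<d. v j - act w v j) \<le> (\<Sum>j<d. v j + M)"
      by (rule sum_mono)
    then show ?thesis by (simp add: sum.distrib)
  qed
  let ?L = "nat \<lceil>((\<Sum>j<d. v j) + d * M) / ((1 - c) * \<delta>)\<rceil>"
  have "ell w \<le> ?L" if "set w \<subseteq> {..<d}" for w
  proof -
    have "(1 - c) * \<delta> > 0" using c_less_1 \<delta> by simp
    then have "real (ell w) \<le> ((\<Sum>j<d. v j) + d * M) / ((1 - c) * \<delta>)"
      using lower[OF that] upper[OF that] by (simp add: field_simps)
    then show ?thesis by linarith
  qed
  then show ?thesis by blast
qed

section \<open>Finite orbits and chamber representatives\<close>

lemma finite_orbit: "finite {act w x | w. set w \<subseteq> {..<d}}"
proof -
  obtain L where L: "\<And>w. set w \<subseteq> {..<d} \<Longrightarrow> ell w \<le> L" using ell_bounded by blast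
  have "{act w x | w. set w \<subseteq> {..<d}} \<subseteq> (\<lambda>w. act w x) ` {w. set w \<subseteq> {..<d} \<and> length w \<le> L}"
  proof clarify
    fix w assume w: "set w \<subseteq> {..<d}"
    then obtain w' where "set w' \<subseteq> {..<d}" "act w' = act w" "length w' = ell w"
      using reduced_word by blast
    with L[OF w] show "act w x \<in> (\<lambda>w. act w x) ` {w. set w \<subseteq> {..<d} \<and> length w \<le> L}"
      by (intro image_eqI[of _ _ w']) auto
  qed
  then show ?thesis
    by (rule finite_subset) (intro finite_imageI finite_lists_length_le finite_lessThan)
qed

text \<open>A point \<open>p\<close> of the orbit with the largest product with \<open>v\<close>
  will do: reflecting it in \<open>i\<close> changes this product by
  \<open>- 2 * gram i p * gram i v\<close>, and \<open>gram i v\<close> is positive.\<close>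

lemma orbit_meets_chamber:
  obtains w where "set w \<subseteq> {..<d}" "\<And>i. i < d \<Longrightarrow> 0 \<le> gram i (act w x)"
proof -
  define A where "A = {act w x | w. set w \<subseteq> {..<d}}"
  have A: "finite A" unfolding A_def by (rule finite_orbit)
  have "act [] x \<in> A" unfolding A_def by (intro CollectI exI[of _ "[]"]) simp
  then have "form v ` A \<noteq> {}" by blast
  from Max_in[OF finite_imageI[OF A] this]
  obtain p where p: "p \<in> A" "Max (form v ` A) = form v p" by (rule imageE)
  have max: "form v q \<le> form v p" if "q \<in> A" for q
    using Max_ge[OF finite_imageI[OF A] imageI[OF that], of "form v"] unfolding p(2) .
  from p(1) obtain w where w: "set w \<subseteq> {..<d}" "p = act w x" unfolding A_def by blast
  have "0 \<le> gram i p" if i: "i < d" for i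
  proof -
    have "refl i p = act (i # w) x" using w by simp
    with w i have "refl i p \<in> A" unfolding A_def by (intro CollectI exI[of _ "i # w"]) auto
    from max[OF this] have "0 \<le> gram i p * ((1 - c) * v i)"
      using i by (simp add: form_refl gram_v mult_ac)
    moreover have "0 < (1 - c) * v i" using c_less_1 v_pos by simp
    ultimately show ?thesis by (simp only: zero_le_mult_iff) linarith
  qed
  then show ?thesis using that[OF w(1)] unfolding w(2) by blast
qed

end

section \<open>The condition number\<close>

lemma euclid_norm_vec: "euclid_norm (vec n f - vec n g) = sqrt (\<Sum>i<n. (f i - g i)\<^sup>2)"
  by (simp add: euclid_norm_def scalar_prod_def power2_eq_square lessThan_atLeast0)

text \<open>Expanding the unit vectors in simple roots gives a left inverse \<open>X\<close> of the
  matrix \<open>S\<close> of roots. For square matrices it is also a right inverse, and this says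
  that the columns of \<open>X\<close> are dual to the roots.\<close>

lemma dual_basis_exists:
  assumes "simple_system \<Gamma> \<alpha>" and d: "d = rank \<Gamma>"
  obtains \<omega> where "\<And>i. i < d \<Longrightarrow> \<omega> i \<in> carrier_vec d"
    "\<And>i j. i < d \<Longrightarrow> j < d \<Longrightarrow> \<alpha> i \<bullet> \<omega> j = (if i = j then 1 else 0)"
    "\<And>x l. x \<in> carrier_vec d \<Longrightarrow> l < d \<Longrightarrow> (\<Sum>i<d. (x \<bullet> \<omega> i) * \<alpha> i $ l) = x $ l"
proof -
  interpret vec_space "TYPE(real)" d .
  have \<alpha>: "\<alpha> i \<in> carrier_vec d" if "i < d" for i
    using assms that by (auto simp: simple_system_def)
  have inj: "inj_on \<alpha> {..<d}" and basis: "basis (\<alpha> ` {..<d})"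
    using assms by (auto simp: simple_system_def)
  have sub: "\<alpha> ` {..<d} \<subseteq> carrier_vec d" using \<alpha> by auto
  have "\<exists>a. unit_vec d k = lincomb a (\<alpha> ` {..<d})" if "k < d" for k
  proof -
    have "unit_vec d k \<in> span (\<alpha> ` {..<d})" using basis by (auto simp: basis_def)
    then show ?thesis using sub by (auto simp: finite_span)
  qed
  then obtain a where a: "\<And>k. k < d \<Longrightarrow> unit_vec d k = lincomb (a k) (\<alpha> ` {..<d})"
    by metis
  define X where "X = mat d d (\<lambda>(k, i). a k (\<alpha> i))"
  define S where "S = mat d d (\<lambda>(i, l). \<alpha> i $ l)"
  have XS_entry: "(\<Sum>i<d. X $$ (k, i) * \<alpha> i $ l) = (if k = l then 1 else 0)" if "k < d" "l < d" for k l
  proof -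
    have "(if k = l then 1 else 0) = lincomb (a k) (\<alpha> ` {..<d}) $ l"
      using that by (simp flip: a)
    also have "\<dots> = (\<Sum>x\<in>\<alpha> ` {..<d}. a k x * x $ l)"
      using that sub by (simp add: lincomb_index)
    also have "\<dots> = (\<Sum>i<d. X $$ (k, i) * \<alpha> i $ l)"
      using inj that by (simp add: sum.reindex X_def)
    finally show ?thesis ..
  qed
  have X: "X \<in> carrier_mat d d" and S: "S \<in> carrier_mat d d" by (auto simp: X_def S_def)
  have "X * S = 1\<^sub>m d"
    using X S XS_entry
    by (intro eq_matI) (auto simp: scalar_prod_def S_def lessThan_atLeast0)
  then have SX: "S * X = 1\<^sub>m d" by (rule mat_mult_left_right_inverse[OF X S])
  define \<omega> where "\<omega> i = col X i" for i
  show ?thesis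
  proof (rule that[of \<omega>])
    show "\<omega> i \<in> carrier_vec d" if "i < d" for i
      using X that by (auto simp: \<omega>_def intro: col_carrier_vec)
    show "\<alpha> i \<bullet> \<omega> j = (if i = j then 1 else 0)" if "i < d" "j < d" for i j
    proof -
      have "row S i = \<alpha> i" using that \<alpha>[of i] by (auto simp: S_def)
      then have "\<alpha> i \<bullet> \<omega> j = (S * X) $$ (i, j)" using X S that by (simp add: \<omega>_def)
      then show ?thesis using that by (simp add: SX)
    qed
    show "(\<Sum>i<d. (x \<bullet> \<omega> i) * \<alpha> i $ l) = x $ l" if x: "x \<in> carrier_vec d" and l: "l < d" for x l
    proof -
      have "(\<Sum>i<d. (x \<bullet> \<omega> i) * \<alpha> i $ l) = (\<Sum>i<d. \<Sum>k<d. x $ k * (X $$ (k, i) * \<alpha> i $ l))"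
        using X by (intro sum.cong) (auto simp: \<omega>_def scalar_prod_def lessThan_atLeast0 sum_distrib_right mult.assoc)
      also have "\<dots> = (\<Sum>k<d. x $ k * (\<Sum>i<d. X $$ (k, i) * \<alpha> i $ l))"
        by (subst sum.swap) (simp add: sum_distrib_left)
      also have "\<dots> = (\<Sum>k<d. if k = l then x $ k else 0)"
        using l by (intro sum.cong) (auto simp: XS_entry)
      finally show ?thesis using l by simp
    qed
  qed
qed

section \<open>From words to matrices\<close>

locale simple_roots = perron_form +
  fixes \<alpha> \<omega> :: "nat \<Rightarrow> real vec" and G :: "real mat set"
  assumes \<alpha>_carrier: "i < d \<Longrightarrow> \<alpha> i \<in> carrier_vec d"
    and \<alpha>_\<alpha>: "i < d \<Longrightarrow> j < d \<Longrightarrow> \<alpha> i \<bullet> \<alpha> j = (if i = j then 1 else - cos (pi / m i j))"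
    and \<omega>_carrier: "i < d \<Longrightarrow> \<omega> i \<in> carrier_vec d"
    and \<alpha>_\<omega>: "i < d \<Longrightarrow> j < d \<Longrightarrow> \<alpha> i \<bullet> \<omega> j = (if i = j then 1 else 0)"
    and expansion: "x \<in> carrier_vec d \<Longrightarrow> l < d \<Longrightarrow> (\<Sum>i<d. (x \<bullet> \<omega> i) * \<alpha> i $ l) = x $ l"
    and G_def: "G = generate (orthogonal_group d) (reflection d ` \<alpha> ` {..<d})"
begin

definition comb :: "(nat \<Rightarrow> real) \<Rightarrow> real vec" where
  "comb b = vec d (\<lambda>l. \<Sum>i<d. b i * \<alpha> i $ l)"

definition coord :: "real vec \<Rightarrow> nat \<Rightarrow> real" where
  "coord x i = x \<bullet> \<omega> i"

lemma comb_carrier [simp]: "comb b \<in> carrier_vec d"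
  by (simp add: comb_def)

lemma comb_coord: "x \<in> carrier_vec d \<Longrightarrow> comb (coord x) = x"
  by (intro eq_vecI) (auto simp: comb_def coord_def expansion)

lemma comb_diff: "comb a - comb b = comb (\<lambda>i. a i - b i)"
  by (intro eq_vecI) (auto simp: comb_def left_diff_distrib sum_subtractf)

lemma comb_scalar_prod:
  assumes "y \<in> carrier_vec d"
  shows "comb b \<bullet> y = (\<Sum>i<d. b i * (\<alpha> i \<bullet> y))"
proof -
  have "comb b \<bullet> y = (\<Sum>l<d. \<Sum>i<d. b i * (\<alpha> i $ l * y $ l))"
    using assms by (simp add: scalar_prod_def comb_def lessThan_atLeast0 sum_distrib_left sum_distrib_right mult.assoc)
  also have "\<dots> = (\<Sum>i<d. b i * (\<alpha> i \<bullet> y))"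
    using assms by (subst sum.swap) (simp add: scalar_prod_def lessThan_atLeast0 sum_distrib_left)
  finally show ?thesis .
qed

lemma \<alpha>_comb: "i < d \<Longrightarrow> \<alpha> i \<bullet> comb b = gram i b"
proof -
  assume i: "i < d"
  have "\<alpha> i \<bullet> comb b = comb b \<bullet> \<alpha> i"
    by (rule comm_scalar_prod[of _ d]) (simp_all add: \<alpha>_carrier i)
  also have "\<dots> = (\<Sum>j<d. b j * (\<alpha> j \<bullet> \<alpha> i))"
    using \<alpha>_carrier[OF i] by (simp add: comb_scalar_prod)
  also have "\<dots> = (\<Sum>j<d. (if j = i then b i else 0) - N i j * b j)"
    using i by (intro sum.cong) (auto simp: \<alpha>_\<alpha> N_def m_sym)
  also have "\<dots> = gram i b"
    using i by (simp add: sum_subtractf gram_def)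
  finally show ?thesis .
qed

lemma comb_comb: "comb a \<bullet> comb b = form a b"
  by (simp add: comb_scalar_prod \<alpha>_comb form_def)

lemma gram_coord_\<omega>: "i < d \<Longrightarrow> j < d \<Longrightarrow> gram j (coord (\<omega> i)) = (if i = j then 1 else 0)"
  using \<alpha>_comb[of j "coord (\<omega> i)"] by (cases "i = j") (simp_all add: comb_coord \<omega>_carrier \<alpha>_\<omega>)

lemma unit_\<alpha>: "i < d \<Longrightarrow> euclid_norm (\<alpha> i) = 1"
  by (simp add: euclid_norm_def \<alpha>_\<alpha>)

lemma reflection_carrier: "reflection d u \<in> carrier_mat d d"
  by (rule carrier_matI) (simp_all add: reflection_def)

lemma reflection_index:
  "i < d \<Longrightarrow> k < d \<Longrightarrow> l < d \<Longrightarrow>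
    reflection d (\<alpha> i) $$ (k, l) = (if k = l then 1 else 0) - 2 * \<alpha> i $ k * \<alpha> i $ l"
  by (simp add: reflection_def unit_\<alpha>)

lemma reflection_comb: "i < d \<Longrightarrow> reflection d (\<alpha> i) *\<^sub>v comb b = comb (refl i b)"
proof (rule eq_vecI)
  fix k assume i: "i < d" and "k < dim_vec (comb (refl i b))"
  then have k: "k < d" by (simp add: comb_def)
  have "(reflection d (\<alpha> i) *\<^sub>v comb b) $ k = (\<Sum>l<d. reflection d (\<alpha> i) $$ (k, l) * comb b $ l)"
    using k reflection_carrier[of "\<alpha> i"] by (simp add: scalar_prod_def lessThan_atLeast0 comb_def)
  also have "\<dots> = (\<Sum>l<d. (if l = k then comb b $ k else 0) - 2 * \<alpha> i $ k * (\<alpha> i $ l * comb b $ l))"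
    using i k by (intro sum.cong) (auto simp: reflection_index algebra_simps)
  also have "\<dots> = comb b $ k - 2 * \<alpha> i $ k * (\<alpha> i \<bullet> comb b)"
    using k by (simp add: sum_subtractf scalar_prod_def comb_def lessThan_atLeast0 sum_distrib_left)
  also have "\<dots> = comb (refl i b) $ k"
  proof -
    have "(\<Sum>j<d. e i j * \<alpha> j $ k) = (\<Sum>j<d. if j = i then \<alpha> i $ k else 0)"
      by (intro sum.cong) (auto simp: e_def)
    also have "\<dots> = \<alpha> i $ k" using i by simp
    finally have "(\<Sum>j<d. 2 * gram i b * (e i j * \<alpha> j $ k)) = 2 * gram i b * \<alpha> i $ k"
      by (simp flip: sum_distrib_left)
    then show ?thesis
      unfolding \<alpha>_comb[OF i] using k by (simp add: comb_def refl_conv algebra_simps sum_subtractf)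
  qed
  finally show "(reflection d (\<alpha> i) *\<^sub>v comb b) $ k = comb (refl i b) $ k" .
qed (simp add: comb_def reflection_def)

lemma reflection_orthogonal: "i < d \<Longrightarrow> reflection d (\<alpha> i) \<in> carrier (orthogonal_group d)"
proof -
  assume i: "i < d"
  let ?R = "reflection d (\<alpha> i)" and ?a = "\<lambda>k. \<alpha> i $ k"
  have "?R\<^sup>T * ?R = 1\<^sub>m d"
  proof (rule eq_matI)
    fix k l assume "k < dim_row (1\<^sub>m d :: real mat)" "l < dim_col (1\<^sub>m d :: real mat)"
    then have kl: "k < d" "l < d" by auto
    have "(?R\<^sup>T * ?R) $$ (k, l) = (\<Sum>p<d. ?R $$ (p, k) * ?R $$ (p, l))"
      using kl reflection_carrier[of "\<alpha> i"] by (simp add: scalar_prod_def lessThan_atLeast0)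
    also have "\<dots> = (\<Sum>p<d. (if p = k then (if k = l then 1 else 0) - 2 * ?a k * ?a l else 0)
        - (if p = l then 2 * ?a k * ?a l else 0) + 4 * ?a k * ?a l * (?a p * ?a p))"
      using i kl by (intro sum.cong) (auto simp: reflection_index algebra_simps)
    also have "\<dots> = (if k = l then 1 else 0) - 4 * ?a k * ?a l + 4 * ?a k * ?a l * (\<alpha> i \<bullet> \<alpha> i)"
      using kl \<alpha>_carrier[OF i]
      by (simp add: sum.distrib sum_subtractf sum_distrib_left scalar_prod_def lessThan_atLeast0)
    also have "\<dots> = 1\<^sub>m d $$ (k, l)" using i kl by (simp add: \<alpha>_\<alpha>)
    finally show "(?R\<^sup>T * ?R) $$ (k, l) = 1\<^sub>m d $$ (k, l)" .
  qed (auto simp: reflection_def)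
  then show ?thesis by (simp add: orthogonal_group_def reflection_carrier)
qed

text \<open>Reflections are involutions, so the inverses of generators are words as well. Together
  with the converse this replaces the matrix group by words in all questions about orbits.\<close>

lemma generate_acts_as_word:
  assumes "g \<in> G"
  shows "\<exists>w. set w \<subseteq> {..<d} \<and> (\<forall>b. g *\<^sub>v comb b = comb (act w b))"
proof -
  interpret O: group "orthogonal_group d" by (rule group_orthogonal_group)
  have R: "reflection d ` \<alpha> ` {..<d} \<subseteq> carrier (orthogonal_group d)"
    using reflection_orthogonal by auto
  have car: "h \<in> carrier_mat d d" if "h \<in> carrier (orthogonal_group d)" for h
    using that by (simp add: orthogonal_group_def)
  show ?thesis
    using assms unfolding G_def
  proof (induction rule: generate.induct)
    case one
    show ?case by (intro exI[of _ "[]"]) (simp add: orthogonal_group_def)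
  next
    case (incl h)
    then obtain i where "i < d" "h = reflection d (\<alpha> i)" by auto
    then show ?case by (intro exI[of _ "[i]"]) (simp add: reflection_comb)
  next
    case (inv h)
    then obtain i where i: "i < d" and h: "h = reflection d (\<alpha> i)" by auto
    let ?h' = "inv\<^bsub>orthogonal_group d\<^esub> h"
    have hc: "h \<in> carrier (orthogonal_group d)" using R inv by blast
    have "?h' \<otimes>\<^bsub>orthogonal_group d\<^esub> h = \<one>\<^bsub>orthogonal_group d\<^esub>" using hc by simp
    then have one: "?h' * h = 1\<^sub>m d" by (simp add: orthogonal_group_def)
    have "?h' *\<^sub>v comb b = comb (refl i b)" for b
    proof -
      have "comb b = h *\<^sub>v comb (refl i b)" using i by (simp add: h reflection_comb)
      then have "?h' *\<^sub>v comb b = (?h' * h) *\<^sub>v comb (refl i b)"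
        using car[OF hc] car[of ?h'] hc by (subst assoc_mult_mat_vec[of _ d d _ d]) auto
      then show ?thesis by (simp add: one)
    qed
    then show ?case using i by (intro exI[of _ "[i]"]) simp
  next
    case (eng h1 h2)
    then obtain w1 w2 where w: "set w1 \<subseteq> {..<d}" "\<And>b. h1 *\<^sub>v comb b = comb (act w1 b)"
      "set w2 \<subseteq> {..<d}" "\<And>b. h2 *\<^sub>v comb b = comb (act w2 b)" by blast
    have "h1 \<in> carrier_mat d d" "h2 \<in> carrier_mat d d"
      using eng O.generate_in_carrier[OF R] car by auto
    then have "(h1 * h2) *\<^sub>v comb b = comb (act (w1 @ w2) b)" for b
      using w by (subst assoc_mult_mat_vec[of _ d d _ d]) auto
    then show ?case using w by (intro exI[of _ "w1 @ w2"]) (simp add: orthogonal_group_def)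
  qed
qed

lemma word_in_generate:
  assumes "set w \<subseteq> {..<d}"
  shows "\<exists>g\<in>G. g \<in> carrier_mat d d \<and> (\<forall>b. g *\<^sub>v comb b = comb (act w b))"
  using assms
proof (induction w)
  case Nil
  have "1\<^sub>m d \<in> G" using generate.one[of "orthogonal_group d"] by (simp add: G_def orthogonal_group_def)
  then show ?case by (intro bexI[of _ "1\<^sub>m d"]) auto
next
  case (Cons i w)
  then obtain g where g: "g \<in> G" "g \<in> carrier_mat d d" "\<And>b. g *\<^sub>v comb b = comb (act w b)" by auto
  let ?R = "reflection d (\<alpha> i)"
  have i: "i < d" using Cons by simp
  have "?R \<in> G" unfolding G_def using i by (intro generate.incl) auto
  then have "?R * g \<in> G" using generate.eng[of ?R "orthogonal_group d" _ g] g
    by (simp add: G_def orthogonal_group_def)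
  moreover have "(?R * g) *\<^sub>v comb b = comb (act (i # w) b)" for b
    using g reflection_carrier[of "\<alpha> i"] i
    by (subst assoc_mult_mat_vec[of _ d d _ d]) (auto simp: reflection_comb)
  ultimately show ?case using g reflection_carrier[of "\<alpha> i"]
    by (intro bexI[of _ "?R * g"]) auto
qed

lemma orbit_comb: "orbit G (comb b) = {comb (act w b) | w. set w \<subseteq> {..<d}}"
  unfolding orbit_def
proof (intro equalityI subsetI)
  fix y assume "y \<in> {g *\<^sub>v comb b |g. g \<in> G}"
  then show "y \<in> {comb (act w b) |w. set w \<subseteq> {..<d}}" using generate_acts_as_word by fastforce
next
  fix y assume "y \<in> {comb (act w b) |w. set w \<subseteq> {..<d}}"
  then obtain w where "set w \<subseteq> {..<d}" "y = comb (act w b)" by blast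
  moreover from word_in_generate[OF this(1)] obtain g where "g \<in> G" "g *\<^sub>v comb b = comb (act w b)"
    by blast
  ultimately show "y \<in> {g *\<^sub>v comb b |g. g \<in> G}" by (intro CollectI exI[of _ g]) simp
qed

lemma finite_orbit_comb: "finite (orbit G (comb b))"
proof -
  have "orbit G (comb b) = comb ` {act w b | w. set w \<subseteq> {..<d}}" unfolding orbit_comb by blast
  then show ?thesis by (simp add: finite_orbit)
qed

lemma orbit_act:
  assumes "set w \<subseteq> {..<d}"
  shows "orbit G (comb (act w b)) = orbit G (comb b)"
  unfolding orbit_comb
proof (intro equalityI subsetI)
  fix y assume "y \<in> {comb (act u (act w b)) |u. set u \<subseteq> {..<d}}"
  then obtain u where "set u \<subseteq> {..<d}" "y = comb (act (u @ w) b)" by auto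
  with assms show "y \<in> {comb (act w b) |w. set w \<subseteq> {..<d}}" by (intro CollectI exI[of _ "u @ w"]) simp
next
  fix y assume "y \<in> {comb (act u b) |u. set u \<subseteq> {..<d}}"
  then obtain u where "set u \<subseteq> {..<d}" "y = comb (act (u @ rev w) (act w b))" using assms by auto
  with assms show "y \<in> {comb (act u (act w b)) |u. set u \<subseteq> {..<d}}"
    by (intro CollectI exI[of _ "u @ rev w"]) simp
qed

section \<open>Distances and filters on the chamber\<close>

definition chamber :: "(nat \<Rightarrow> real) set" where
  "chamber = {b. \<forall>i<d. 0 \<le> gram i b}"

lemma orbit_representative:
  assumes "x \<in> carrier_vec d"
  obtains b where "b \<in> chamber" "orbit G x = orbit G (comb b)"
proof -
  obtain w where w: "set w \<subseteq> {..<d}" "\<And>i. i < d \<Longrightarrow> 0 \<le> gram i (act w (coord x))"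
    using orbit_meets_chamber by blast
  then show ?thesis
    using that[of "act w (coord x)"] orbit_act[OF w(1), of "coord x"] comb_coord[OF assms]
    by (simp add: chamber_def)
qed

text \<open>By invariance of the form the second word moves over to the first argument.\<close>

lemma form_act_act_le:
  assumes "a \<in> chamber" "b \<in> chamber" "set u \<subseteq> {..<d}" "set w \<subseteq> {..<d}"
  shows "form (act u a) (act w b) \<le> form a b"
proof -
  have "form (act u a) (act w b) = form (act (rev w @ u) a) b"
    using form_act[of "rev w" "act u a" "act w b"] assms by simp
  also have "\<dots> \<le> form a b"
    using assms by (intro form_act_le) (auto simp: chamber_def)
  finally show ?thesis .
qed

lemma max_filter_chamber:
  assumes "a \<in> chamber" "b \<in> chamber"
  shows "max_filter (orbit G (comb a)) (orbit G (comb b)) = form a b"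
  unfolding max_filter_def
proof (rule Max_eqI)
  have "{p \<bullet> q |p q. p \<in> orbit G (comb a) \<and> q \<in> orbit G (comb b)}
      = (\<lambda>(p, q). p \<bullet> q) ` (orbit G (comb a) \<times> orbit G (comb b))" by auto
  then show "finite {p \<bullet> q |p q. p \<in> orbit G (comb a) \<and> q \<in> orbit G (comb b)}"
    by (simp add: finite_orbit_comb)
next
  fix y assume "y \<in> {p \<bullet> q |p q. p \<in> orbit G (comb a) \<and> q \<in> orbit G (comb b)}"
  then show "y \<le> form a b"
    using form_act_act_le[OF assms] by (auto simp: orbit_comb comb_comb)
next
  have "comb (act [] a) \<in> orbit G (comb a)" "comb (act [] b) \<in> orbit G (comb b)"
    unfolding orbit_comb by (intro CollectI exI[of _ "[]"], simp)+
  then show "form a b \<in> {p \<bullet> q |p q. p \<in> orbit G (comb a) \<and> q \<in> orbit G (comb b)}"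
    unfolding act_Nil by (intro CollectI exI[of _ "comb a"] exI[of _ "comb b"]) (simp add: comb_comb)
qed

lemma form_diff: "form (\<lambda>i. x i - y i) (\<lambda>i. x i - y i) = form x x - 2 * form x y + form y y"
  using form_lincomb_left[of 1 x "-1" y "\<lambda>i. x i - y i"]
    form_lincomb_right[of x 1 x "-1" y] form_lincomb_right[of y 1 x "-1" y] form_sym[of y x]
  by simp

text \<open>All points of an orbit have the same norm, so the least distance occurs where the
  product is largest, that is, at the representatives in the chamber.\<close>

lemma orbit_dist_chamber:
  assumes "a \<in> chamber" "b \<in> chamber"
  shows "orbit_dist (orbit G (comb a)) (orbit G (comb b)) = sqrt (form (\<lambda>i. a i - b i) (\<lambda>i. a i - b i))"
  unfolding orbit_dist_def
proof (rule Min_eqI)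
  have "{euclid_norm (p - q) |p q. p \<in> orbit G (comb a) \<and> q \<in> orbit G (comb b)}
      = (\<lambda>(p, q). euclid_norm (p - q)) ` (orbit G (comb a) \<times> orbit G (comb b))" by auto
  then show "finite {euclid_norm (p - q) |p q. p \<in> orbit G (comb a) \<and> q \<in> orbit G (comb b)}"
    by (simp add: finite_orbit_comb)
next
  fix y assume "y \<in> {euclid_norm (p - q) |p q. p \<in> orbit G (comb a) \<and> q \<in> orbit G (comb b)}"
  then obtain u w where "set u \<subseteq> {..<d}" "set w \<subseteq> {..<d}"
    "y = euclid_norm (comb (act u a) - comb (act w b))" by (auto simp: orbit_comb)
  with form_act_act_le[OF assms this(1,2)]
  show "sqrt (form (\<lambda>i. a i - b i) (\<lambda>i. a i - b i)) \<le> y"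
    by (simp add: comb_diff comb_comb euclid_norm_def form_diff form_act)
next
  have "comb (act [] a) \<in> orbit G (comb a)" "comb (act [] b) \<in> orbit G (comb b)"
    unfolding orbit_comb by (intro CollectI exI[of _ "[]"], simp)+
  then show "sqrt (form (\<lambda>i. a i - b i) (\<lambda>i. a i - b i))
      \<in> {euclid_norm (p - q) |p q. p \<in> orbit G (comb a) \<and> q \<in> orbit G (comb b)}"
    unfolding act_Nil
    by (intro CollectI exI[of _ "comb a"] exI[of _ "comb b"])
      (simp add: comb_diff comb_comb euclid_norm_def)
qed

lemma bank_dist_chamber:
  assumes T: "\<And>i. i < n \<Longrightarrow> T i \<in> chamber" "\<And>i. i < n \<Longrightarrow> orbit G (t i) = orbit G (comb (T i))"
    and "a \<in> chamber" "b \<in> chamber"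
  shows "euclid_norm (max_filter_bank G n t (orbit G (comb a)) - max_filter_bank G n t (orbit G (comb b)))
    = sqrt (\<Sum>i<n. (form (T i) (\<lambda>j. a j - b j))\<^sup>2)"
proof -
  have "form (T i) (\<lambda>j. a j - b j) = form (T i) a - form (T i) b" for i
    using form_lincomb_right[of "T i" 1 a "-1" b] by simp
  then show ?thesis
    using assms by (simp add: max_filter_bank_def euclid_norm_vec max_filter_chamber)
qed

text \<open>The filter with template \<open>\<omega> i\<close> reads off the root coordinate
  \<open>z i\<close> of a difference \<open>z\<close> of chamber points. The bank measures the
  Euclidean length of the coordinate vector, and \<open>form_bounds\<close> compares it with the
  true length.\<close>

lemma bilipschitz_dual_basis:
  assumes "c > -1"
  shows "bilipschitz_bank d G d \<omega> (1 / sqrt (1 + c)) (1 / sqrt (1 - c))"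
  unfolding bilipschitz_bank_def
proof (intro ballI)
  fix x y :: "real vec" assume x: "x \<in> carrier_vec d" and y: "y \<in> carrier_vec d"
  obtain a where a: "a \<in> chamber" "orbit G x = orbit G (comb a)" using orbit_representative[OF x] .
  obtain b where b: "b \<in> chamber" "orbit G y = orbit G (comb b)" using orbit_representative[OF y] .
  define z where "z = (\<lambda>i. a i - b i)"
  have "coord (\<omega> i) \<in> chamber" if "i < d" for i
    using that by (simp add: chamber_def gram_coord_\<omega>)
  moreover have "orbit G (\<omega> i) = orbit G (comb (coord (\<omega> i)))" if "i < d" for i
    using that by (simp add: comb_coord \<omega>_carrier)
  ultimately have "euclid_norm (max_filter_bank G d \<omega> (orbit G x) - max_filter_bank G d \<omega> (orbit G y))
      = sqrt (\<Sum>i<d. (form (coord (\<omega> i)) z)\<^sup>2)"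
    unfolding a(2) b(2) z_def by (intro bank_dist_chamber a b)
  also have "(\<Sum>i<d. (form (coord (\<omega> i)) z)\<^sup>2) = (\<Sum>i<d. (z i)\<^sup>2)"
  proof (intro sum.cong HOL.refl)
    fix i assume "i \<in> {..<d}"
    then have i: "i < d" by simp
    have "form (coord (\<omega> i)) z = (\<Sum>j<d. if j = i then z i else 0)"
      unfolding form_sym[of _ z] form_def[of z] using i by (intro sum.cong) (auto simp: gram_coord_\<omega>)
    then show "(form (coord (\<omega> i)) z)\<^sup>2 = (z i)\<^sup>2" using i by simp
  qed
  finally have bank: "euclid_norm (max_filter_bank G d \<omega> (orbit G x) - max_filter_bank G d \<omega> (orbit G y))
      = sqrt (\<Sum>i<d. (z i)\<^sup>2)" .
  have dist: "orbit_dist (orbit G x) (orbit G y) = sqrt (form z z)"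
    unfolding a(2) b(2) z_def by (intro orbit_dist_chamber a b)
  have "sqrt (form z z) \<le> sqrt (1 + c) * sqrt (\<Sum>i<d. (z i)\<^sup>2)"
    using form_bounds(2)[of z] by (simp flip: real_sqrt_mult)
  moreover have "sqrt (1 - c) * sqrt (\<Sum>i<d. (z i)\<^sup>2) \<le> sqrt (form z z)"
    using form_bounds(1)[of z] by (simp flip: real_sqrt_mult)
  moreover have "sqrt (1 + c) > 0" "sqrt (1 - c) > 0" using assms c_less_1 by simp_all
  ultimately show "1 / sqrt (1 + c) * orbit_dist (orbit G x) (orbit G y)
      \<le> euclid_norm (max_filter_bank G d \<omega> (orbit G x) - max_filter_bank G d \<omega> (orbit G y)) \<and>
    euclid_norm (max_filter_bank G d \<omega> (orbit G x) - max_filter_bank G d \<omega> (orbit G y))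
      \<le> 1 / sqrt (1 - c) * orbit_dist (orbit G x) (orbit G y)"
    unfolding bank dist by (simp add: field_simps)
qed

text \<open>Flipping the signs of \<^term>\<open>v\<close> on one side of a bipartition turns the eigenvalue \<open>c\<close> into \<open>- c\<close>.
  A max filter is monotone on the chamber, so it cannot see the flipped vector better than
  \<^term>\<open>v\<close> itself, although the flipped vector is longer.\<close>

lemma bilipschitz_lower_bound:
  fixes \<epsilon> :: "nat \<Rightarrow> bool"
  assumes bip: "\<And>i j. i < d \<Longrightarrow> j < d \<Longrightarrow> i \<noteq> j \<Longrightarrow> m i j \<noteq> 2 \<Longrightarrow> \<epsilon> i \<noteq> \<epsilon> j"
    and "c > -1"
    and t: "\<And>i. i < n \<Longrightarrow> t i \<in> carrier_vec d" and pos: "0 < L" "0 < U"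
    and bank: "bilipschitz_bank d G n t L U"
  shows "sqrt ((1 + c) / (1 - c)) \<le> U / L"
proof -
  have "\<exists>T. \<forall>i. i < n \<longrightarrow> T i \<in> chamber \<and> orbit G (t i) = orbit G (comb (T i))"
    by (intro choice allI) (metis orbit_representative t)
  then obtain T where T: "\<And>i. i < n \<Longrightarrow> T i \<in> chamber"
    "\<And>i. i < n \<Longrightarrow> orbit G (t i) = orbit G (comb (T i))" by blast
  have ineq: "L * sqrt (form z z) \<le> sqrt (\<Sum>i<n. (form (T i) z)\<^sup>2)"
    "sqrt (\<Sum>i<n. (form (T i) z)\<^sup>2) \<le> U * sqrt (form z z)"
    if "a \<in> chamber" "b \<in> chamber" "z = (\<lambda>j. a j - b j)" for a b z
  proof -
    have "L * orbit_dist (orbit G (comb a)) (orbit G (comb b))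
        \<le> euclid_norm (max_filter_bank G n t (orbit G (comb a)) - max_filter_bank G n t (orbit G (comb b)))"
      "euclid_norm (max_filter_bank G n t (orbit G (comb a)) - max_filter_bank G n t (orbit G (comb b)))
        \<le> U * orbit_dist (orbit G (comb a)) (orbit G (comb b))"
      using bank comb_carrier unfolding bilipschitz_bank_def by blast+
    moreover have "euclid_norm (max_filter_bank G n t (orbit G (comb a)) - max_filter_bank G n t (orbit G (comb b)))
        = sqrt (\<Sum>i<n. (form (T i) z)\<^sup>2)"
      unfolding that(3) by (intro bank_dist_chamber T that(1,2))
    ultimately show "L * sqrt (form z z) \<le> sqrt (\<Sum>i<n. (form (T i) z)\<^sup>2)"
      "sqrt (\<Sum>i<n. (form (T i) z)\<^sup>2) \<le> U * sqrt (form z z)"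
      by (simp_all add: orbit_dist_chamber[OF that(1,2)] that(3))
  qed
  define s where "s i = (if \<epsilon> i then 1 else - 1 :: real)" for i
  define v' where "v' i = s i * v i" for i
  \<comment> \<open>The factor is chosen such that \<open>M * v\<close> and the flipped vector
    \<open>v'\<close> have products of the same size \<open>(1 + c) * v i\<close> with the simple
    roots. Adding \<open>v'\<close> to \<open>M * v\<close> then stays in the chamber, so
    \<open>v'\<close> is a difference of chamber points and the bilipschitz bounds apply to
    it.\<close>
  define M where "M = (1 + c) / (1 - c)"
  define S where "S = (\<Sum>i<d. (v i)\<^sup>2)"
  have M: "M * (1 - c) = 1 + c" "M > 0" using c_less_1 assms(2) by (simp_all add: M_def)
  have gram_v': "gram i v' = s i * (1 + c) * v i" if "i < d" for i
  proof -
    have "(\<Sum>j<d. N i j * v' j) = (\<Sum>j<d. - s i * (N i j * v j))"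
    proof (intro sum.cong HOL.refl)
      fix j assume "j \<in> {..<d}"
      then show "N i j * v' j = - s i * (N i j * v j)"
        using bip[OF that, of j] by (cases "m i j = 2") (auto simp: N_def v'_def s_def)
    qed
    also have "\<dots> = - s i * (c * v i)" by (simp only: sum_distrib_left[symmetric] perron_N[OF that])
    finally show ?thesis by (simp add: gram_def v'_def algebra_simps)
  qed
  have "(\<lambda>_. 0) \<in> chamber" by (simp add: chamber_def gram_def)
  moreover have v_chamber: "v \<in> chamber"
    using c_less_1 by (simp add: chamber_def gram_v less_imp_le[OF v_pos])
  ultimately have upper: "sqrt (\<Sum>i<n. (form (T i) v)\<^sup>2) \<le> U * sqrt (form v v)"
    using ineq(2)[of v "\<lambda>_. 0" v] by simp
  have gram_M: "gram i (\<lambda>j. M * v j) = (1 + c) * v i" if "i < d" for i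
    using gram_lincomb[of i M v 0 v] gram_v[OF that] M(1) by (simp add: mult.assoc[symmetric])
  have "(\<lambda>j. M * v j) \<in> chamber"
    using assms(2) by (simp add: chamber_def gram_M less_imp_le[OF v_pos])
  moreover have "(\<lambda>j. M * v j + v' j) \<in> chamber"
  proof -
    have "gram i (\<lambda>j. M * v j + v' j) = (1 + s i) * ((1 + c) * v i)" if "i < d" for i
      using gram_lincomb[of i 1 "\<lambda>j. M * v j" 1 v'] gram_M[OF that] gram_v'[OF that]
      by (simp add: algebra_simps)
    moreover have "0 \<le> 1 + s i" for i by (simp add: s_def)
    ultimately show ?thesis
      using assms(2) by (simp add: chamber_def less_imp_le[OF v_pos])
  qed
  ultimately have "L * sqrt (form v' v') \<le> sqrt (\<Sum>i<n. (form (T i) v')\<^sup>2)"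
    by (intro ineq(1)[where a = "\<lambda>j. M * v j + v' j" and b = "\<lambda>j. M * v j"]) auto
  also have "\<dots> \<le> sqrt (\<Sum>i<n. (form (T i) v)\<^sup>2)"
  proof (intro real_sqrt_le_mono sum_mono)
    fix i assume "i \<in> {..<n}"
    then have g: "0 \<le> gram j (T i)" if "j < d" for j using T(1)[of i] that by (simp add: chamber_def)
    have "\<bar>form (T i) v'\<bar> \<le> (\<Sum>j<d. \<bar>v' j * gram j (T i)\<bar>)"
      unfolding form_sym[of "T i"] form_def[of v'] by (rule sum_abs)
    also have "\<dots> = form (T i) v"
      unfolding form_sym[of "T i"] form_def[of v]
      using g less_imp_le[OF v_pos] by (intro sum.cong) (auto simp: v'_def s_def abs_mult)
    finally show "(form (T i) v')\<^sup>2 \<le> (form (T i) v)\<^sup>2" by (rule abs_le_square_iff[THEN iffD1, OF order_trans]) simp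
  qed
  finally have "L * sqrt (form v' v') \<le> U * sqrt (form v v)" using upper by simp
  moreover have "form v v = (1 - c) * S"
    by (simp add: form_def gram_v S_def sum_distrib_left power2_eq_square ac_simps)
  moreover have "form v' v' = (1 + c) * S"
    unfolding form_def S_def sum_distrib_left
    by (intro sum.cong) (auto simp: gram_v' v'_def s_def power2_eq_square)
  ultimately have "L * sqrt (1 + c) * sqrt S \<le> U * sqrt (1 - c) * sqrt S"
    by (simp add: real_sqrt_mult mult.assoc)
  moreover have "S > 0" unfolding S_def using d_pos by (intro sum_pos zero_less_power v_pos) auto
  ultimately have "L * sqrt (1 + c) \<le> U * sqrt (1 - c)" by simp
  then show ?thesis using pos c_less_1 by (simp add: real_sqrt_divide field_simps)
qed

text \<open>The infimum is a minimum: the dual basis attains the bound valid for every bank.\<close>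

lemma kappa_eq:
  fixes \<epsilon> :: "nat \<Rightarrow> bool"
  assumes bip: "\<And>i j. i < d \<Longrightarrow> j < d \<Longrightarrow> i \<noteq> j \<Longrightarrow> m i j \<noteq> 2 \<Longrightarrow> \<epsilon> i \<noteq> \<epsilon> j"
  shows "kappa d G = sqrt ((1 + c) / (1 - c))"
  unfolding kappa_def
proof (rule cInf_eq_minimum)
  have c: "-1 < c" using c_nonneg by simp
  then have "0 < sqrt (1 + c)" "0 < sqrt (1 - c)" using c_less_1 by simp_all
  then show "sqrt ((1 + c) / (1 - c)) \<in> {C / c | n t C c.
      (\<forall>i<n. t i \<in> carrier_vec d) \<and> 0 < C \<and> 0 < c \<and> bilipschitz_bank d G n t c C}"
    using bilipschitz_dual_basis[OF c] \<omega>_carrier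
    by (intro CollectI exI[of _ d] exI[of _ \<omega>] exI[of _ "1 / sqrt (1 - c)"] exI[of _ "1 / sqrt (1 + c)"])
      (simp add: real_sqrt_divide)
  fix y assume "y \<in> {C / c | n t C c.
      (\<forall>i<n. t i \<in> carrier_vec d) \<and> 0 < C \<and> 0 < c \<and> bilipschitz_bank d G n t c C}"
  then obtain n t L U where y: "y = U / L" and t: "\<forall>i<n. t i \<in> carrier_vec d"
    and LU: "0 < L" "0 < U" "bilipschitz_bank d G n t L U" by blast
  show "sqrt ((1 + c) / (1 - c)) \<le> y"
    unfolding y using t by (intro bilipschitz_lower_bound[OF bip c _ LU]) auto
qed

end

text \<open>What remains for each diagram is a two-coloring of its vertices and a positive
  eigenvector with eigenvalue below 1.\<close>

theorem kappa_standard_representation: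
  fixes v :: "nat \<Rightarrow> real" and \<epsilon> :: "nat \<Rightarrow> bool"
  assumes G: "standard_representation \<Gamma> G" and d: "rank \<Gamma> = d" "0 < d"
    and ge_2: "\<And>i j. i \<noteq> j \<Longrightarrow> 2 \<le> coxeter_order \<Gamma> i j"
    and bip: "\<And>i j. i < j \<Longrightarrow> j < d \<Longrightarrow> coxeter_order \<Gamma> i j \<noteq> 2 \<Longrightarrow> \<epsilon> i \<noteq> \<epsilon> j"
    and v: "\<And>i. i < d \<Longrightarrow> 0 < v i"
    and perron: "\<And>i. i < d \<Longrightarrow>
      (\<Sum>j<d. (if i = j then 0 else cos (pi / coxeter_order \<Gamma> i j)) * v j) = c * v i"
    and c: "c < 1"
  shows "kappa d G = sqrt ((1 + c) / (1 - c))"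
proof -
  obtain \<alpha> where \<alpha>: "simple_system \<Gamma> \<alpha>"
    and gen: "G = generate (orthogonal_group d) (reflection d ` \<alpha> ` {..<d})"
    using G d by (auto simp: standard_representation_def)
  obtain \<omega> where \<omega>: "\<And>i. i < d \<Longrightarrow> \<omega> i \<in> carrier_vec d"
    "\<And>i j. i < d \<Longrightarrow> j < d \<Longrightarrow> \<alpha> i \<bullet> \<omega> j = (if i = j then 1 else 0)"
    "\<And>x l. x \<in> carrier_vec d \<Longrightarrow> l < d \<Longrightarrow> (\<Sum>i<d. (x \<bullet> \<omega> i) * \<alpha> i $ l) = x $ l"
    using dual_basis_exists[OF \<alpha> d(1)[symmetric]] by blast
  have sym: "coxeter_order \<Gamma> i j = coxeter_order \<Gamma> j i" for i j
    by (simp add: coxeter_order_def insert_commute)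
  have unit: "\<alpha> i \<bullet> \<alpha> i = 1" if "i < d" for i
    using \<alpha> d that by (auto simp: simple_system_def euclid_norm_def)
  \<comment> \<open>The locale wants \<open>v\<close> positive at every index, so it is continued by
    1; the eigenvector equation sees only indices below \<open>d\<close>.\<close>
  interpret simple_roots d "coxeter_order \<Gamma>" c "\<lambda>i. if i < d then v i else 1" \<alpha> \<omega> G
  proof unfold_locales
    fix i assume "i < d"
    then show "(\<Sum>j<d. (if i = j then 0 else cos (pi / coxeter_order \<Gamma> i j)) * (if j < d then v j else 1))
        = c * (if i < d then v i else 1)"
      using perron[of i] by simp
  qed (use \<alpha> \<omega> d v c ge_2 gen unit in \<open>auto simp: simple_system_def sym\<close>)
  show ?thesis
  proof (rule kappa_eq[of \<epsilon>])
    fix i j assume "i < d" "j < d" "i \<noteq> j" "coxeter_order \<Gamma> i j \<noteq> 2"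
    then show "\<epsilon> i \<noteq> \<epsilon> j" using bip[of i j] bip[of j i] sym[of i j] by (cases "i < j") auto
  qed
qed

section \<open>Perron vectors\<close>

lemma cos_pi_div_less_1: "2 \<le> h \<Longrightarrow> cos (pi / real h) < 1"
proof -
  assume "2 \<le> h"
  then have "0 < pi / h" "pi / h \<le> pi" by (auto simp: field_simps)
  then show ?thesis using cos_monotone_0_pi[of 0 "pi / h"] by simp
qed

lemma half_angle_quotient:
  assumes "2 \<le> h"
  shows "sqrt ((1 + cos (pi / real h)) / (1 - cos (pi / real h))) = cot (pi / (2 * real h))"
proof -
  define x where "x = pi / (2 * real h)"
  have h: "real h \<ge> 2" using assms by simp
  have x: "0 < x" "x < pi / 2" using h by (simp_all add: x_def field_simps)
  then have pos: "sin x > 0" "cos x > 0" by (auto intro!: sin_gt_zero cos_gt_zero)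
  have "pi / real h = 2 * x" by (simp add: x_def)
  then have "1 + cos (pi / real h) = 2 * (cos x)\<^sup>2" "1 - cos (pi / real h) = 2 * (sin x)\<^sup>2"
    by (simp_all add: cos_double_cos cos_squared_eq)
  then show ?thesis
    using pos by (simp add: real_sqrt_divide real_sqrt_mult cot_def x_def)
qed

section \<open>Path-shaped and branched diagrams\<close>

lemma sum_path_neighbours:
  fixes g :: "nat \<Rightarrow> real"
  assumes "i < n" "\<And>j. j < n \<Longrightarrow> j \<noteq> Suc i \<Longrightarrow> i \<noteq> Suc j \<Longrightarrow> g j = 0"
  shows "(\<Sum>j<n. g j) = (if Suc i < n then g (Suc i) else 0) + (if 0 < i then g (i - 1) else 0)"
proof -
  have "(\<Sum>j<n. g j) = (\<Sum>j<n. (if j = Suc i then g (Suc i) else 0) + (if j = i - 1 then if 0 < i then g (i - 1) else 0 else 0))"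
    using assms by (intro sum.cong) (auto intro: assms(2))
  also have "\<dots> = (if Suc i < n then g (Suc i) else 0) + (if 0 < i then g (i - 1) else 0)"
    using assms(1) by (auto simp: sum.distrib)
  finally show ?thesis .
qed

lemma path_edges_iff': "{i, k} \<in> path_edges n \<longleftrightarrow> (k = Suc i \<and> k < n) \<or> (i = Suc k \<and> i < n)"
  by (auto simp: path_edges_def doubleton_eq_iff)

lemma coxeter_order_sym: "coxeter_order \<Gamma> i j = coxeter_order \<Gamma> j i"
  by (simp add: coxeter_order_def insert_commute)

text \<open>\<open>p i\<close> is the order on the edge from \<open>i\<close> to
  \<open>Suc i\<close>, so the eigenvector equation becomes a three-term recurrence; parity of the
  index is the two-coloring.\<close>

lemma kappa_path:
  assumes G: "standard_representation \<Gamma> G" and d: "rank \<Gamma> = d" "0 < d" and edges: "edges \<Gamma> = path_edges d"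
    and p: "\<And>i. Suc i < d \<Longrightarrow> coxeter_order \<Gamma> i (Suc i) = p i" "\<And>i. 2 \<le> p i"
    and v: "\<And>i. i < d \<Longrightarrow> 0 < v i" and h: "2 \<le> h"
    and perron: "\<And>i. i < d \<Longrightarrow> (if Suc i < d then cos (pi / p i) * v (Suc i) else 0)
      + (if 0 < i then cos (pi / p (i - 1)) * v (i - 1) else 0) = cos (pi / h) * v i"
  shows "kappa d G = cot (pi / (2 * real h))"
  unfolding half_angle_quotient[OF h, symmetric]
proof (rule kappa_standard_representation[OF G d, where v = v and \<epsilon> = even])
  have nonadjacent: "coxeter_order \<Gamma> i j = 2" if "\<not> (j = Suc i \<and> j < d)" "\<not> (i = Suc j \<and> i < d)" for i j
    using that by (simp add: coxeter_order_def edges path_edges_iff')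
  show "2 \<le> coxeter_order \<Gamma> i j" if "i \<noteq> j" for i j
    using p nonadjacent[of i j] coxeter_order_sym[of \<Gamma> i j] by (metis le_refl)
  show "even i \<noteq> even j" if "i < j" "j < d" "coxeter_order \<Gamma> i j \<noteq> 2" for i j
  proof -
    have "j = Suc i"
      by (rule ccontr) (use that nonadjacent[of j i] in auto)
    then show ?thesis by simp
  qed
  show "(\<Sum>j<d. (if i = j then 0 else cos (pi / coxeter_order \<Gamma> i j)) * v j) = cos (pi / h) * v i"
    if i: "i < d" for i
  proof -
    let ?g = "\<lambda>j. (if i = j then 0 else cos (pi / coxeter_order \<Gamma> i j)) * v j"
    have "?g j = 0" if "j \<noteq> Suc i" "i \<noteq> Suc j" for j
      using nonadjacent[of j i] that by simp
    then have "(\<Sum>j<d. ?g j) = (if Suc i < d then ?g (Suc i) else 0) + (if 0 < i then ?g (i - 1) else 0)"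
      by (intro sum_path_neighbours i)
    also have "(if Suc i < d then ?g (Suc i) else 0) = (if Suc i < d then cos (pi / p i) * v (Suc i) else 0)"
      using p(1)[of i] by simp
    also have "(if 0 < i then ?g (i - 1) else 0) = (if 0 < i then cos (pi / p (i - 1)) * v (i - 1) else 0)"
      using p(1)[of "i - 1"] i by (auto simp: coxeter_order_sym[of \<Gamma> i])
    finally show ?thesis using perron[OF i] by (simp only:)
  qed
qed (use v cos_pi_div_less_1[OF h] in auto)

text \<open>Without labels all edge weights are \<open>1 / 2\<close>, and the equations are stated
  after doubling. The extra vertex \<open>n\<close> hangs on \<open>b\<close> and takes the color
  opposite to that of \<open>b\<close>.\<close>

lemma kappa_branched:
  assumes G: "standard_representation \<Gamma> G" and d: "rank \<Gamma> = Suc n"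
    and edges: "edges \<Gamma> = path_edges n \<union> {{b, n}}" and label: "label \<Gamma> = Map.empty" and b: "b < n"
    and v: "\<And>i. i < Suc n \<Longrightarrow> 0 < v i" and h: "2 \<le> h"
    and perron: "\<And>i. i < n \<Longrightarrow> (if Suc i < n then v (Suc i) else 0)
      + (if 0 < i then v (i - 1) else 0) + (if i = b then v n else 0) = 2 * cos (pi / h) * v i"
    and perron_n: "v b = 2 * cos (pi / h) * v n"
  shows "kappa (Suc n) G = cot (pi / (2 * real h))"
  unfolding half_angle_quotient[OF h, symmetric]
proof (rule kappa_standard_representation[OF G d,
      where v = v and \<epsilon> = "\<lambda>i. if i = n then odd b else even i"])
  have order: "coxeter_order \<Gamma> i j =
    (if (j = Suc i \<and> j < n) \<or> (i = Suc j \<and> i < n) \<or> (i = b \<and> j = n) \<or> (i = n \<and> j = b) then 3 else 2)" for i j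
    by (auto simp: coxeter_order_def edges label path_edges_iff' doubleton_eq_iff)
  show "2 \<le> coxeter_order \<Gamma> i j" for i j by (simp add: order)
  show "(if i = n then odd b else even i) \<noteq> (if j = n then odd b else even j)"
    if "i < j" "j < Suc n" "coxeter_order \<Gamma> i j \<noteq> 2" for i j
    using that by (auto simp: order split: if_splits)
  let ?g = "\<lambda>i j. (if i = j then 0 else cos (pi / coxeter_order \<Gamma> i j)) * v j"
  show "(\<Sum>j<Suc n. ?g i j) = cos (pi / h) * v i" if i: "i < Suc n" for i
  proof (cases "i = n")
    case True
    have "(\<Sum>j<Suc n. ?g i j) = (\<Sum>j<Suc n. if j = b then v b / 2 else 0)"
      using b True by (intro sum.cong) (auto simp: order cos_60)
    with b perron_n True show ?thesis by simp
  next
    case False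
    with i have i: "i < n" by simp
    have "(\<Sum>j<n. ?g i j) = (if Suc i < n then v (Suc i) / 2 else 0) + (if 0 < i then v (i - 1) / 2 else 0)"
      using i by (subst sum_path_neighbours[of i]) (auto simp: order cos_60)
    moreover have "?g i n = (if i = b then v n / 2 else 0)"
      using i by (auto simp: order cos_60)
    ultimately show ?thesis using perron[OF i] by (auto split: if_splits)
  qed
qed (use v cos_pi_div_less_1[OF h] in auto)

section \<open>Sine vectors for the individual types\<close>

lemma sin_times_cos_sum: "2 * (sin x * cos y) = sin (x + y) + sin (x - y :: real)"
  by (simp add: sin_add sin_diff)

text \<open>The doubled eigenvector equation in the interior of an unlabeled path; this is why all
  eigenvectors are made of sines.\<close>

lemma sin_recurrence:
  "sin (real (Suc (Suc i)) * t) + sin (real i * t) = 2 * cos t * sin (real (Suc i) * t)"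
  using sin_times_cos_sum[of "real (Suc i) * t" t] by (simp add: algebra_simps)

lemma sin_multiple_pos:
  assumes "0 < i" "i < h"
  shows "0 < sin (real i * (pi / real h))"
proof (rule sin_gt_zero)
  show "0 < real i * (pi / real h)" using assms by simp
  have "real i < real h" using assms by simp
  then show "real i * (pi / real h) < pi" using assms by (simp add: field_simps)
qed

text \<open>The sines vanish at the two fictitious vertices just beyond the ends of the path, at the
  angles 0 and \<open>pi\<close>, so the recurrence also holds at the end vertices.\<close>

lemma kappa_A:
  assumes "standard_representation (diagram_A l) G" "1 \<le> l"
  shows "kappa l G = cot (pi / (2 * real (Suc l)))"
proof (rule kappa_path[OF assms(1), where p = "\<lambda>_. 3" and v = "\<lambda>i. sin (real (Suc i) * (pi / real (Suc l)))"])
  fix i assume i: "i < l"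
  let ?t = "pi / real (Suc l)"
  show "(if Suc i < l then cos (pi / real 3) * sin (real (Suc (Suc i)) * ?t) else 0)
      + (if 0 < i then cos (pi / real 3) * sin (real (Suc (i - 1)) * ?t) else 0)
      = cos ?t * sin (real (Suc i) * ?t)"
  proof -
    have "(if Suc i < l then cos (pi / real 3) * sin (real (Suc (Suc i)) * ?t) else 0)
        = sin (real (Suc (Suc i)) * ?t) / 2"
    proof (cases "Suc i < l")
      case False
      with i have "Suc i = l" by simp
      then have "real (Suc (Suc i)) * ?t = pi" by simp
      then show ?thesis using False by simp
    qed (simp add: cos_60)
    moreover have "(if 0 < i then cos (pi / real 3) * sin (real (Suc (i - 1)) * ?t) else 0)
        = sin (real i * ?t) / 2"
      by (cases i) (simp_all add: cos_60)
    ultimately show ?thesis using sin_recurrence[of i ?t] by simp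
  qed
  show "0 < sin (real (Suc i) * ?t)" using i by (intro sin_multiple_pos) auto
next
  show "coxeter_order (diagram_A l) i (Suc i) = 3" if "Suc i < l" for i
    using that by (simp add: coxeter_order_def diagram_A_def path_edges_iff)
qed (use assms in \<open>simp_all add: diagram_A_def\<close>)

text \<open>Covers types B, H and I. Dividing the last sine by \<open>2 * cos (pi / q)\<close>
  absorbs the label into the equation of the last vertex but one, which becomes the plain
  recurrence. The equation of the last vertex remains as \<open>cond\<close>; it is what selects
  \<open>h\<close>.\<close>

lemma kappa_path_end_label:
  assumes G: "standard_representation \<lparr>rank = l, edges = path_edges l, label = [{l - 2, l - 1} \<mapsto> q]\<rparr> G"
    and "2 \<le> l" "3 \<le> q" "l < h"
    and cond: "2 * (cos (pi / q))\<^sup>2 * sin (real (l - 1) * (pi / h)) = cos (pi / h) * sin (real l * (pi / h))"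
  shows "kappa l G = cot (pi / (2 * real h))"
proof -
  let ?t = "pi / real h"
  define k where "k = cos (pi / q)"
  have "real q \<ge> 3" using assms by simp
  then have "pi / q < pi / 2" by (simp add: field_simps)
  moreover have "0 < pi / q" using assms by simp
  ultimately have k: "k > 0" unfolding k_def by (intro cos_gt_zero) auto
  define v where "v i = (if Suc i = l then sin (real l * ?t) / (2 * k) else sin (real (Suc i) * ?t))" for i
  let ?p = "\<lambda>i. if i + 2 = l then q else 3"
  show ?thesis
  proof (rule kappa_path[OF G, where p = ?p and v = v])
    show "0 < v i" if "i < l" for i
      using that assms k sin_multiple_pos[of "Suc i" h] sin_multiple_pos[of l h]
      by (simp add: v_def del: of_nat_Suc)
    fix i assume i: "i < l"
    have less: "(if 0 < i then cos (pi / ?p (i - 1)) * v (i - 1) else 0) = sin (real i * ?t) / 2"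
      if "Suc i < l" using that by (cases i) (auto simp: v_def cos_60)
    consider "i + 2 < l" | "i + 2 = l" | "i + 1 = l" using i by linarith
    then show "(if Suc i < l then cos (pi / ?p i) * v (Suc i) else 0)
      + (if 0 < i then cos (pi / ?p (i - 1)) * v (i - 1) else 0) = cos ?t * v i"
    proof cases
      case 1
      then show ?thesis
        using less sin_recurrence[of i ?t] by (simp add: v_def cos_60 del: of_nat_Suc)
    next
      case 2
      then have "l = Suc (Suc i)" by simp
      then show ?thesis
        using less sin_recurrence[of i ?t] k by (simp add: v_def cos_60 flip: k_def del: of_nat_Suc)
    next
      case 3
      then obtain j where j: "i = Suc j" "l = Suc (Suc j)" using assms(2) by (cases i) auto
      have "k * sin (real (Suc j) * ?t) = cos ?t * (sin (real (Suc (Suc j)) * ?t) / (2 * k))"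
        using cond k by (simp add: j field_simps power2_eq_square flip: k_def del: of_nat_Suc)
      then show ?thesis by (simp add: v_def j flip: k_def del: of_nat_Suc)
    qed
  next
    show "coxeter_order \<lparr>rank = l, edges = path_edges l, label = [{l - 2, l - 1} \<mapsto> q]\<rparr> i (Suc i) = ?p i"
      if "Suc i < l" for i
      using that assms by (auto simp: coxeter_order_def path_edges_iff doubleton_eq_iff)
  qed (use assms in auto)
qed

lemma kappa_B:
  assumes "standard_representation (diagram_B l) G" "2 \<le> l"
  shows "kappa l G = cot (pi / (2 * real (2 * l)))"
proof (rule kappa_path_end_label[OF assms(1)[unfolded diagram_B_def] assms(2)])
  let ?t = "pi / real (2 * l)"
  have "real l * ?t = pi / 2" using assms by simp
  moreover have "real (l - 1) * ?t = pi / 2 - ?t"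
  proof -
    have "real (l - 1) = real l - 1" using assms by simp
    then have "real (l - 1) * ?t = real l * ?t - ?t" by (simp only: left_diff_distrib mult_1_left)
    then show ?thesis using \<open>real l * ?t = pi / 2\<close> by (simp only:)
  qed
  ultimately have "sin (real l * ?t) = 1" "sin (real (l - 1) * ?t) = cos ?t"
    by (simp_all only: sin_pi_half) (simp add: sin_diff)
  then show "2 * (cos (pi / real 4))\<^sup>2 * sin (real (l - 1) * ?t) = cos ?t * sin (real l * ?t)"
    by (simp only:) (simp add: cos_45 power2_eq_square)
qed (use assms in auto)

lemma kappa_I:
  assumes "standard_representation (diagram_I m) G" "3 \<le> m"
  shows "kappa 2 G = cot (pi / (2 * real m))"
proof (rule kappa_path_end_label)
  show "standard_representation \<lparr>rank = 2, edges = path_edges 2, label = [{2 - 2, 2 - 1} \<mapsto> m]\<rparr> G"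
    using assms by (simp add: diagram_I_def)
  have "sin (real 2 * (pi / m)) = 2 * sin (pi / m) * cos (pi / m)"
    using sin_double[of "pi / m"] by simp
  then show "2 * (cos (pi / m))\<^sup>2 * sin (real (2 - 1) * (pi / m)) = cos (pi / m) * sin (real 2 * (pi / m))"
    by (simp only: power2_eq_square) simp
qed (use assms in auto)

text \<open>The angle \<open>x = pi / 5\<close> satisfies
  \<open>cos (3 * x) = - cos (2 * x)\<close>; after division by the factor \<open>u + 1\<close> the
  cosine \<open>u\<close> is a root of a quadratic, and \<open>cos (2 * x)\<close> is
  \<open>2 * u^2 - 1\<close>.\<close>

lemma cos_36_minus_cos_72: "cos (pi / 5) - cos (2 * (pi / 5)) = 1 / 2"
proof -
  define u where "u = cos (pi / 5)"
  have "u > 0" unfolding u_def by (intro cos_gt_zero) (auto simp: field_simps)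
  have "cos (3 * (pi / 5)) = - cos (2 * (pi / 5))"
    using cos_pi_minus[of "2 * (pi / 5)"] by (simp add: field_simps)
  then have "4 * u ^ 3 - 3 * u = - (2 * u\<^sup>2 - 1)"
    unfolding u_def cos_treble_cos cos_double_cos .
  then have "(u + 1) * (4 * u\<^sup>2 - 2 * u - 1) = 0"
    by (simp add: algebra_simps power3_eq_cube power2_eq_square)
  with \<open>u > 0\<close> have "4 * u\<^sup>2 - 2 * u - 1 = 0" by simp
  then show ?thesis unfolding cos_double_cos u_def[symmetric] by simp
qed

text \<open>The same identity in multiples of \<open>pi / 30\<close>, as needed for the Coxeter
  number 30 of types H4 and E8.\<close>

lemma sin_54_minus_sin_18: "sin (9 * (pi / 30)) - sin (3 * (pi / 30)) = 1 / 2"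
proof -
  have "sin (9 * (pi / 30)) = cos (pi / 5)" "sin (3 * (pi / 30)) = cos (2 * (pi / 5))"
    unfolding sin_cos_eq by (rule arg_cong[of _ _ cos], simp add: field_simps)+
  then show ?thesis using cos_36_minus_cos_72 by simp
qed

text \<open>Doubling the angle writes the squared cosine of the label as a cosine of a multiple of
  \<open>t\<close>. The condition then expands into sums of sines, which cancel because
  \<open>10 * t = pi\<close>.\<close>

lemma kappa_H3:
  assumes "standard_representation (diagram_H 3) G"
  shows "kappa 3 G = cot (pi / (2 * real 10))"
proof (rule kappa_path_end_label)
  show "standard_representation \<lparr>rank = 3, edges = path_edges 3, label = [{3 - 2, 3 - 1} \<mapsto> 5]\<rparr> G"
    using assms by (simp add: diagram_H_def)
  define t where "t = pi / 10"
  have k: "2 * (cos (pi / 5))\<^sup>2 = 1 + cos (4 * t)"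
    using cos_double_cos[of "pi / 5"] by (simp add: t_def)
  have "sin (6 * t) = sin (4 * t)"
    using sin_pi_minus[of "4 * t"] by (simp add: t_def field_simps)
  moreover have "2 * ((1 + cos (4 * t)) * sin (2 * t)) = 2 * sin (2 * t) + sin (6 * t) - sin (2 * t)"
    using sin_times_cos_sum[of "2 * t" "4 * t"] sin_minus[of "2 * t"] by (simp add: algebra_simps)
  moreover have "2 * (cos t * sin (3 * t)) = sin (4 * t) + sin (2 * t)"
    using sin_times_cos_sum[of "3 * t" t] by (simp add: algebra_simps)
  ultimately show "2 * (cos (pi / real 5))\<^sup>2 * sin (real (3 - 1) * (pi / real 10))
      = cos (pi / real 10) * sin (real 3 * (pi / real 10))"
    using k by (simp add: t_def)
qed auto

lemma kappa_H4:
  assumes "standard_representation (diagram_H 4) G"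
  shows "kappa 4 G = cot (pi / (2 * real 30))"
proof (rule kappa_path_end_label)
  show "standard_representation \<lparr>rank = 4, edges = path_edges 4, label = [{4 - 2, 4 - 1} \<mapsto> 5]\<rparr> G"
    using assms by (simp add: diagram_H_def)
  define t where "t = pi / 30"
  have k: "2 * (cos (pi / 5))\<^sup>2 = 1 + cos (12 * t)"
    using cos_double_cos[of "pi / 5"] by (simp add: t_def)
  have "sin (15 * t) = 1" "sin (5 * t) = 1 / 2" by (simp_all add: t_def sin_30)
  moreover have "sin (9 * t) - sin (3 * t) = 1 / 2" using sin_54_minus_sin_18 by (simp add: t_def)
  moreover have "2 * ((1 + cos (12 * t)) * sin (3 * t)) = 2 * sin (3 * t) + sin (15 * t) - sin (9 * t)"
    using sin_times_cos_sum[of "3 * t" "12 * t"] sin_minus[of "9 * t"] by (simp add: algebra_simps)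
  moreover have "2 * (cos t * sin (4 * t)) = sin (5 * t) + sin (3 * t)"
    using sin_times_cos_sum[of "4 * t" t] by (simp add: algebra_simps)
  ultimately show "2 * (cos (pi / real 5))\<^sup>2 * sin (real (4 - 1) * (pi / real 30))
      = cos (pi / real 30) * sin (real 4 * (pi / real 30))"
    using k by (simp add: t_def)
qed auto

text \<open>The label sits in the middle, so the vector is symmetric under reversal: sines of
  \<open>t\<close>, \<open>2 * t\<close>, \<open>2 * t\<close>, \<open>t\<close>. The inner
  equations hold because \<open>sin (3 * t)\<close> is the cosine of the label and
  \<open>sin (2 * t) = 1 / 2\<close>.\<close>

lemma kappa_F4:
  assumes "standard_representation diagram_F4 G"
  shows "kappa 4 G = cot (pi / (2 * real 12))"
proof (rule kappa_path[OF assms, where p = "\<lambda>i. if i = 1 then 4 else 3"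
      and v = "\<lambda>i. sin ((if i = 0 \<or> i = 3 then 1 else 2) * (pi / 12))"])
  define t where "t = pi / 12"
  fix i :: nat assume "i < 4"
  then consider "i = 0" | "i = 1" | "i = 2" | "i = 3" by linarith
  note i = this
  have 1: "sin (2 * t) / 2 = cos t * sin t" by (simp add: sin_double)
  have "2 * (cos t * sin (2 * t)) = sin t + sin (3 * t)"
    using sin_times_cos_sum[of "2 * t" t] by (simp add: algebra_simps)
  moreover have "sin (3 * t) = sqrt 2 / 2" "sin (2 * t) = 1 / 2"
    by (simp_all add: t_def sin_45 sin_30)
  moreover from this have "sqrt 2 / 2 * sin (2 * t) = sqrt 2 / 4" by simp
  ultimately have 2: "sqrt 2 / 2 * sin (2 * t) + sin t / 2 = cos t * sin (2 * t)" by linarith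
  show "(if Suc i < 4 then cos (pi / real (if i = 1 then 4 else 3)) *
        sin ((if Suc i = 0 \<or> Suc i = 3 then 1 else 2) * (pi / 12)) else 0)
      + (if 0 < i then cos (pi / real (if i - 1 = 1 then 4 else 3)) *
        sin ((if i - 1 = 0 \<or> i - 1 = 3 then 1 else 2) * (pi / 12)) else 0)
      = cos (pi / real 12) * sin ((if i = 0 \<or> i = 3 then 1 else 2) * (pi / 12))"
    using i 1 2 unfolding t_def by cases (simp_all add: cos_60 cos_45)
  show "0 < sin ((if i = 0 \<or> i = 3 then 1 else 2) * (pi / 12))"
    by (intro sin_gt_zero) auto
next
  fix i assume "Suc i < 4"
  then consider "i = 0" | "i = 1" | "i = 2" by linarith
  then show "coxeter_order diagram_F4 i (Suc i) = (if i = 1 then 4 else 3)"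
    by cases (simp_all add: coxeter_order_def diagram_F4_def path_edges_iff doubleton_eq_iff)
qed (simp_all add: diagram_F4_def)

lemma kappa_D:
  assumes G: "standard_representation (diagram_D l) G" and l: "4 \<le> l"
  shows "kappa l G = cot (pi / (2 * real (2 * (l - 1))))"
proof -
  obtain n where n: "l = Suc (Suc (Suc n))" "1 \<le> n" using l by (cases l; cases "l - 1"; cases "l - 2") auto
  define t where "t = pi / real (2 * Suc (Suc n))"
  \<comment> \<open>The sine that would continue the path beyond the fork is
    \<open>sin (pi / 2) = 1\<close>; the two leaves share it equally.\<close>
  define v where "v i = (if i \<le> n then sin (real (Suc i) * t) else 1 / 2)" for i
  have end_: "sin (real (Suc (Suc n)) * t) = 1"
  proof -
    have "real (Suc (Suc n)) * t = pi / 2" by (simp add: t_def field_simps)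
    then show ?thesis by (simp only: sin_pi_half)
  qed
  have end': "sin (real (Suc n) * t) = cos t"
  proof -
    have "real (Suc n) * t = pi / 2 - t" by (simp add: t_def field_simps)
    then show ?thesis by (simp only:) (simp add: sin_diff)
  qed
  have "kappa (Suc (Suc (Suc n))) G = cot (pi / (2 * real (2 * Suc (Suc n))))"
  proof (rule kappa_branched[where b = n and v = v])
    show "standard_representation (diagram_D (Suc (Suc (Suc n)))) G" using G n by simp
    show "0 < v i" for i
      using sin_multiple_pos[of "Suc i" "2 * Suc (Suc n)"] by (simp add: v_def t_def)
    fix i assume "i < Suc (Suc n)"
    then consider "i < n" | "i = n" | "i = Suc n" by linarith
    then show "(if Suc i < Suc (Suc n) then v (Suc i) else 0) + (if 0 < i then v (i - 1) else 0)
        + (if i = n then v (Suc (Suc n)) else 0) = 2 * cos (pi / real (2 * Suc (Suc n))) * v i"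
      unfolding t_def[symmetric]
    proof cases
      case 1
      moreover have "(if 0 < i then v (i - 1) else 0) = sin (real i * t)"
        using 1 by (cases i) (auto simp: v_def)
      ultimately show "(if Suc i < Suc (Suc n) then v (Suc i) else 0) + (if 0 < i then v (i - 1) else 0)
        + (if i = n then v (Suc (Suc n)) else 0) = 2 * cos t * v i"
        using sin_recurrence[of i t] by (simp add: v_def del: of_nat_Suc)
    next
      case 2
      moreover have "v (n - 1) = sin (real n * t)"
        using n by (cases n) (auto simp: v_def)
      ultimately show "(if Suc i < Suc (Suc n) then v (Suc i) else 0) + (if 0 < i then v (i - 1) else 0)
        + (if i = n then v (Suc (Suc n)) else 0) = 2 * cos t * v i"
        using sin_recurrence[of n t] end_ n by (simp add: v_def del: of_nat_Suc)
    next
      case 3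
      then show "(if Suc i < Suc (Suc n) then v (Suc i) else 0) + (if 0 < i then v (i - 1) else 0)
        + (if i = n then v (Suc (Suc n)) else 0) = 2 * cos t * v i"
        using end' by (simp add: v_def del: of_nat_Suc)
    qed
  next
    show "v n = 2 * cos (pi / real (2 * Suc (Suc n))) * v (Suc (Suc n))"
      unfolding t_def[symmetric] using end' by (simp add: v_def del: of_nat_Suc)
  qed (simp_all add: diagram_D_def)
  then show ?thesis by (simp add: n)
qed

text \<open>Each of the three arms at vertex 2 carries a sine solution that vanishes beyond its free
  end, scaled to take the value \<open>sin (3 * t)\<close> at vertex 2. The equation at the branch
  vertex itself is left over as \<open>cond\<close>.\<close>

lemma kappa_E:
  assumes G: "standard_representation (diagram_E n) G" and n: "6 \<le> n" "n \<le> h"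
  defines "t \<equiv> pi / real h"
  assumes cond: "sin (3 * t) / sin (real (n - 3) * t) * sin (real (n - 4) * t) + sin (3 * t) / (2 * cos t) = sin (4 * t)"
  shows "kappa n G = cot (pi / (2 * real h))"
proof -
  obtain k where k: "n = Suc (k + 5)" using n by (intro that[of "n - 6"]) auto
  have pos: "0 < sin (real i * t)" if "0 < i" "i < n" for i
    using sin_multiple_pos[of i h] that n by (simp add: t_def)
  have "real h \<ge> 6" using n by simp
  then have "t < pi / 2" "0 < t" by (simp_all add: t_def field_simps)
  then have cos: "0 < cos t" by (intro cos_gt_zero) auto
  define a where "a = sin (3 * t) / sin (real (k + 3) * t)"
  have a: "0 < a" "a * sin (real (k + 3) * t) = sin (3 * t)"
    using pos[of 3] pos[of "k + 3"] by (simp_all add: a_def k)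
  define v where "v i = (if i \<le> 2 then sin (real (Suc i) * t)
    else if i < n - 1 then a * sin (real (n - 1 - i) * t) else sin (3 * t) / (2 * cos t))" for i
  have "kappa (Suc (k + 5)) G = cot (pi / (2 * real h))"
  proof (rule kappa_branched[where b = 2 and v = v])
    show "standard_representation (diagram_E (Suc (k + 5))) G" using G k by simp
    show "0 < v i" if "i < Suc (k + 5)" for i
      using that pos[of "Suc i"] pos[of "n - 1 - i"] pos[of 3] a cos by (auto simp: v_def k)
    show "v 2 = 2 * cos (pi / real h) * v (k + 5)"
      using cos by (simp add: v_def k flip: t_def)
    fix i assume i: "i < k + 5"
    then consider "i = 0" | "i = 1" | "i = 2" | "3 \<le> i" by linarith
    then show "(if Suc i < k + 5 then v (Suc i) else 0) + (if 0 < i then v (i - 1) else 0)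
      + (if i = 2 then v (k + 5) else 0) = 2 * cos (pi / real h) * v i"
      unfolding t_def[symmetric]
    proof cases
      case 1
      then show "(if Suc i < k + 5 then v (Suc i) else 0) + (if 0 < i then v (i - 1) else 0)
        + (if i = 2 then v (k + 5) else 0) = 2 * cos t * v i"
        using sin_recurrence[of 0 t] by (simp add: v_def)
    next
      case 2
      then show "(if Suc i < k + 5 then v (Suc i) else 0) + (if 0 < i then v (i - 1) else 0)
        + (if i = 2 then v (k + 5) else 0) = 2 * cos t * v i"
        using sin_recurrence[of 1 t] by (simp add: v_def)
    next
      case 3
      have "a * sin (real (k + 2) * t) + sin (3 * t) / (2 * cos t) = sin (4 * t)"
        using cond by (simp add: a_def k algebra_simps)
      then show "(if Suc i < k + 5 then v (Suc i) else 0) + (if 0 < i then v (i - 1) else 0)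
        + (if i = 2 then v (k + 5) else 0) = 2 * cos t * v i"
        using sin_recurrence[of 2 t] 3 by (simp add: v_def k algebra_simps)
    next
      case 4
      \<comment> \<open>\<open>j\<close> counts the vertices that follow \<open>i\<close> on its
        arm, since the sines on this arm are counted from the free end.\<close>
      define j where "j = k + 4 - i"
      have ij: "i + j = k + 4" using i by (simp add: j_def)
      have "(if Suc i < k + 5 then v (Suc i) else 0) = a * sin (real j * t)"
      proof (cases "j = 0")
        case False
        then have "n - 1 - Suc i = j" "\<not> Suc i \<le> 2" "Suc i < n - 1" using ij 4 by (simp_all add: k)
        with False ij show ?thesis by (simp add: v_def)
      qed (use ij in simp)
      moreover have "v i = a * sin (real (Suc j) * t)"
      proof -
        have "n - 1 - i = Suc j" "\<not> i \<le> 2" "i < n - 1" using i 4 by (simp_all add: k j_def)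
        then show ?thesis by (simp add: v_def del: of_nat_Suc)
      qed
      moreover have "v (i - 1) = a * sin (real (Suc (Suc j)) * t)"
      proof (cases "i = 3")
        case True
        then have "Suc (Suc j) = k + 3" using ij by simp
        then have "a * sin (real (Suc (Suc j)) * t) = sin (3 * t)" using a(2) by (simp only:)
        then show ?thesis using True by (simp add: v_def del: of_nat_Suc)
      next
        case False
        with 4 i have "n - 1 - (i - 1) = Suc (Suc j)" "\<not> i - 1 \<le> 2" "i - 1 < n - 1" by (auto simp: k j_def)
        then show ?thesis by (simp add: v_def del: of_nat_Suc)
      qed
      ultimately show "(if Suc i < k + 5 then v (Suc i) else 0) + (if 0 < i then v (i - 1) else 0)
        + (if i = 2 then v (k + 5) else 0) = 2 * cos t * v i"
        using 4 sin_recurrence[of j t] by (simp add: distrib_left[symmetric] del: of_nat_Suc)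
    qed
  qed (use n in \<open>simp_all add: diagram_E_def k add.commute\<close>)
  then show ?thesis by (simp add: k)
qed

lemma kappa_E6:
  assumes "standard_representation (diagram_E 6) G"
  shows "kappa 6 G = cot (pi / (2 * real 12))"
proof (rule kappa_E[OF assms])
  define t where "t = pi / 12"
  have 1: "sin (3 * t) = sqrt 2 / 2" "sin (2 * t) = 1 / 2" "sin (4 * t) = sqrt 3 / 2"
    by (simp_all add: t_def sin_45 sin_30 sin_60)
  have "cos t = cos (pi / 3 - pi / 4)" by (simp add: t_def field_simps)
  also have "\<dots> = sqrt 2 / 4 * (1 + sqrt 3)"
    unfolding cos_diff by (simp add: cos_60 cos_45 sin_60 sin_45 algebra_simps)
  finally have c: "cos t = sqrt 2 / 4 * (1 + sqrt 3)" .
  have "1 + sqrt 3 > 0" by (simp add: add_pos_pos)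
  moreover have "sqrt 2 / 2 / (2 * (sqrt 2 / 4 * w)) = 1 / w" if "w > 0" for w :: real
    using that by (simp add: field_simps)
  ultimately have "sqrt 2 / 2 / (2 * cos t) = 1 / (1 + sqrt 3)" unfolding c by blast
  also have "\<dots> = (sqrt 3 - 1) / 2" using \<open>1 + sqrt 3 > 0\<close> by (simp add: field_simps)
  finally have "sin (3 * t) / (2 * cos t) = (sqrt 3 - 1) / 2" by (simp add: 1)
  moreover have "sin (3 * t) / sin (3 * t) = 1" by (simp add: 1(1))
  ultimately have "sin (3 * t) / sin (3 * t) * sin (2 * t) + sin (3 * t) / (2 * cos t) = sin (4 * t)"
    unfolding 1(2,3) by (simp only:) (simp add: diff_divide_distrib)
  then show "sin (3 * (pi / real 12)) / sin (real (6 - 3) * (pi / real 12)) * sin (real (6 - 4) * (pi / real 12))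
      + sin (3 * (pi / real 12)) / (2 * cos (pi / real 12)) = sin (4 * (pi / real 12))"
    by (simp add: t_def)
qed auto

text \<open>In degrees the condition reads 1 / (4 sin 40) + 1 / (4 cos 10) = sin 40. Cleared of
  denominators it follows from 2 sin^2 40 = 1 - sin 10 and cos 10 - sin 20 = sin 40.\<close>

lemma kappa_E7:
  assumes "standard_representation (diagram_E 7) G"
  shows "kappa 7 G = cot (pi / (2 * real 18))"
proof (rule kappa_E[OF assms])
  define t where "t = pi / 18"
  have s3: "sin (3 * t) = 1 / 2" by (simp add: t_def sin_30)
  have pos: "0 < sin (4 * t)" "0 < cos t" by (auto simp: t_def intro!: sin_gt_zero cos_gt_zero)
  have shift: "cos (8 * t) = sin t" "cos t = sin (8 * t)" "cos (5 * t) = sin (4 * t)"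
    unfolding sin_cos_eq by (simp_all add: t_def field_simps)
  have "sin (8 * t) - sin (2 * t) = 2 * sin (3 * t) * cos (5 * t)"
    using sin_add[of "5 * t" "3 * t"] sin_diff[of "5 * t" "3 * t"] by (simp add: algebra_simps)
  then have 1: "cos t - sin (2 * t) = sin (4 * t)" using s3 shift(2,3) by simp
  have "2 * (sin (4 * t) * sin (4 * t)) = 1 - sin t"
    using cos_double_sin[of "4 * t"] shift(1) by (simp add: power2_eq_square)
  then have "4 * sin (4 * t) * sin (4 * t) * cos t = 2 * (1 - sin t) * cos t"
    by (simp add: mult.assoc flip: mult_2)
  also have "\<dots> = 2 * cos t - sin (2 * t)" unfolding sin_double by (simp add: algebra_simps)
  finally have "4 * sin (4 * t) * sin (4 * t) * cos t = cos t + sin (4 * t)" using 1 by simp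
  then have "1 / (4 * sin (4 * t)) + 1 / (4 * cos t) = sin (4 * t)"
    using pos by (simp add: field_simps)
  then have "sin (3 * t) / sin (4 * t) * sin (3 * t) + sin (3 * t) / (2 * cos t) = sin (4 * t)"
    unfolding s3 by simp
  then show "sin (3 * (pi / real 18)) / sin (real (7 - 3) * (pi / real 18)) * sin (real (7 - 4) * (pi / real 18))
      + sin (3 * (pi / real 18)) / (2 * cos (pi / real 18)) = sin (4 * (pi / real 18))"
    by (simp add: t_def)
qed auto

text \<open>In degrees the condition reads 2 sin 18 sin 24 + sin 18 / (2 cos 6) = sin 24. After
  multiplication by 2 cos 6 only sin 30 and sin 18 remain, and both sides equal 1/2 + sin
  18.\<close>

lemma kappa_E8:
  assumes "standard_representation (diagram_E 8) G"
  shows "kappa 8 G = cot (pi / (2 * real 30))"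
proof (rule kappa_E[OF assms])
  define t where "t = pi / 30"
  have s5: "sin (5 * t) = 1 / 2" by (simp add: t_def sin_30)
  have pos: "0 < cos t" by (auto simp: t_def intro!: cos_gt_zero)
  have "sin (9 * t) = cos (6 * t)" unfolding sin_cos_eq by (simp add: t_def field_simps)
  then have "2 * (sin (3 * t) * sin (3 * t)) = 1 - sin (9 * t)"
    using cos_double_sin[of "3 * t"] by (simp add: power2_eq_square)
  moreover have "sin (9 * t) - sin (3 * t) = 1 / 2" using sin_54_minus_sin_18 by (simp add: t_def)
  moreover have "2 * sin (3 * t) * (sin (5 * t) + sin (3 * t)) = sin (3 * t) + 2 * (sin (3 * t) * sin (3 * t))"
    unfolding s5 by (simp add: distrib_left)
  ultimately have s3: "2 * sin (3 * t) * (sin (5 * t) + sin (3 * t)) = 1 / 2" by linarith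
  have s4: "2 * (sin (4 * t) * cos t) = sin (5 * t) + sin (3 * t)"
    using sin_times_cos_sum[of "4 * t" t] by (simp add: algebra_simps)
  have "2 * cos t * (2 * sin (3 * t) * sin (4 * t)) + sin (3 * t) = 2 * cos t * sin (4 * t)"
  proof -
    have "2 * cos t * (2 * sin (3 * t) * sin (4 * t)) = 2 * sin (3 * t) * (2 * (sin (4 * t) * cos t))"
      by simp
    also have "\<dots> = 1 / 2" using s3 s4 by simp
    finally have "2 * cos t * (2 * sin (3 * t) * sin (4 * t)) = 1 / 2" .
    moreover have "2 * cos t * sin (4 * t) = 1 / 2 + sin (3 * t)"
      unfolding s4[unfolded s5, symmetric] by simp
    ultimately show ?thesis by linarith
  qed
  then have "2 * sin (3 * t) * sin (4 * t) + sin (3 * t) / (2 * cos t) = sin (4 * t)"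
    using pos by (simp add: field_simps)
  then have "sin (3 * t) / sin (5 * t) * sin (4 * t) + sin (3 * t) / (2 * cos t) = sin (4 * t)"
    unfolding s5 by simp
  then show "sin (3 * (pi / real 30)) / sin (real (8 - 3) * (pi / real 30)) * sin (real (8 - 4) * (pi / real 30))
      + sin (3 * (pi / real 30)) / (2 * cos (pi / real 30)) = sin (4 * (pi / real 30))"
    by (simp add: t_def)
qed auto

section \<open>Degrees of algebraic numbers\<close>

text \<open>Polymorphic in the field: the numbers studied are real, but their conjugates have to be
  sought among the complex numbers.\<close>

definition rpoly :: "rat poly \<Rightarrow> 'a :: field_char_0 \<Rightarrow> 'a" where
  "rpoly q x = poly (map_poly of_rat q) x"

lemma rpoly_0 [simp]: "rpoly 0 x = 0"
  by (simp add: rpoly_def)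

lemma rpoly_pCons [simp]: "rpoly (pCons a q) x = of_rat a + x * rpoly q x"
  by (simp add: rpoly_def of_rat_hom.map_poly_pCons_hom)

lemma rpoly_1 [simp]: "rpoly 1 x = 1"
  by (simp add: rpoly_def)

lemma rpoly_add: "rpoly (p + q) x = rpoly p x + rpoly q x"
  by (induction p q rule: poly_induct2) (simp_all add: of_rat_add algebra_simps)

lemma rpoly_smult: "rpoly (smult a p) x = of_rat a * rpoly p x"
  by (induction p) (simp_all add: of_rat_mult algebra_simps)

lemma rpoly_mult: "rpoly (p * q) x = rpoly p x * rpoly q x"
  by (induction p) (simp_all add: rpoly_add rpoly_smult algebra_simps)

lemma rpoly_diff: "rpoly (p - q) x = rpoly p x - rpoly q x"
  using rpoly_add[of "p - q" q x] by simp

lemma rpoly_pcompose: "rpoly (pcompose p q) x = rpoly p (rpoly q x)"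
  by (induction p) (simp_all add: rpoly_add rpoly_mult pcompose_pCons)

lemma rpoly_of_rat: "rpoly p (of_rat x) = of_rat (poly p x)"
  by (induction p) (simp_all add: of_rat_add of_rat_mult)

lemma rpoly_of_real: "rpoly p (of_real x :: complex) = of_real (rpoly p x)"
proof -
  have "(of_rat a :: complex) = of_real (of_rat a)" for a
    by (cases a) (simp add: of_rat_rat)
  then show ?thesis by (induction p) simp_all
qed

text \<open>A lower bound on degrees is all that minimality demands of a monic polynomial with root
  \<open>x\<close>, so minimal polynomials never have to be constructed as such.\<close>

definition min_degree :: "nat \<Rightarrow> 'a :: field_char_0 \<Rightarrow> bool" where
  "min_degree n x \<longleftrightarrow> (\<forall>q. q \<noteq> 0 \<longrightarrow> rpoly q x = 0 \<longrightarrow> n \<le> degree q)"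

lemma min_degreeD: "min_degree n x \<Longrightarrow> q \<noteq> 0 \<Longrightarrow> rpoly q x = 0 \<Longrightarrow> n \<le> degree q"
  by (simp add: min_degree_def)

lemma obtain_min_degree:
  assumes "q \<noteq> 0" "rpoly q x = 0"
  obtains f where "f \<noteq> 0" "rpoly f x = 0" "min_degree (degree f) x" "degree f \<le> degree q"
proof -
  let ?P = "\<lambda>f. f \<noteq> 0 \<and> rpoly f x = 0"
  define f where "f = arg_min degree ?P"
  have "?P f" unfolding f_def by (rule arg_min_natI[of ?P q]) (use assms in simp)
  moreover have "degree f \<le> degree p" if "?P p" for p
    unfolding f_def by (rule arg_min_nat_le[of ?P]) (rule that)
  ultimately show ?thesis using that[of f] assms by (simp add: min_degree_def)
qed

lemma min_degree_dvd:
  assumes "f \<noteq> 0" "rpoly f x = 0" "min_degree (degree f) x" "rpoly q x = 0"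
  shows "f dvd q"
proof -
  have "rpoly (q mod f) x = 0"
    using assms(2,4) rpoly_add[of "f * (q div f)" "q mod f" x] by (simp add: rpoly_mult)
  moreover have "q mod f = 0 \<or> degree (q mod f) < degree f"
    using assms(1) by (rule degree_mod_less)
  ultimately have "q mod f = 0" using min_degreeD[OF assms(3), of "q mod f"] by linarith
  then show ?thesis by (simp add: dvd_eq_mod_eq_0)
qed

lemma rpoly_const: "degree q = 0 \<Longrightarrow> rpoly q x = 0 \<Longrightarrow> q = 0"
  by (elim degree_eq_zeroE) simp

text \<open>An annihilator of \<open>y'\<close> of smaller degree would give a proper factor of
  \<open>r\<close>, and \<open>y\<close> would be a root of this factor or of its cofactor.\<close>

lemma min_degree_conjugate:
  assumes r: "r \<noteq> 0" "rpoly r y = 0" "min_degree (degree r) y" and y': "rpoly r y' = 0"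
  shows "min_degree (degree r) y'"
proof -
  obtain g where g: "g \<noteq> 0" "rpoly g y' = 0" "min_degree (degree g) y'"
    using obtain_min_degree[OF r(1) y'] by blast
  then obtain h where h: "r = g * h" using min_degree_dvd[OF g y'] by blast
  with r g have "h \<noteq> 0" by auto
  have deg: "degree r = degree g + degree h" using \<open>h \<noteq> 0\<close> g(1) by (simp add: h degree_mult_eq)
  have "degree g \<noteq> 0" using rpoly_const[of g y'] g by auto
  have "rpoly g y = 0 \<or> rpoly h y = 0" using r(2) by (simp add: h rpoly_mult)
  then have "degree r \<le> degree g \<or> degree r \<le> degree h"
    using min_degreeD[OF r(3)] g(1) \<open>h \<noteq> 0\<close> by blast
  then have "degree g = degree r" using deg \<open>degree g \<noteq> 0\<close> by linarith
  with g(3) show ?thesis by simp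
qed

lemma min_degree_scaled:
  assumes "min_degree n x" "c \<noteq> 0"
  shows "min_degree n (of_rat c * x)"
  unfolding min_degree_def
proof (intro allI impI)
  fix q :: "rat poly" assume q: "q \<noteq> 0" "rpoly q (of_rat c * x) = 0"
  have "degree (pcompose q [:0, c:]) = degree q"
    using \<open>c \<noteq> 0\<close> by (simp add: degree_pcompose)
  moreover have "pcompose q [:0, c:] \<noteq> 0"
    using q(1) \<open>c \<noteq> 0\<close> pcompose_eq_0[of q "[:0, c:]"] by auto
  moreover have "rpoly (pcompose q [:0, c:]) x = 0"
    using q(2) by (simp add: rpoly_pcompose mult.commute)
  ultimately show "n \<le> degree q" using min_degreeD[OF assms(1)] by metis
qed

section \<open>Quadratic extensions by a reciprocal\<close>

text \<open>The Dickson polynomials, that is, the rescaled Chebyshev polynomials of the first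
  kind.\<close>

fun recip_power :: "nat \<Rightarrow> rat poly" where
  "recip_power 0 = [:2:]"
| "recip_power (Suc 0) = [:0, 1:]"
| "recip_power (Suc (Suc m)) = [:0, 1:] * recip_power (Suc m) - recip_power m"

lemma rpoly_recip_power:
  "x \<noteq> 0 \<Longrightarrow> rpoly (recip_power m) (x + 1 / x) = x ^ m + 1 / x ^ m"
  by (induction m rule: recip_power.induct) (simp_all add: rpoly_diff rpoly_mult field_simps)

lemma degree_recip_power: "degree (recip_power m) \<le> m"
proof (induction m rule: recip_power.induct)
  case (3 m)
  have "degree ([:0, 1:] * recip_power (Suc m)) \<le> Suc (Suc m)"
    using degree_mult_le[of "[:0, 1:]" "recip_power (Suc m)"] 3 by simp
  with 3 show ?case by (simp del: mult_pCons_left add: degree_diff_le)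
qed auto

text \<open>The shift by \<open>m\<close> makes the induction work: removing the constant
  coefficient of \<open>f\<close> raises it by one.\<close>

lemma shifted_reciprocal_sum:
  "\<exists>t. degree t \<le> m + degree f \<and>
    (\<forall>x::'a::field_char_0. x \<noteq> 0 \<longrightarrow> rpoly t (x + 1 / x) = x ^ m * rpoly f x + rpoly f (1 / x) / x ^ m)"
proof (induction f arbitrary: m)
  case 0
  show ?case by (intro exI[of _ 0]) auto
next
  case (pCons b h)
  show ?case
  proof (cases "h = 0")
    case True
    show ?thesis
      using degree_recip_power[of m] True degree_smult_le[of b "recip_power m"]
      by (intro exI[of _ "smult b (recip_power m)"]) (auto simp: rpoly_smult rpoly_recip_power algebra_simps)
  next
    case False
    obtain t where t: "degree t \<le> Suc m + degree h"
      "\<And>x::'a. x \<noteq> 0 \<Longrightarrow> rpoly t (x + 1 / x) = x ^ Suc m * rpoly h x + rpoly h (1 / x) / x ^ Suc m"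
      using pCons.IH[of "Suc m"] by blast
    have "degree (smult b (recip_power m)) \<le> m"
      using degree_smult_le[of b "recip_power m"] degree_recip_power[of m] by simp
    then have "degree (smult b (recip_power m) + t) \<le> m + degree (pCons b h)"
      using t(1) False by (intro degree_add_le) auto
    moreover have "rpoly (smult b (recip_power m) + t) (x + 1 / x)
        = x ^ m * rpoly (pCons b h) x + rpoly (pCons b h) (1 / x) / x ^ m" if "x \<noteq> 0" for x :: 'a
      unfolding rpoly_add rpoly_smult rpoly_recip_power[OF that] t(2)[OF that] rpoly_pCons
      using that by (simp add: field_simps)
    ultimately show ?thesis by blast
  qed
qed

text \<open>\<open>N\<close> plays the role of the norm of \<open>f x\<close> down to the field of
  \<open>x + 1 / x\<close>. For \<open>f = a + x * g\<close> the product consists of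
  \<open>a * a\<close>, of \<open>a\<close> times a symmetrized sum, and of the norm of
  \<open>g\<close>.\<close>

lemma reciprocal_norm_exists:
  "\<exists>N. degree N \<le> degree f \<and>
    (\<forall>x::'a::field_char_0. x \<noteq> 0 \<longrightarrow> rpoly N (x + 1 / x) = rpoly f x * rpoly f (1 / x))"
proof (induction f)
  case 0
  show ?case by (intro exI[of _ 0]) auto
next
  case (pCons a g)
  obtain N where N: "degree N \<le> degree g"
    "\<And>x::'a. x \<noteq> 0 \<Longrightarrow> rpoly N (x + 1 / x) = rpoly g x * rpoly g (1 / x)"
    using pCons.IH by blast
  obtain t where t: "degree t \<le> 1 + degree g"
    "\<And>x::'a. x \<noteq> 0 \<Longrightarrow> rpoly t (x + 1 / x) = x ^ 1 * rpoly g x + rpoly g (1 / x) / x ^ 1"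
    using shifted_reciprocal_sum[of 1 g, where 'a = 'a] by blast
  show ?case
  proof (cases "g = 0")
    case True
    then show ?thesis by (intro exI[of _ "[:a * a:]"]) (auto simp: of_rat_mult)
  next
    case False
    have "degree (smult a t) \<le> Suc (degree g)" using degree_smult_le[of a t] t(1) by simp
    then have "degree ([:a * a:] + smult a t + N) \<le> degree (pCons a g)"
      using N(1) False by (intro degree_add_le) auto
    moreover have "rpoly ([:a * a:] + smult a t + N) (x + 1 / x)
        = rpoly (pCons a g) x * rpoly (pCons a g) (1 / x)" if "x \<noteq> 0" for x :: 'a
      unfolding rpoly_add rpoly_smult N(2)[OF that] t(2)[OF that] rpoly_pCons rpoly_0
      using that by (simp add: of_rat_mult field_simps)
    ultimately show ?thesis by blast
  qed
qed

lemma reciprocal_norm: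
  assumes "f \<noteq> 0"
  obtains N where "N \<noteq> 0" "degree N \<le> degree f"
    "\<And>x::complex. x \<noteq> 0 \<Longrightarrow> rpoly N (x + 1 / x) = rpoly f x * rpoly f (1 / x)"
proof -
  obtain N where N: "degree N \<le> degree f"
    "\<And>x::complex. x \<noteq> 0 \<Longrightarrow> rpoly N (x + 1 / x) = rpoly f x * rpoly f (1 / x)"
    using reciprocal_norm_exists[of f, where 'a = complex] by blast
  let ?f = "map_poly of_rat f :: complex poly"
  have "?f \<noteq> 0" using assms by (subst map_poly_eq_0_iff) auto
  then have fin: "finite {x. poly ?f x = 0}" by (rule poly_roots_finite)
  define Z where "Z = {x. poly ?f x = 0}"
  have "finite (Z \<union> inverse ` Z \<union> {0})" using fin by (simp add: Z_def)
  then have "\<exists>x. x \<notin> Z \<union> inverse ` Z \<union> {0}"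
    by (rule ex_new_if_finite[OF infinite_UNIV_char_0])
  then obtain x where "x \<notin> Z \<union> inverse ` Z \<union> {0}" ..
  then have x: "x \<noteq> 0" "x \<notin> Z" and x': "x \<notin> inverse ` Z" by blast+
  have x'': "inverse x \<notin> Z"
  proof
    assume "inverse x \<in> Z"
    then have "inverse (inverse x) \<in> inverse ` Z" by (rule imageI)
    with x' show False by simp
  qed
  from x(2) x'' have "rpoly f x \<noteq> 0" "rpoly f (inverse x) \<noteq> 0"
    unfolding rpoly_def Z_def by blast+
  then have "rpoly f (1 / x) \<noteq> 0" by (simp add: inverse_eq_divide)
  with N(2)[OF x(1)] \<open>rpoly f x \<noteq> 0\<close> have "N \<noteq> 0" by auto
  with N that show ?thesis by blast
qed

text \<open>If \<open>x\<close> had smaller degree over the rationals, its minimal polynomial would be half of \<open>p\<close>, and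
  the other half would be the reciprocal of the first one.\<close>

lemma reciprocal_extension:
  fixes x :: complex
  assumes r: "degree r = k" "rpoly r (x + 1 / x) = 0" "min_degree k (x + 1 / x)" "0 < k"
    and p: "p \<noteq> 0" "Polynomial.coeff p 0 \<noteq> 0" "degree p = 2 * k" "\<And>x::complex. x \<noteq> 0 \<Longrightarrow> rpoly p x = x ^ k * rpoly r (x + 1 / x)"
    and q: "q \<noteq> 0" "rpoly q x = 0" "degree q < 2 * k" and x: "x \<noteq> 0"
  obtains f s where "degree f = k" "s \<noteq> 0" "f \<noteq> 0"
    "\<And>x::complex. x \<noteq> 0 \<Longrightarrow> rpoly f x * rpoly f (1 / x) = of_rat s * rpoly r (x + 1 / x)"
proof -
  have r0: "r \<noteq> 0" using r by auto
  obtain f where f: "f \<noteq> 0" "rpoly f x = 0" "min_degree (degree f) x" "degree f \<le> degree q"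
    using obtain_min_degree[OF q(1,2)] by blast
  obtain N where N: "N \<noteq> 0" "degree N \<le> degree f"
    "\<And>x::complex. x \<noteq> 0 \<Longrightarrow> rpoly N (x + 1 / x) = rpoly f x * rpoly f (1 / x)"
    using reciprocal_norm[OF f(1)] by blast
  have N_root: "rpoly N (x + 1 / x) = 0" using N(3)[OF x] f(2) by simp
  then have "k \<le> degree N" using min_degreeD[OF r(3) N(1)] by simp
  have "rpoly p x = 0" using p(4)[OF x] r(2) by simp
  then obtain g where g: "p = f * g" using min_degree_dvd[OF f(1-3)] by blast
  with p(1) have "g \<noteq> 0" by auto
  then have deg: "degree f + degree g = 2 * k" using g f(1) p(3) by (simp add: degree_mult_eq)
  then have "degree g > 0" using f(4) q(3) by simp
  \<comment> \<open>The cofactor \<open>g\<close> has a complex root \<open>z\<close>, and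
    \<open>z + 1 / z\<close> is a conjugate of \<open>x + 1 / x\<close>. So the norm of
    \<open>g\<close> has degree at least \<open>k\<close>, just like that of \<open>f\<close>, and
    both factors must have degree exactly \<open>k\<close>.\<close>
  have "\<not> constant (poly (map_poly of_rat g :: complex poly))"
  proof -
    have "degree (map_poly of_rat g :: complex poly) = degree g" by (intro degree_map_poly) auto
    with \<open>degree g > 0\<close> show ?thesis by (simp add: constant_degree)
  qed
  then obtain z :: complex where z: "rpoly g z = 0"
    using fundamental_theorem_of_algebra unfolding rpoly_def by blast
  then have pz: "rpoly p z = 0" by (simp add: g rpoly_mult)
  have "z \<noteq> 0"
  proof
    assume "z = 0"
    with pz have "rpoly p (of_rat 0 :: complex) = 0" by simp
    then show False using p(2) unfolding rpoly_of_rat by (simp add: poly_0_coeff_0)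
  qed
  then have "rpoly r (z + 1 / z) = 0" using p(4)[of z] pz by simp
  then have "min_degree k (z + 1 / z)"
    using min_degree_conjugate[OF r0 r(2)] r(1,3) by simp
  moreover obtain M where M: "M \<noteq> 0" "degree M \<le> degree g"
    "\<And>x::complex. x \<noteq> 0 \<Longrightarrow> rpoly M (x + 1 / x) = rpoly g x * rpoly g (1 / x)"
    using reciprocal_norm[OF \<open>g \<noteq> 0\<close>] by blast
  ultimately have "k \<le> degree M" using min_degreeD[of k _ M] M(3)[OF \<open>z \<noteq> 0\<close>] z by simp
  with M(2) N(2) deg \<open>k \<le> degree N\<close> have degs: "degree f = k" "degree N = k" by linarith+
  have "r dvd N" using min_degree_dvd[OF r0 r(2) _ N_root] r(1,3) by simp
  then obtain s' where s': "N = r * s'" by blast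
  with N(1) have "s' \<noteq> 0" by auto
  with s' degs(2) r(1) r0 have "degree s' = 0" by (simp add: degree_mult_eq)
  then obtain s where "s' = [:s:]" by (rule degree_eq_zeroE)
  with s' \<open>s' \<noteq> 0\<close> have s: "N = smult s r" "s \<noteq> 0" by auto
  show ?thesis
  proof (rule that[OF degs(1) s(2) f(1)])
    fix x :: complex assume "x \<noteq> 0"
    then show "rpoly f x * rpoly f (1 / x) = of_rat s * rpoly r (x + 1 / x)"
      using N(3)[of x] by (simp add: s(1) rpoly_smult)
  qed
qed

text \<open>Descent: 3 is not a square modulo 5.\<close>

lemma ternary_form_int:
  fixes A B M :: int
  assumes "A\<^sup>2 - 3 * B\<^sup>2 + 5 * M\<^sup>2 = 0"
  shows "A = 0 \<and> B = 0 \<and> M = 0"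
  using assms
proof (induction "nat (\<bar>A\<bar> + \<bar>B\<bar> + \<bar>M\<bar>)" arbitrary: A B M rule: less_induct)
  case less
  have mod5: "a mod 5 \<in> {0, 1, 2, 3, 4}" for a :: int
    by (simp only: insert_iff empty_iff) presburger
  have "A\<^sup>2 - 3 * B\<^sup>2 = 5 * (- (M\<^sup>2))" using less.prems by simp
  then have "(A\<^sup>2 - 3 * B\<^sup>2) mod 5 = 0" by (simp only: mod_mult_self1_is_0)
  moreover have "((A mod 5)\<^sup>2 - 3 * (B mod 5)\<^sup>2) mod 5 = (A\<^sup>2 - 3 * B\<^sup>2) mod 5"
    by (intro mod_diff_cong mod_mult_cong HOL.refl power_mod)
  ultimately have "((A mod 5)\<^sup>2 - 3 * (B mod 5)\<^sup>2) mod 5 = 0" by simp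
  then have "A mod 5 = 0 \<and> B mod 5 = 0"
    using mod5[of A] mod5[of B] by (elim insertE emptyE) simp_all
  then obtain A' B' where AB: "A = 5 * A'" "B = 5 * B'" by (metis mod_0_imp_dvd dvdE)
  then have "M\<^sup>2 = 5 * (3 * B'\<^sup>2 - A'\<^sup>2)" using less.prems by (simp add: power_mult_distrib)
  then have "5 dvd M\<^sup>2" by simp
  then have "(M mod 5)\<^sup>2 mod 5 = 0" by (simp add: power_mod dvd_eq_mod_eq_0)
  then have "M mod 5 = 0" using mod5[of M] by (elim insertE emptyE) simp_all
  then obtain M' where M: "M = 5 * M'" by (metis mod_0_imp_dvd dvdE)
  have eq: "A'\<^sup>2 - 3 * B'\<^sup>2 + 5 * M'\<^sup>2 = 0"
    using less.prems by (simp add: AB M power_mult_distrib)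
  show ?case
  proof (rule ccontr)
    assume "\<not> (A = 0 \<and> B = 0 \<and> M = 0)"
    then have "nat (\<bar>A'\<bar> + \<bar>B'\<bar> + \<bar>M'\<bar>) < nat (\<bar>A\<bar> + \<bar>B\<bar> + \<bar>M\<bar>)"
      unfolding AB M by linarith
    from less.hyps[OF this eq] \<open>\<not> (A = 0 \<and> B = 0 \<and> M = 0)\<close> show False by (simp add: AB M)
  qed
qed

text \<open>One form serves two contradictions: for \<open>m = 0\<close> it says that 3 is not a
  rational square (type E7), otherwise that \<open>- 5\<close> times a nonzero square is not a norm
  from the field of \<open>sqrt 3\<close> (type E8).\<close>

lemma ternary_form_rat:
  fixes a b m :: rat
  assumes "a\<^sup>2 - 3 * b\<^sup>2 + 5 * m\<^sup>2 = 0"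
  shows "a = 0 \<and> b = 0 \<and> m = 0"
proof -
  obtain A u where a: "a = of_int A / of_int u" "u > 0" by (cases a) (auto simp: Fract_of_int_quotient)
  obtain B v where b: "b = of_int B / of_int v" "v > 0" by (cases b) (auto simp: Fract_of_int_quotient)
  obtain M w where m: "m = of_int M / of_int w" "w > 0" by (cases m) (auto simp: Fract_of_int_quotient)
  have "of_int ((A * v * w)\<^sup>2 - 3 * (B * u * w)\<^sup>2 + 5 * (M * u * v)\<^sup>2)
      = (a\<^sup>2 - 3 * b\<^sup>2 + 5 * m\<^sup>2) * of_int ((u * v * w)\<^sup>2)"
    using a(2) b(2) m(2) by (simp add: a(1) b(1) m(1) power_divide power_mult_distrib field_simps)
  also have "\<dots> = of_int 0" using assms by simp
  finally have "(A * v * w)\<^sup>2 - 3 * (B * u * w)\<^sup>2 + 5 * (M * u * v)\<^sup>2 = 0" by (simp only: of_int_eq_iff)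
  from ternary_form_int[OF this] show ?thesis using a b m by simp
qed

text \<open>Meant for 48 and 80, the values that quadratic factors of the two quartics would force
  on the squared difference of their middle coefficients: 48 is 3 modulo 5, and 80 is 2 modulo
  3.\<close>

lemma int_square_residue: "(d::int)\<^sup>2 mod 5 \<noteq> 3" "d\<^sup>2 mod 3 \<noteq> 2"
proof -
  have "d mod 5 \<in> {0, 1, 2, 3, 4}" "d mod 3 \<in> {0, 1, 2}"
    unfolding insert_iff empty_iff by presburger+
  then have "(d mod 5)\<^sup>2 mod 5 \<noteq> 3" "(d mod 3)\<^sup>2 mod 3 \<noteq> 2" by auto
  then show "d\<^sup>2 mod 5 \<noteq> 3" "d\<^sup>2 mod 3 \<noteq> 2" by (simp_all add: mod_simps)
qed

text \<open>Gauss's lemma turns an annihilator of least degree, a rational factor of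
  \<open>P\<close>, into an integer factor of the same degree.\<close>

lemma min_degree_or_factor:
  fixes P :: "int poly" and x :: "'a :: field_char_0"
  assumes "P \<noteq> 0" "rpoly (map_poly of_int P) x = 0" and no_factor: "\<And>F G. P = F * G \<Longrightarrow> 0 < degree F \<Longrightarrow> degree F < degree P \<Longrightarrow> False"
  shows "min_degree (degree P) x"
proof (rule ccontr)
  assume "\<not> min_degree (degree P) x"
  then obtain q where q: "q \<noteq> 0" "rpoly q x = 0" "degree q < degree P" by (auto simp: min_degree_def)
  obtain f where f: "f \<noteq> 0" "rpoly f x = 0" "min_degree (degree f) x" "degree f \<le> degree q"
    using obtain_min_degree[OF q(1,2)] by blast
  from min_degree_dvd[OF f(1-3) assms(2)] obtain g where g: "map_poly of_int P = f * g" by blast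
  from rat_to_int_factor[OF g] obtain F G where FG: "P = F * G" "degree F = degree f" by blast
  have "degree f \<noteq> 0" using rpoly_const[of f x] f by auto
  with no_factor[OF FG(1)] FG(2) f(4) q(3) show False by simp
qed

text \<open>Both outer coefficients of a linear factor are units, so up to sign it is X - 1 or X +
  1.\<close>

lemma linear_factor_root:
  fixes F G :: "int poly"
  assumes "degree F = 1" "\<bar>Polynomial.coeff (F * G) 0\<bar> = 1" "\<bar>lead_coeff (F * G)\<bar> = 1"
  shows "poly (F * G) 1 = 0 \<or> poly (F * G) (- 1) = 0"
proof -
  have unit: "\<bar>a\<bar> = 1" if "\<bar>a * b\<bar> = 1" for a b :: int
    using that by (metis abs_mult abs_zmult_eq_1 abs_abs)
  obtain a b where F: "F = [:b, a:]" by (rule degree1_coeffs[OF assms(1)])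
  have "\<bar>b\<bar> = 1" using assms(2) by (intro unit[of b "Polynomial.coeff G 0"]) (simp add: F coeff_mult_0)
  moreover have "lead_coeff F = a" using assms(1) unfolding F by (simp split: if_splits)
  then have "\<bar>a\<bar> = 1" using assms(3) by (intro unit[of a "lead_coeff G"]) (simp only: lead_coeff_mult)
  ultimately have "poly F 1 = 0 \<or> poly F (- 1) = 0" by (auto simp: F)
  then show ?thesis by auto
qed

lemma min_degree_cubic:
  fixes x :: "'a :: field_char_0"
  assumes P: "P = [:c0, c1, c2, 1:]" "\<bar>c0\<bar> = 1" "poly P 1 \<noteq> 0" "poly P (- 1) \<noteq> 0"
    and x: "rpoly (map_poly of_int P) x = 0"
  shows "min_degree 3 x"
proof -
  have "degree P = 3" by (simp add: P(1))
  have "min_degree (degree P) x"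
  proof (rule min_degree_or_factor[OF _ x])
    fix F G assume FG: "P = F * G" "0 < degree F" "degree F < degree P"
    then have "F \<noteq> 0" "G \<noteq> 0" using P(1) by auto
    with \<open>degree P = 3\<close> \<open>F \<noteq> 0\<close> \<open>G \<noteq> 0\<close> have "degree F + degree G = 3" unfolding FG(1) by (simp add: degree_mult_eq)
    then consider "degree F = 1" | "degree G = 1" using FG(2,3) \<open>degree P = 3\<close> by linarith
    then show False
    proof cases
      case 1
      from linear_factor_root[OF 1, of G] show False using P by (simp flip: FG(1))
    next
      case 2
      from linear_factor_root[OF 2, of F] show False using P by (simp add: mult.commute[of G F] flip: FG(1))
    qed
  qed (use P(1) in simp)
  then show ?thesis by (simp only: \<open>degree P = 3\<close>)
qed

text \<open>Up to a common sign, two quadratic factors are monic with the same constant term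
  \<open>b\<close>, which is 1 or -1; \<open>no_quadratic\<close> lists the coefficient equations
  that result.\<close>

lemma min_degree_quartic:
  fixes x :: "'a :: field_char_0"
  assumes P: "P = [:1, c1, c2, c3, 1:]" "poly P 1 \<noteq> 0" "poly P (- 1) \<noteq> 0"
    and x: "rpoly (map_poly of_int P) x = 0"
    and no_quadratic: "\<And>a a' b :: int. b\<^sup>2 = 1 \<Longrightarrow> a + a' = c3 \<Longrightarrow> b * (a + a') = c1 \<Longrightarrow> 2 * b + a * a' = c2 \<Longrightarrow> False"
  shows "min_degree 4 x"
proof -
  have "degree P = 4" by (simp add: P(1))
  have "min_degree (degree P) x"
  proof (rule min_degree_or_factor[OF _ x])
    fix F G assume FG: "P = F * G" "0 < degree F" "degree F < degree P"
    then have "F \<noteq> 0" "G \<noteq> 0" using P(1) by auto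
    with \<open>degree P = 4\<close> \<open>F \<noteq> 0\<close> \<open>G \<noteq> 0\<close> have "degree F + degree G = 4" unfolding FG(1) by (simp add: degree_mult_eq)
    then consider "degree F = 1" | "degree G = 1" | "degree F = 2" "degree G = 2"
      using FG(2,3) \<open>degree P = 4\<close> by linarith
    then show False
    proof cases
      case 1
      from linear_factor_root[OF 1, of G] show False using P by (simp flip: FG(1))
    next
      case 2
      from linear_factor_root[OF 2, of F] show False using P by (simp add: mult.commute[of G F] flip: FG(1))
    next
      case 3
      obtain e a b where F: "F = [:b, a, e:]" by (rule degree2_coeffs[OF 3(1)])
      obtain e' a' b' where G: "G = [:b', a', e':]" by (rule degree2_coeffs[OF 3(2)])
      have eqs: "b * b' = 1" "b * a' + a * b' = c1" "b * e' + a * a' + e * b' = c2"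
        "a * e' + e * a' = c3" "e * e' = 1"
        using FG(1) by (simp_all add: P(1) F G algebra_simps)
      have "b = 1 \<and> b' = 1 \<or> b = - 1 \<and> b' = - 1" "e = 1 \<and> e' = 1 \<or> e = - 1 \<and> e' = - 1"
        using eqs(1,5) by (simp_all add: zmult_eq_1_iff)
      then show False
        using no_quadratic[of "b * e" "a * e" "a' * e"] eqs(2-4) by (elim disjE conjE) simp_all
    qed
  qed (use P(1) in simp)
  then show ?thesis by (simp only: \<open>degree P = 4\<close>)
qed

section \<open>Minimal polynomials of the cotangents\<close>

lemma min_degree_of_real: "min_degree n (complex_of_real x) \<longleftrightarrow> min_degree n x"
  by (simp add: min_degree_def rpoly_of_real)

lemma is_minimal_polynomialI:
  assumes "lead_coeff p = 1" "degree p = n" "rpoly p x = 0" "min_degree n x"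
  shows "is_minimal_polynomial p x"
  using assms by (auto simp: is_minimal_polynomial_def min_degree_def rpoly_def)

lemma rpoly_of_int_pCons [simp]:
  "rpoly (map_poly of_int (pCons a P)) x = of_int a + x * rpoly (map_poly of_int P) x"
  by (simp add: of_int_hom.map_poly_pCons_hom)

lemma minimal_polynomial_E6:
  fixes x :: real
  assumes x: "x ^ 4 - 8 * x ^ 3 + 2 * x\<^sup>2 + 8 * x + 1 = 0"
  shows "is_minimal_polynomial [:1, 8, 2, -8, 1:] x"
proof (rule is_minimal_polynomialI)
  show "rpoly [:1, 8, 2, -8, 1:] x = 0"
    using x by (simp add: power_def algebra_simps eval_nat_numeral)
  then have root: "rpoly (map_poly of_int [:1, 8, 2, -8, 1:]) x = 0" by simp
  show "min_degree 4 x"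
  proof (rule min_degree_quartic[OF HOL.refl _ _ root])
    fix a a' b :: int
    assume ab: "b\<^sup>2 = 1" "a + a' = -8" "b * (a + a') = 8" "2 * b + a * a' = 2"
    then have "b = -1" by simp
    have "(a - a')\<^sup>2 = (a + a')\<^sup>2 - 4 * (a * a')" by (simp add: power2_eq_square algebra_simps)
    also have "\<dots> = 48" using ab(2,4) \<open>b = -1\<close> by simp
    finally show False using int_square_residue(1)[of "a - a'"] by simp
  qed simp_all
qed simp_all

lemma minimal_polynomial_H3:
  fixes x :: real
  assumes x: "x ^ 4 - 4 * x ^ 3 - 14 * x\<^sup>2 - 4 * x + 1 = 0"
  shows "is_minimal_polynomial [:1, -4, -14, -4, 1:] x"
proof (rule is_minimal_polynomialI)
  show "rpoly [:1, -4, -14, -4, 1:] x = 0"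
    using x by (simp add: power_def algebra_simps eval_nat_numeral)
  then have root: "rpoly (map_poly of_int [:1, -4, -14, -4, 1:]) x = 0" by simp
  show "min_degree 4 x"
  proof (rule min_degree_quartic[OF HOL.refl _ _ root])
    fix a a' b :: int
    assume ab: "b\<^sup>2 = 1" "a + a' = -4" "b * (a + a') = -4" "2 * b + a * a' = -14"
    then have "b = 1" by simp
    have "(a - a')\<^sup>2 = (a + a')\<^sup>2 - 4 * (a * a')" by (simp add: power2_eq_square algebra_simps)
    also have "\<dots> = 80" using ab(2,4) \<open>b = 1\<close> by simp
    finally show False using int_square_residue(2)[of "a - a'"] by simp
  qed simp_all
qed simp_all

lemma rpoly_1_arg: "rpoly f (1 :: 'a :: field_char_0) = of_rat (poly f 1)"
  and rpoly_m1_arg: "rpoly f (- 1 :: 'a) = of_rat (poly f (- 1))"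
  using rpoly_of_rat[of f 1, where 'a = 'a] rpoly_of_rat[of f "-1", where 'a = 'a]
  by (simp_all add: of_rat_minus)

text \<open>Dividing \<open>x + 1 / x\<close> by 4 gives an algebraic unit, to which the test for
  cubics applies. Were the degree of \<open>x\<close> below 6, evaluating the norm equation at 1 and
  -1 would make \<open>24 * s\<close> and \<open>8 * s\<close> both squares, hence 3 a
  square.\<close>

lemma minimal_polynomial_E7:
  fixes x :: real
  assumes z: "z ^ 3 - 3 * z\<^sup>2 + 1 = 0" and x: "x \<noteq> 0" "x + 1 / x = 4 * z"
  shows "is_minimal_polynomial [:1, -12, 3, 40, 3, -12, 1:] x"
proof (rule is_minimal_polynomialI)
  let ?p = "[:1, -12, 3, 40, 3, -12, 1:] :: rat poly" and ?r = "[:64, 0, -12, 1:] :: rat poly"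
  have p_r: "rpoly ?p t = t ^ 3 * rpoly ?r (t + 1 / t)" if "t \<noteq> 0" for t :: "'a :: field_char_0"
    using that by (simp add: field_simps power3_eq_cube)
  have r: "rpoly ?r (x + 1 / x) = 0"
  proof -
    have "rpoly ?r (4 * z) = 64 * (z ^ 3 - 3 * z\<^sup>2 + 1)"
      by (simp add: power2_eq_square power3_eq_cube algebra_simps)
    then show ?thesis unfolding x(2) z by simp
  qed
  then show "rpoly ?p x = 0" using p_r[OF x(1)] by simp
  have "min_degree 3 z"
    by (rule min_degree_cubic[OF HOL.refl, of 1 0 "-3"])
      (use z in \<open>simp_all add: power2_eq_square power3_eq_cube algebra_simps\<close>)
  then have y: "min_degree 3 (x + 1 / x)"
    using min_degree_scaled[of 3 z 4] by (simp add: x(2))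
  define w where "w = complex_of_real x"
  have w: "w \<noteq> 0" "w + 1 / w = complex_of_real (x + 1 / x)" using x(1) by (simp_all add: w_def)
  show "min_degree 6 x"
  proof (rule ccontr)
    assume "\<not> min_degree 6 x"
    then obtain q where q: "q \<noteq> 0" "rpoly q x = 0" "degree q < 2 * 3"
      by (auto simp: min_degree_def)
    obtain f s where f: "degree f = 3" "s \<noteq> 0"
      "\<And>t::complex. t \<noteq> 0 \<Longrightarrow> rpoly f t * rpoly f (1 / t) = of_rat s * rpoly ?r (t + 1 / t)"
    proof (rule reciprocal_extension[of ?r 3 w ?p q])
      show "rpoly ?r (w + 1 / w) = 0" unfolding w(2) rpoly_of_real r by simp
      show "min_degree 3 (w + 1 / w)" unfolding w(2) min_degree_of_real by (rule y)
      show "rpoly q w = 0" by (simp add: w_def rpoly_of_real q)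
      show "rpoly ?p t = t ^ 3 * rpoly ?r (t + 1 / t)" if "t \<noteq> 0" for t :: complex
        by (rule p_r[OF that])
    qed (use q w in simp_all)
    have "of_rat ((poly f 1)\<^sup>2) = (of_rat (24 * s) :: complex)"
      using f(3)[of 1] by (simp add: rpoly_1_arg power2_eq_square of_rat_mult)
    then have 1: "(poly f 1)\<^sup>2 = 24 * s" by (simp only: of_rat_eq_iff)
    have "of_rat ((poly f (-1))\<^sup>2) = (of_rat (8 * s) :: complex)"
      using f(3)[of "-1"] by (simp add: rpoly_m1_arg power2_eq_square of_rat_mult)
    then have 2: "(poly f (-1))\<^sup>2 = 8 * s" by (simp only: of_rat_eq_iff)
    have "(poly f 1 * poly f (-1))\<^sup>2 - 3 * (8 * s)\<^sup>2 + 5 * 0\<^sup>2 = 0"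
      unfolding power_mult_distrib 1 2 by (simp add: power2_eq_square)
    from ternary_form_rat[OF this] f(2) show False by simp
  qed
qed simp_all

text \<open>Evaluation at 1 and at -1 gives the same value \<open>16 * s\<close>, so these points do
  not suffice. At \<open>t = 2 + sqrt 3\<close>, where \<open>t + 1 / t = 4\<close>, the norm
  equation makes \<open>- 1280 * s\<close>, that is \<open>- 5 * (4 * poly f 1)^2\<close>, a norm
  from the field of \<open>sqrt 3\<close>.\<close>

lemma minimal_polynomial_E8:
  fixes x :: real
  assumes z: "z ^ 4 - 4 * z ^ 3 - 4 * z\<^sup>2 + z + 1 = 0" and x: "x \<noteq> 0" "x + 1 / x = 4 * z"
  shows "is_minimal_polynomial [:1, -16, -60, 16, 134, 16, -60, -16, 1:] x"
proof (rule is_minimal_polynomialI)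
  let ?p = "[:1, -16, -60, 16, 134, 16, -60, -16, 1:] :: rat poly"
    and ?r = "[:256, 64, -64, -16, 1:] :: rat poly"
  have p_r: "rpoly ?p t = t ^ 4 * rpoly ?r (t + 1 / t)" if "t \<noteq> 0" for t :: "'a :: field_char_0"
    using that by (simp add: field_simps power4_eq_xxxx)
  have r: "rpoly ?r (x + 1 / x) = 0"
  proof -
    have "rpoly ?r (4 * z) = 256 * (z ^ 4 - 4 * z ^ 3 - 4 * z\<^sup>2 + z + 1)"
      by (simp add: power2_eq_square power3_eq_cube power4_eq_xxxx algebra_simps)
    then show ?thesis unfolding x(2) z by simp
  qed
  then show "rpoly ?p x = 0" using p_r[OF x(1)] by simp
  have "min_degree 4 z"
  proof (rule min_degree_quartic[OF HOL.refl, of 1 "-4" "-4"])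
    fix a a' b :: int
    assume ab: "a + a' = -4" "b * (a + a') = 1"
    from ab(2) show False unfolding ab(1) by presburger
  qed (use z in \<open>simp_all add: power2_eq_square power3_eq_cube power4_eq_xxxx algebra_simps\<close>)
  then have y: "min_degree 4 (x + 1 / x)"
    using min_degree_scaled[of 4 z 4] by (simp add: x(2))
  define w where "w = complex_of_real x"
  have w: "w \<noteq> 0" "w + 1 / w = complex_of_real (x + 1 / x)" using x(1) by (simp_all add: w_def)
  show "min_degree 8 x"
  proof (rule ccontr)
    assume "\<not> min_degree 8 x"
    then obtain q where q: "q \<noteq> 0" "rpoly q x = 0" "degree q < 2 * 4"
      by (auto simp: min_degree_def)
    obtain f s where f: "degree f = 4" "s \<noteq> 0"
      "\<And>t::complex. t \<noteq> 0 \<Longrightarrow> rpoly f t * rpoly f (1 / t) = of_rat s * rpoly ?r (t + 1 / t)"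
    proof (rule reciprocal_extension[of ?r 4 w ?p q])
      show "rpoly ?r (w + 1 / w) = 0" unfolding w(2) rpoly_of_real r by simp
      show "min_degree 4 (w + 1 / w)" unfolding w(2) min_degree_of_real by (rule y)
      show "rpoly q w = 0" by (simp add: w_def rpoly_of_real q)
      show "rpoly ?p t = t ^ 4 * rpoly ?r (t + 1 / t)" if "t \<noteq> 0" for t :: complex
        by (rule p_r[OF that])
    qed (use q w in simp_all)
    have "of_rat ((poly f 1)\<^sup>2) = (of_rat (16 * s) :: complex)"
      using f(3)[of 1] by (simp add: rpoly_1_arg power2_eq_square of_rat_mult)
    then have 1: "(poly f 1)\<^sup>2 = 16 * s" by (simp only: of_rat_eq_iff)
    \<comment> \<open>The divisor is the minimal polynomial of \<open>2 + sqrt 3\<close>, whose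
      other root is the reciprocal. The remainder gives the values of \<open>f\<close> at both roots
      with the same rational \<open>u\<close> and \<open>v\<close>.\<close>
    define g where "g = f mod [:1, -4, 1:]"
    have "degree g < degree [:1, -4, 1 :: rat:] \<or> g = 0"
      using degree_mod_less[of "[:1, -4, 1 :: rat:]" f] by (auto simp: g_def)
    then obtain u v where g: "g = [:u, v:]"
    proof (cases g)
      case (pCons u g')
      with \<open>degree g < _ \<or> g = 0\<close> have "degree g' = 0" by (auto split: if_splits)
      then obtain v where "g' = [:v:]" by (rule degree_eq_zeroE)
      with pCons that show ?thesis by blast
    qed
    define t where "t = complex_of_real (2 + sqrt 3)"
    have t': "1 / t = complex_of_real (2 - sqrt 3)" and t0: "t \<noteq> 0"
    proof -
      have "2 + sqrt 3 \<noteq> 0" by (rule less_imp_neq[symmetric]) (simp add: add_pos_pos)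
      then show "t \<noteq> 0" unfolding t_def of_real_eq_0_iff .
      have prod: "(2 + sqrt 3) * (2 - sqrt 3) = 1" by (simp add: algebra_simps)
      then have "t * complex_of_real (2 - sqrt 3) = 1" unfolding t_def of_real_mult[symmetric]
        by (simp only: prod of_real_1)
      then have "1 / t = t * complex_of_real (2 - sqrt 3) / t" by (simp only:)
      with \<open>t \<noteq> 0\<close> show "1 / t = complex_of_real (2 - sqrt 3)" by simp
    qed
    have sum: "t + 1 / t = 4" unfolding t' by (simp add: t_def)
    have prod: "t * (1 / t) = 1" using t0 by simp
    have quadratic: "rpoly f a = of_rat u + of_rat v * a" if "1 - 4 * a + a * a = 0" for a :: complex
    proof -
      define h where "h = [:1, -4, 1 :: rat:]"
      have "rpoly h a = 0" using that by (simp add: h_def algebra_simps)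
      moreover have "f = h * (f div h) + g" unfolding g_def h_def by (rule mult_div_mod_eq[symmetric])
      then have "rpoly f a = rpoly h a * rpoly (f div h) a + rpoly g a"
        by (metis rpoly_add rpoly_mult)
      ultimately have "rpoly f a = rpoly g a" by simp
      then show ?thesis by (simp add: g mult.commute)
    qed
    have "1 - 4 * a + a * a = 0" if "a + b = 4" "a * b = 1" for a b :: complex
    proof -
      have "1 - 4 * a + a * a = 1 - a * b" unfolding that(1)[symmetric] by (simp add: algebra_simps)
      then show ?thesis using that(2) by simp
    qed
    from this[OF sum prod] this[of "1 / t" t] sum prod
    have "1 - 4 * t + t * t = 0" "1 - 4 * (1 / t) + 1 / t * (1 / t) = 0"
      by (simp_all only: add.commute mult.commute)
    then have ft: "rpoly f t = of_rat u + of_rat v * t" "rpoly f (1 / t) = of_rat u + of_rat v * (1 / t)"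
      using quadratic by blast+
    have "rpoly f t * rpoly f (1 / t)
        = of_rat u * of_rat u + of_rat u * of_rat v * (t + 1 / t) + of_rat v * of_rat v * (t * (1 / t))"
      unfolding ft by (simp add: algebra_simps)
    moreover have "rpoly f t * rpoly f (1 / t) = of_rat s * rpoly ?r 4"
      using f(3)[OF t0] unfolding sum .
    moreover have "of_rat s * rpoly ?r 4 = (of_rat (- 1280 * s) :: complex)"
      by (simp add: of_rat_mult of_rat_minus)
    moreover have "of_rat (u * u + 4 * (u * v) + v * v)
        = of_rat u * of_rat u + of_rat u * of_rat v * 4 + of_rat v * of_rat v * (1 :: complex)"
      by (simp add: of_rat_add of_rat_mult)
    ultimately have "of_rat (u * u + 4 * (u * v) + v * v) = (of_rat (- 1280 * s) :: complex)"
      by (simp only: sum prod)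
    then have 2: "u * u + 4 * (u * v) + v * v = - 1280 * s" by (simp only: of_rat_eq_iff)
    have "(u + 2 * v)\<^sup>2 - 3 * v\<^sup>2 + 5 * (4 * poly f 1)\<^sup>2 = (u * u + 4 * (u * v) + v * v) + 80 * (poly f 1)\<^sup>2"
      by (simp add: power2_eq_square algebra_simps)
    also have "\<dots> = 0" unfolding 1 2 by simp
    finally have "(u + 2 * v)\<^sup>2 - 3 * v\<^sup>2 + 5 * (4 * poly f 1)\<^sup>2 = 0" .
    from ternary_form_rat[OF this] have "poly f 1 = 0" by simp
    with 1 f(2) show False by simp
  qed
qed simp_all

section \<open>Trigonometric values and decimal bounds\<close>

lemma cot_greater_1: "3 \<le> h \<Longrightarrow> 1 < cot (pi / (2 * real h))"
proof -
  assume "3 \<le> h"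
  define t where "t = pi / (2 * real h)"
  have t: "0 < t" "t < pi / 4" using \<open>3 \<le> h\<close> by (simp_all add: t_def field_simps)
  have "sin t < sin (pi / 2 - t)" using t by (intro sin_monotone_2pi) auto
  then have "sin t < cos t" by (simp add: sin_diff)
  moreover have "0 < sin t" using t by (intro sin_gt_zero) auto
  ultimately show ?thesis by (simp add: cot_def t_def)
qed

lemma cot_plus_tan: "3 \<le> h \<Longrightarrow> cot (pi / (2 * real h)) + 1 / cot (pi / (2 * real h)) = 2 / sin (pi / h)"
proof -
  assume "3 \<le> h"
  define t where "t = pi / (2 * real h)"
  have t: "0 < t" "t < pi / 2" using \<open>3 \<le> h\<close> by (simp_all add: t_def field_simps)
  then have pos: "sin t > 0" "cos t > 0" by (auto intro!: sin_gt_zero cos_gt_zero)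
  have "pi / h = 2 * t" by (simp add: t_def)
  then have "sin (pi / h) = 2 * sin t * cos t" by (simp only: sin_double)
  moreover have "cot t + 1 / cot t = ((cos t)\<^sup>2 + (sin t)\<^sup>2) / (sin t * cos t)"
    using pos by (simp add: cot_def field_simps power2_eq_square)
  ultimately show ?thesis using pos by (simp add: t_def)
qed

text \<open>Needed for E6, whose polynomial is symmetric under \<open>x \<mapsto> - 1 / x\<close>
  and not under inversion.\<close>

lemma cot_minus_tan: "3 \<le> h \<Longrightarrow> cot (pi / (2 * real h)) - 1 / cot (pi / (2 * real h)) = 2 * cot (pi / h)"
proof -
  assume "3 \<le> h"
  define t where "t = pi / (2 * real h)"
  have t: "0 < t" "t < pi / 2" using \<open>3 \<le> h\<close> by (simp_all add: t_def field_simps)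
  then have pos: "sin t > 0" "cos t > 0" by (auto intro!: sin_gt_zero cos_gt_zero)
  have "pi / h = 2 * t" by (simp add: t_def)
  then have "cot (pi / h) = ((cos t)\<^sup>2 - (sin t)\<^sup>2) / (2 * (sin t * cos t))"
    by (simp only: cot_def sin_double cos_double mult.assoc)
  moreover have "cot t - 1 / cot t = ((cos t)\<^sup>2 - (sin t)\<^sup>2) / (sin t * cos t)"
    using pos by (simp add: cot_def field_simps power2_eq_square)
  moreover have "2 * (X / (2 * W)) = X / W" for X W :: real by simp
  ultimately show ?thesis unfolding t_def[symmetric] by (simp only:)
qed

text \<open>\<open>x + 1 / x\<close> increases on the branch \<open>x > 1\<close>, where
  \<open>cot_greater_1\<close> puts the cotangents; the other solution is the reciprocal.\<close>

lemma add_recip_bounds: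
  fixes x a b y :: real
  assumes "1 < x" "x + 1 / x = y" "1 < a" "a + 1 / a < y" "y < b + 1 / b" "1 < b"
  shows "a < x" "x < b"
proof -
  have mono: "s + 1 / s \<le> t + 1 / t" if "1 < s" "s \<le> t" for s t :: real
  proof -
    have "1 / s - 1 / t = (t - s) / (s * t)" using that by (simp add: diff_frac_eq)
    also have "\<dots> \<le> (t - s) / 1"
      using that mult_mono[of 1 s 1 t] by (intro divide_left_mono) auto
    finally show ?thesis by simp
  qed
  show "a < x" using mono[of x a] assms by linarith
  show "x < b" using mono[of b x] assms by linarith
qed

lemma diff_recip_bounds:
  fixes x a b y :: real
  assumes "0 < x" "x - 1 / x = y" "0 < a" "a - 1 / a < y" "y < b - 1 / b" "0 < b"
  shows "a < x" "x < b"
proof -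
  have mono: "s - 1 / s \<le> t - 1 / t" if "0 < s" "s \<le> t" for s t :: real
    using that by (intro diff_mono divide_left_mono) auto
  show "a < x" using mono[of x a] assms by linarith
  show "x < b" using mono[of b x] assms by linarith
qed

lemma sin_treble: "sin (3 * x) = 3 * sin x - 4 * (sin x) ^ 3" for x :: real
proof -
  have "sin (3 * x) = sin (2 * x + x)" by simp
  also have "\<dots> = 2 * sin x * (cos x)\<^sup>2 + sin x - 2 * (sin x) ^ 3"
    unfolding sin_add sin_double cos_double_sin
    by (simp add: power2_eq_square power3_eq_cube algebra_simps)
  also have "\<dots> = 3 * sin x - 4 * (sin x) ^ 3"
    unfolding cos_squared_eq by (simp add: power2_eq_square power3_eq_cube algebra_simps)
  finally show ?thesis .
qed

text \<open>The difference of the two sides is \<open>t - s\<close> times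
  \<open>3 - 4 * (t * t + s * t + s * s)\<close>. A decimal bound on a sine can thus be tested on
  the sine of the triple angle, which is known algebraically.\<close>

lemma treble_mono:
  fixes s t :: real
  assumes "0 \<le> s" "s \<le> t" "t \<le> 1 / 2"
  shows "3 * s - 4 * s ^ 3 \<le> 3 * t - 4 * t ^ 3"
proof -
  have "s * s \<le> 1 / 2 * (1 / 2)" "s * t \<le> 1 / 2 * (1 / 2)" "t * t \<le> 1 / 2 * (1 / 2)"
    using assms by (intro mult_mono; simp)+
  then have "0 \<le> (t - s) * (3 - 4 * (t * t + s * t + s * s))"
    using assms by (intro mult_nonneg_nonneg) auto
  then show ?thesis by (simp add: power3_eq_cube algebra_simps)
qed

lemma sin_18_quadratic: "4 * (sin (pi / 10))\<^sup>2 + 2 * sin (pi / 10) - 1 = 0"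
proof -
  have "sin (pi / 10) = cos (2 * (pi / 5))"
    unfolding sin_cos_eq by (rule arg_cong[of _ _ cos]) simp
  moreover have "cos (2 * (pi / 5)) = 2 * (cos (pi / 5))\<^sup>2 - 1" by (rule cos_double_cos)
  moreover have "cos (pi / 5) = cos (2 * (pi / 5)) + 1 / 2" using cos_36_minus_cos_72 by simp
  ultimately have "sin (pi / 10) = 2 * (sin (pi / 10) + 1 / 2)\<^sup>2 - 1" by simp
  then show ?thesis by (simp add: power2_eq_square algebra_simps)
qed

lemma sin_pos_le_half: "6 \<le> h \<Longrightarrow> 0 < sin (pi / real h) \<and> sin (pi / real h) \<le> 1 / 2"
proof -
  assume "6 \<le> h"
  then have h: "0 < pi / real h" "pi / real h \<le> pi / 6" "pi / real h < pi" by (auto simp: field_simps)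
  then have "sin (pi / real h) \<le> sin (pi / 6)" by (intro sin_monotone_2pi_le) auto
  then show ?thesis using h by (auto simp: sin_30 intro: sin_gt_zero)
qed

lemma cot_E6:
  defines "x \<equiv> cot (pi / (2 * real 12))"
  shows "\<bar>x - 7.5957\<bar> < 1 / 10 ^ 4" "is_minimal_polynomial [:1, 8, 2, -8, 1:] x"
proof -
  define C where "C = cot (pi / 12)"
  have "1 < x" unfolding x_def by (rule cot_greater_1) simp
  have y: "x - 1 / x = 2 * C" using cot_minus_tan[of 12] by (simp add: x_def C_def)
  have "1 < C" using cot_greater_1[of 6] by (simp add: C_def)
  have "C + 1 / C = 2 / sin (pi / real 6)" using cot_plus_tan[of 6] by (simp add: C_def)
  also have "\<dots> = 4" by (simp add: sin_30)
  finally have "C + 1 / C = 4" .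
  with \<open>1 < C\<close> have C: "(C - 2)\<^sup>2 = 3"
  proof -
    have "C * C + 1 = C * (C + 1 / C)" using \<open>1 < C\<close> by (simp add: distrib_left)
    then have "C * C + 1 = C * 4" by (simp only: \<open>C + 1 / C = 4\<close>)
    then show ?thesis by (simp add: power2_eq_square algebra_simps)
  qed
  \<comment> \<open>\<open>C\<close> is \<open>2 + sqrt 3\<close>; this enclosure is narrow enough
    to place \<open>x\<close> between 7.5957 and 7.5958.\<close>
  have "3.73205 < C"
  proof (rule ccontr)
    assume "\<not> 3.73205 < C"
    then have "\<bar>C - 2\<bar> \<le> 1.73205" using \<open>1 < C\<close> unfolding abs_le_iff by auto
    then have "(C - 2)\<^sup>2 \<le> 1.73205\<^sup>2" by (simp add: abs_le_square_iff[symmetric])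
    with C show False by (simp add: power2_eq_square)
  qed
  moreover have "C < 3.73207"
  proof (rule ccontr)
    assume "\<not> C < 3.73207"
    then have "1.73207\<^sup>2 \<le> (C - 2)\<^sup>2" by (intro power_mono) auto
    with C show False by (simp add: power2_eq_square)
  qed
  ultimately have "7.4641 < 2 * C" "2 * C < 7.46414" by simp_all
  moreover have "(7.5957 :: real) - 1 / 7.5957 < 7.4641" "(7.46414 :: real) < 7.5958 - 1 / 7.5958" by simp_all
  ultimately have ineq: "7.5957 - 1 / 7.5957 < 2 * C" "2 * C < 7.5958 - 1 / 7.5958"
    by (blast intro: less_trans)+
  have "7.5957 < x" "x < 7.5958"
    by (rule diff_recip_bounds[OF _ y _ ineq]; use \<open>1 < x\<close> in simp)+
  then show "\<bar>x - 7.5957\<bar> < 1 / 10 ^ 4" unfolding abs_less_iff by simp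
  have "x ^ 4 - 8 * x ^ 3 + 2 * x\<^sup>2 + 8 * x + 1 = x\<^sup>2 * ((x - 1 / x)\<^sup>2 - 8 * (x - 1 / x) + 4)"
    using \<open>1 < x\<close> by (simp add: field_simps power2_eq_square power3_eq_cube power4_eq_xxxx)
  also have "\<dots> = x\<^sup>2 * (4 * ((C - 2)\<^sup>2 - 3))" unfolding y by (simp add: power2_eq_square algebra_simps)
  finally show "is_minimal_polynomial [:1, 8, 2, -8, 1:] x"
    using C by (intro minimal_polynomial_E6) simp
qed

lemma cot_H3:
  defines "x \<equiv> cot (pi / (2 * real 10))"
  shows "\<bar>x - 6.3137\<bar> < 1 / 10 ^ 4" "is_minimal_polynomial [:1, -4, -14, -4, 1:] x"
proof -
  define s where "s = sin (pi / real 10)"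
  define y where "y = 2 / s"
  have "1 < x" unfolding x_def by (rule cot_greater_1) simp
  have s: "0 < s" using sin_pos_le_half[of 10] by (simp add: s_def)
  have y: "x + 1 / x = y" using cot_plus_tan[of 10] by (simp add: x_def s_def y_def)
  have "4 * s\<^sup>2 + 2 * s - 1 = 0" using sin_18_quadratic by (simp add: s_def)
  then have s2: "16 * (s * s) = 4 - 8 * s" by (simp add: power2_eq_square)
  have "s * y = 2" using s by (simp add: y_def)
  \<comment> \<open>Inverts the quadratic for \<open>s\<close>, the sine of 18 degrees: its
    reciprocal doubled is \<open>y = 2 + sqrt 20\<close>.\<close>
  have "s * s * ((y - 2)\<^sup>2 - 20) = (s * y) * (s * y) - 4 * s * (s * y) - 16 * (s * s)"
    by (simp add: power2_eq_square algebra_simps)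
  also have "\<dots> = 0" unfolding \<open>s * y = 2\<close> s2 by simp
  finally have Y: "(y - 2)\<^sup>2 = 20" using s by simp
  have "0 < y" using s by (simp add: y_def)
  have "6.4721 < y"
  proof (rule ccontr)
    assume "\<not> 6.4721 < y"
    then have "\<bar>y - 2\<bar> \<le> 4.4721" using \<open>0 < y\<close> unfolding abs_le_iff by auto
    then have "(y - 2)\<^sup>2 \<le> 4.4721\<^sup>2" by (simp add: abs_le_square_iff[symmetric])
    with Y show False by (simp add: power2_eq_square)
  qed
  moreover have "y < 6.47215"
  proof (rule ccontr)
    assume "\<not> y < 6.47215"
    then have "4.47215\<^sup>2 \<le> (y - 2)\<^sup>2" by (intro power_mono) auto
    with Y show False by (simp add: power2_eq_square)
  qed
  moreover have "(6.3137 :: real) + 1 / 6.3137 < 6.4721" "(6.47215 :: real) < 6.3138 + 1 / 6.3138" by simp_all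
  ultimately have ineq: "6.3137 + 1 / 6.3137 < y" "y < 6.3138 + 1 / 6.3138"
    by (blast intro: less_trans)+
  have "6.3137 < x" "x < 6.3138"
    by (rule add_recip_bounds[OF _ y _ ineq]; use \<open>1 < x\<close> in simp)+
  then show "\<bar>x - 6.3137\<bar> < 1 / 10 ^ 4" unfolding abs_less_iff by simp
  have xy: "x * (y - 2) = x * x + 1 - 2 * x"
    unfolding y[symmetric] using \<open>1 < x\<close> by (simp add: algebra_simps)
  have "x ^ 4 - 4 * x ^ 3 - 14 * x\<^sup>2 - 4 * x + 1 = (x * x + 1 - 2 * x)\<^sup>2 - 20 * (x * x)"
    by (simp add: power2_eq_square power3_eq_cube power4_eq_xxxx algebra_simps)
  also have "\<dots> = x * x * ((y - 2)\<^sup>2 - 20)"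
    unfolding xy[symmetric] by (simp add: power2_eq_square algebra_simps)
  finally show "is_minimal_polynomial [:1, -4, -14, -4, 1:] x"
    using Y by (intro minimal_polynomial_H3) simp
qed

lemma cot_E7:
  defines "x \<equiv> cot (pi / (2 * real 18))"
  shows "\<bar>x - 11.4301\<bar> < 1 / 10 ^ 4" "is_minimal_polynomial [:1, -12, 3, 40, 3, -12, 1:] x"
proof -
  define s where "s = sin (pi / real 18)"
  have "1 < x" unfolding x_def by (rule cot_greater_1) simp
  have s: "0 < s" "s \<le> 1 / 2" using sin_pos_le_half[of 18] by (simp_all add: s_def)
  have y: "x + 1 / x = 2 / s" using cot_plus_tan[of 18] by (simp add: x_def s_def)
  have treble: "3 * s - 4 * s ^ 3 = 1 / 2" using sin_treble[of "pi / 18"] by (simp add: s_def sin_30)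
  have "0.173647 < s"
    using treble_mono[of s "0.173647"] s treble by (rule_tac ccontr) (simp add: power3_eq_cube)
  moreover have "s < 0.1736485"
    using treble_mono[of "0.1736485" s] s treble by (rule_tac ccontr) (simp add: power3_eq_cube)
  ultimately have "11.51749 < 2 / s" "2 / s < 11.5176875"
    unfolding pos_less_divide_eq[OF s(1)] pos_divide_less_eq[OF s(1)] by simp_all
  moreover have "(11.43 :: real) + 1 / 11.43 < 11.51749" "(11.5176875 :: real) < 11.4302 + 1 / 11.4302" by simp_all
  ultimately have ineq: "11.43 + 1 / 11.43 < 2 / s" "2 / s < 11.4302 + 1 / 11.4302"
    by (blast intro: less_trans)+
  have "11.43 < x" "x < 11.4302"
    by (rule add_recip_bounds[OF _ y _ ineq]; use \<open>1 < x\<close> in simp)+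
  then show "\<bar>x - 11.4301\<bar> < 1 / 10 ^ 4" unfolding abs_less_iff by simp
  show "is_minimal_polynomial [:1, -12, 3, 40, 3, -12, 1:] x"
  proof (rule minimal_polynomial_E7)
    show "x + 1 / x = 4 * (1 / (2 * s))" using y by simp
    \<comment> \<open>The triple-angle cubic for \<open>s\<close>, rewritten for
      \<open>1 / (2 * s)\<close>, is monic and integral with constant term 1.\<close>
    have "(1 / (2 * s)) ^ 3 - 3 * (1 / (2 * s))\<^sup>2 + 1 = (1 / 2 - (3 * s - 4 * s ^ 3)) / (4 * s ^ 3)"
      using s by (simp add: field_simps power2_eq_square power3_eq_cube)
    then show "(1 / (2 * s)) ^ 3 - 3 * (1 / (2 * s))\<^sup>2 + 1 = 0" using treble by simp
  qed (use \<open>1 < x\<close> in simp)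
qed

lemma cot_E8:
  defines "x \<equiv> cot (pi / (2 * real 30))"
  shows "\<bar>x - 19.0811\<bar> < 1 / 10 ^ 4"
    "is_minimal_polynomial [:1, -16, -60, 16, 134, 16, -60, -16, 1:] x"
proof -
  define s where "s = sin (pi / real 30)"
  define u where "u = sin (pi / real 10)"
  have "1 < x" unfolding x_def by (rule cot_greater_1) simp
  have s: "0 < s" "s \<le> 1 / 2" using sin_pos_le_half[of 30] by (simp_all add: s_def)
  have u: "0 < u" using sin_pos_le_half[of 10] by (simp add: u_def)
  have y: "x + 1 / x = 2 / s" using cot_plus_tan[of 30] by (simp add: x_def s_def)
  have treble: "3 * s - 4 * s ^ 3 = u" using sin_treble[of "pi / 30"] by (simp add: s_def u_def)
  have u2: "4 * u\<^sup>2 + 2 * u - 1 = 0" using sin_18_quadratic by (simp add: u_def)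
  have u_le: "4 * a\<^sup>2 + 2 * a - 1 \<le> 0" if "0 \<le> a" "a \<le> u" for a
  proof -
    have "a\<^sup>2 \<le> u\<^sup>2" using that by (intro power_mono) auto
    then show ?thesis using that u2 by linarith
  qed
  have u_ge: "0 \<le> 4 * a\<^sup>2 + 2 * a - 1" if "u \<le> a" for a
  proof -
    have "u\<^sup>2 \<le> a\<^sup>2" using that u by (intro power_mono) auto
    then show ?thesis using that u2 by linarith
  qed
  have "0.1045282 < s"
  proof (rule ccontr)
    assume "\<not> 0.1045282 < s"
    then have "u \<le> 3 * 0.1045282 - 4 * 0.1045282 ^ 3"
      using treble_mono[of s "0.1045282"] s treble by simp
    from u_ge[OF this] show False by (simp add: power2_eq_square power3_eq_cube)
  qed
  moreover have "s < 0.1045289"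
  proof (rule ccontr)
    assume "\<not> s < 0.1045289"
    then have "3 * 0.1045289 - 4 * 0.1045289 ^ 3 \<le> u"
      using treble_mono[of "0.1045289" s] s treble by simp
    from u_le[OF _ this] show False by (simp add: power2_eq_square power3_eq_cube)
  qed
  ultimately have "19.133415 < 2 / s" "2 / s < 19.1336"
    unfolding pos_less_divide_eq[OF s(1)] pos_divide_less_eq[OF s(1)] by simp_all
  moreover have "(19.081 :: real) + 1 / 19.081 < 19.133415" "(19.1336 :: real) < 19.0812 + 1 / 19.0812" by simp_all
  ultimately have ineq: "19.081 + 1 / 19.081 < 2 / s" "2 / s < 19.0812 + 1 / 19.0812"
    by (blast intro: less_trans)+
  have "19.081 < x" "x < 19.0812"
    by (rule add_recip_bounds[OF _ y _ ineq]; use \<open>1 < x\<close> in simp)+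
  then show "\<bar>x - 19.0811\<bar> < 1 / 10 ^ 4" unfolding abs_less_iff by simp
  show "is_minimal_polynomial [:1, -16, -60, 16, 134, 16, -60, -16, 1:] x"
  proof (rule minimal_polynomial_E8)
    show "x + 1 / x = 4 * (1 / (2 * s))" using y by simp
    \<comment> \<open>Inserting the triple angle into the quadratic for \<open>u\<close> gives a
      sextic in \<open>s\<close>. Its quadratic factor belongs to the sines of 54 and -18 degrees
      and is negative for \<open>0 < s \<le> 1 / 2\<close>, so \<open>s\<close> is a root of the
      quartic.\<close>
    have "(16 * s ^ 4 + 8 * s ^ 3 - 16 * s\<^sup>2 - 8 * s + 1) * (4 * s\<^sup>2 - 2 * s - 1)
        = 4 * (3 * s - 4 * s ^ 3)\<^sup>2 + 2 * (3 * s - 4 * s ^ 3) - 1"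
      by (simp add: power2_eq_square power3_eq_cube power4_eq_xxxx algebra_simps)
    also have "\<dots> = 0" using u2 by (simp add: treble)
    finally have "16 * s ^ 4 + 8 * s ^ 3 - 16 * s\<^sup>2 - 8 * s + 1 = 0 \<or> 4 * s\<^sup>2 - 2 * s - 1 = 0" by simp
    moreover have "4 * s\<^sup>2 - 2 * s - 1 < 0"
    proof -
      have "s * (2 * s) \<le> s * 1" using s by (intro mult_left_mono) auto
      then show ?thesis by (simp add: power2_eq_square)
    qed
    ultimately have "16 * s ^ 4 + 8 * s ^ 3 - 16 * s\<^sup>2 - 8 * s + 1 = 0" by simp
    moreover have "(1 / (2 * s)) ^ 4 - 4 * (1 / (2 * s)) ^ 3 - 4 * (1 / (2 * s))\<^sup>2 + 1 / (2 * s) + 1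
        = (16 * s ^ 4 + 8 * s ^ 3 - 16 * s\<^sup>2 - 8 * s + 1) / (16 * s ^ 4)"
      using s by (simp add: field_simps power2_eq_square power3_eq_cube power4_eq_xxxx)
    ultimately show "(1 / (2 * s)) ^ 4 - 4 * (1 / (2 * s)) ^ 3 - 4 * (1 / (2 * s))\<^sup>2 + 1 / (2 * s) + 1 = 0"
      by simp
  qed (use \<open>1 < x\<close> in simp)
qed

section \<open>Growth in the infinite families\<close>

lemma linear_asymptotics:
  fixes f g :: "nat \<Rightarrow> real"
  assumes "\<And>l. k \<le> l \<Longrightarrow> f l = g l" "1 \<le> k" "(\<lambda>l. g l / real l) \<longlonglongrightarrow> L"
  shows "\<exists>e :: nat \<Rightarrow> real. e \<in> o(\<lambda>_. 1) \<and> (\<forall>l\<ge>k. f l = (L + e l) * real l)"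
\<comment> \<open>The error term is found by solving the equation for it, so only its limit has to
  be shown.\<close>
proof (intro exI[of _ "\<lambda>l. g l / real l - L"] conjI allI impI)
  have "(\<lambda>l. g l / real l - L) \<longlonglongrightarrow> L - L" using assms(3) by (intro tendsto_diff tendsto_const)
  then show "(\<lambda>l. g l / real l - L) \<in> o(\<lambda>_. 1)" by (intro smalloI_tendsto) auto
  show "f l = (L + (g l / real l - L)) * real l" if "k \<le> l" for l
    using assms(1)[OF that] assms(2) that by simp
qed

lemma asymptotics_A: "(\<lambda>l. cot (pi / (2 * real (Suc l))) / real l) \<longlonglongrightarrow> 2 / pi"
  unfolding cot_def of_nat_Suc by real_asymp

lemma asymptotics_B: "(\<lambda>l. cot (pi / (2 * real (2 * l))) / real l) \<longlonglongrightarrow> 4 / pi"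
  unfolding cot_def of_nat_mult by real_asymp

lemma asymptotics_D: "(\<lambda>l. cot (pi / (2 * real (2 * (l - 1)))) / real l) \<longlonglongrightarrow> 4 / pi"
proof (rule Lim_transform_eventually)
  \<comment> \<open>Real subtraction replaces the truncated one, with which it agrees for
    \<open>l \<ge> 1\<close>.\<close>
  show "(\<lambda>l. cot (pi / (4 * (real l - 1))) / real l) \<longlonglongrightarrow> 4 / pi"
    unfolding cot_def by real_asymp
  show "\<forall>\<^sub>F l in sequentially. cot (pi / (4 * (real l - 1))) / real l = cot (pi / (2 * real (2 * (l - 1)))) / real l"
    using eventually_ge_at_top[of 1] by eventually_elim (simp add: of_nat_diff)
qed

lemma asymptotics_I: "(\<lambda>m. cot (pi / (2 * real m)) / real m) \<longlonglongrightarrow> 2 / pi"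
  unfolding cot_def by real_asymp

theorem theorem7:
  fixes A B D E H I :: "nat \<Rightarrow> real mat set" and F4 :: "real mat set"
  assumes "\<And>l. l \<ge> 1 \<Longrightarrow> standard_representation (diagram_A l) (A l)"
    and "\<And>l. l \<ge> 2 \<Longrightarrow> standard_representation (diagram_B l) (B l)"
    and "\<And>l. l \<ge> 4 \<Longrightarrow> standard_representation (diagram_D l) (D l)"
    and "\<And>n. n \<in> {6, 7, 8} \<Longrightarrow> standard_representation (diagram_E n) (E n)"
    and "standard_representation diagram_F4 F4"
    and "\<And>n. n \<in> {3, 4} \<Longrightarrow> standard_representation (diagram_H n) (H n)"
    and "\<And>m. m \<ge> 3 \<Longrightarrow> standard_representation (diagram_I m) (I m)"
  shows
    "kappa 6 (E 6) = kappa 4 F4 \<and>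
       \<bar>kappa 6 (E 6) - 7.5957\<bar> < 1 / 10 ^ 4 \<and>
       is_minimal_polynomial [:1, 8, 2, -8, 1:] (kappa 6 (E 6)) \<and>
     \<bar>kappa 7 (E 7) - 11.4301\<bar> < 1 / 10 ^ 4 \<and>
       is_minimal_polynomial [:1, -12, 3, 40, 3, -12, 1:] (kappa 7 (E 7)) \<and>
     kappa 8 (E 8) = kappa 4 (H 4) \<and>
       \<bar>kappa 8 (E 8) - 19.0811\<bar> < 1 / 10 ^ 4 \<and>
       is_minimal_polynomial [:1, -16, -60, 16, 134, 16, -60, -16, 1:] (kappa 8 (E 8)) \<and>
     \<bar>kappa 3 (H 3) - 6.3137\<bar> < 1 / 10 ^ 4 \<and>
       is_minimal_polynomial [:1, -4, -14, -4, 1:] (kappa 3 (H 3)) \<and>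
     (\<exists>e :: nat \<Rightarrow> real. e \<in> o(\<lambda>_. 1) \<and>
        (\<forall>l\<ge>1. kappa l (A l) = (2 / pi + e l) * real l)) \<and>
     (\<exists>e :: nat \<Rightarrow> real. e \<in> o(\<lambda>_. 1) \<and>
        (\<forall>l\<ge>2. kappa l (B l) = (4 / pi + e l) * real l)) \<and>
     (\<exists>e :: nat \<Rightarrow> real. e \<in> o(\<lambda>_. 1) \<and>
        (\<forall>l\<ge>4. kappa l (D l) = (4 / pi + e l) * real l)) \<and>
     (\<forall>m\<ge>3. kappa 2 (I m) =
        sqrt ((1 + cos (pi / real m)) / (1 - cos (pi / real m)))) \<and>
     (\<exists>e :: nat \<Rightarrow> real. e \<in> o(\<lambda>_. 1) \<and>
        (\<forall>m\<ge>3. kappa 2 (I m) = (2 / pi + e m) * real m))"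
proof -
  \<comment> \<open>Types with the same Coxeter number share their constant: 12 for E6 and F4, 30
    for E8 and H4.\<close>
  have E6: "kappa 6 (E 6) = cot (pi / (2 * real 12))" by (intro kappa_E6 assms) simp
  have E7: "kappa 7 (E 7) = cot (pi / (2 * real 18))" by (intro kappa_E7 assms) simp
  have E8: "kappa 8 (E 8) = cot (pi / (2 * real 30))" by (intro kappa_E8 assms) simp
  have F4: "kappa 4 F4 = cot (pi / (2 * real 12))" by (intro kappa_F4 assms)
  have H3: "kappa 3 (H 3) = cot (pi / (2 * real 10))" by (intro kappa_H3 assms) simp
  have H4: "kappa 4 (H 4) = cot (pi / (2 * real 30))" by (intro kappa_H4 assms) simp
  have I: "kappa 2 (I m) = cot (pi / (2 * real m))" if "3 \<le> m" for m
    using that by (intro kappa_I assms)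
  have "\<forall>m\<ge>3. kappa 2 (I m) = sqrt ((1 + cos (pi / real m)) / (1 - cos (pi / real m)))"
    using I by (simp add: half_angle_quotient)
  moreover have "\<exists>e :: nat \<Rightarrow> real. e \<in> o(\<lambda>_. 1) \<and> (\<forall>l\<ge>1. kappa l (A l) = (2 / pi + e l) * real l)"
    by (intro linear_asymptotics[OF _ _ asymptotics_A] kappa_A assms) auto
  moreover have "\<exists>e :: nat \<Rightarrow> real. e \<in> o(\<lambda>_. 1) \<and> (\<forall>l\<ge>2. kappa l (B l) = (4 / pi + e l) * real l)"
    by (intro linear_asymptotics[OF _ _ asymptotics_B] kappa_B assms) auto
  moreover have "\<exists>e :: nat \<Rightarrow> real. e \<in> o(\<lambda>_. 1) \<and> (\<forall>l\<ge>4. kappa l (D l) = (4 / pi + e l) * real l)"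
    by (intro linear_asymptotics[OF _ _ asymptotics_D] kappa_D assms) auto
  moreover have "\<exists>e :: nat \<Rightarrow> real. e \<in> o(\<lambda>_. 1) \<and> (\<forall>m\<ge>3. kappa 2 (I m) = (2 / pi + e m) * real m)"
    by (intro linear_asymptotics[OF _ _ asymptotics_I] I) auto
  ultimately show ?thesis
    unfolding E6 E7 E8 F4 H3 H4 using cot_E6 cot_E7 cot_E8 cot_H3 by blast
qed

end
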